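(* (Weighted average derivative.) Let $X=(D,Z)$, let $m(w,\gamma)=S(u)\gamma(u,z)$, let $\varepsilon_n=\sqrt{\ln(p)/n}$, and suppose the following hold. (1) $b_j\in\Gamma$ for all $j$, and for every $\alpha\in\Gamma$ and $\varepsilon>0$ there are $p$ and $\rho\in\mathbb{R}^p$ with $\mathrm{E}[\{\alpha(X)-\sum_{j=1}^p\rho_jb_j(X)\}^2]<\varepsilon$. (2) There exist $C>1$, $\xi>0$ such that for each positive integer $s\le C\varepsilon_n^{-2/(2\xi+1)}$ there is $\bar\rho\in\mathbb{R}^p$ with $s$ nonzero elements such that $\Vert\bar\alpha-b'\bar\rho\Vert\le Cs^{-\xi}$. (3) $G$ has largest eigenvalue bounded uniformly in $n$, and there are $C,c>0$ such that for each $\ell$ and all integers $s=s_n\approx C\varepsilon_n^{-2}$ (i.e. $s_n\varepsilon_n^2\to C$), with probability approaching one, $$\min_{J\subset\{1,\dots,p\},\,|J|\le s}\ \min_{\Vert\rho_{J^c}\Vert_1\le3\Vert\rho_J\Vert_1,\ \rho_J\ne0}\frac{\rho'\hat G_\ell\rho}{\rho_J'\rho_J}\ge c.$$ (4) There is $C>0$ such that with probability one $\sup_j|b_j(X)|\le C$. (5) $\varepsilon_n=o(r)$, $r=o(n^c\varepsilon_n)$ for all $c>0$, and there exists $C>0$ such that $p\le Cn^C$. (6) $\mathrm{E}[\{Y-\bar\gamma(X)\}^2|X]$ and $\bar\alpha(X)$ are bounded. (7) With probability approaching one $\hat\gamma_\ell\in\Gamma$, and there is $d_\gamma>0$ such that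 $\Vert\hat\gamma_\ell-\bar\gamma\Vert=O_p(n^{-d_\gamma})$ for each $\ell$, and either (2) and (3) are satisfied with $\frac{\xi}{2\xi+1}+d_\gamma>\frac12$, or condition (S) below is satisfied and $d_\gamma>1/4$. (8) There is $C>0$ such that $|S(u)|\le C$ and $f(D|Z)^{-1}\omega(D)\le C$. Condition (S): $\bar\alpha(X)=\sum_{j=1}^\infty\rho_{j0}b_j(X)$, $\sum_{j=1}^\infty|\rho_{j0}|<\infty$, and for some $C>0$ and $\bar s=C\sqrt n$ the $b_j(x)$ corresponding to the largest $\bar s$ values of $|\rho_{j0}|$ are included in $b(x)$. Then $\sqrt n(\hat\theta-\bar\theta)\overset{d}{\to}N(0,V)$. If in addition condition (S) is satisfied then $\hat V\overset{p}{\to}V$.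
   Context: $W_1,\dots,W_n$ are i.i.d. copies of a data observation $W$ that includes a scalar $Y$ with $\mathrm{E}[Y^2]<\infty$, covariates $X=(D,Z)$ with $D$ a continuously distributed scalar with pdf $f(d|z)$ conditional on $Z=z$, and a random variable $U$ independent of $Z$ with known pdf $\omega(u)$ (one simulation draw from $\omega$). $S(u)=-\omega(u)^{-1}\partial\omega(u)/\partial u$. $\Gamma$ is a closed linear subspace of the space of functions $\gamma(X)$ with $\mathrm{E}[\gamma(X)^2]<\infty$. The Riesz representer is $\alpha_0(X)=f(D|Z)^{-1}\omega(D)S(D)$, satisfying $\mathrm{E}[m(W,\gamma)]=\mathrm{E}[\alpha_0(X)\gamma(X)]$ for all $\gamma$ with $\mathrm{E}[\gamma(X)^2]<\infty$. $\bar\alpha=\arg\min_{\alpha\in\Gamma}\mathrm{E}[\{\alpha_0(X)-\alpha(X)\}^2]$, $\bar\gamma=\arg\min_{\gamma\in\Gamma}\mathrm{E}[\{Y-\gamma(X)\}^2]$, and $$\bar\theta=\mathrm{E}[m(W,\bar\gamma)],\quad \psi(w)=m(w,\bar\gamma)-\bar\theta+\bar\alpha(x)[y-\bar\gamma(x)],\quad V=\mathrm{E}[\psi(W)^2].$$ $(b_j)_{j\ge1}$ is a sequence of functions of $x$; for each $n$, $b(x)=(b_1(x),\dots,b_p(x))'$ with $p=p_n\ge2$; $m(w,b)=(m(w,b_1),\dots,m(w,b_p))'$; $G=\mathrm{E}[b(X)b(X)']$. Cross-fitting: $L\ge2$ is fixed and $I_1,\dots,I_L$ is a partition of $\{1,\dots,n\}$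 into sets of about equal size, with $n_\ell=|I_\ell|$. For each $\ell$, $\hat\gamma_\ell$ is a regression learner computed only from observations not in $I_\ell$. With $r=r_n>0$, $$\hat M_\ell=\frac1{n-n_\ell}\sum_{i\notin I_\ell}m(W_i,b),\quad \hat G_\ell=\frac1{n-n_\ell}\sum_{i\notin I_\ell}b(X_i)b(X_i)',$$ $$\hat\rho_\ell\in\arg\min_{\rho\in\mathbb{R}^p}\{-2\hat M_\ell'\rho+\rho'\hat G_\ell\rho+2r\Vert\rho\Vert_1\},\quad \hat\alpha_\ell(x)=b(x)'\hat\rho_\ell .$$ The estimators are $$\hat\theta=\frac1n\sum_{\ell=1}^L\sum_{i\in I_\ell}\{m(W_i,\hat\gamma_\ell)+\hat\alpha_\ell(X_i)[Y_i-\hat\gamma_\ell(X_i)]\},$$ $$\hat V=\frac1n\sum_{\ell=1}^L\sum_{i\in I_\ell}\hat\psi_{i\ell}^2,\quad \hat\psi_{i\ell}=m(W_i,\hat\gamma_\ell)-\hat\theta+\hat\alpha_\ell(X_i)[Y_i-\hat\gamma_\ell(X_i)].$$ $\Vert a\Vert=\sqrt{\mathrm{E}[a(W)^2]}$, where for an estimated function the expectation is over a $W$ independent of the data with the estimate held fixed. $\Vert\cdot\Vert_1$ is the sum of absolute values of the entries. $\rho_J$ is the subvector of $\rho$ with indices in $J$, $\rho_{J^c}$ the remaining subvector. Limits are as $n\to\infty$. *)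

theory Defs
  imports
    "HOL-Probability.Probability"
    "HOL-Library.Landau_Symbols"
    "Jordan_Normal_Form.Char_Poly"
begin

section \<open>Modes of convergence\<close>

text \<open>Inner probability is used so that the notion is meaningful without a separate
  measurability claim for the events; for measurable events it says that the probabilities tend to 1.\<close>

definition with_prob_approaching_one :: "'o measure \<Rightarrow> (nat \<Rightarrow> 'o \<Rightarrow> bool) \<Rightarrow> bool" where
  "with_prob_approaching_one M Q \<longleftrightarrow>
     (\<exists>A. (\<forall>n. A n \<in> sets M \<and> (\<forall>\<omega>\<in>A n. Q n \<omega>)) \<and> (\<lambda>n. measure M (A n)) \<longlonglongrightarrow> 1)"

definition bigO_in_prob :: "'o measure \<Rightarrow> (nat \<Rightarrow> 'o \<Rightarrow> real) \<Rightarrow> (nat \<Rightarrow> real) \<Rightarrow> bool" where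
  "bigO_in_prob M X a \<longleftrightarrow>
     (\<forall>e>0. \<exists>K>0. \<exists>N. \<forall>n\<ge>N. measure M {\<omega> \<in> space M. \<bar>X n \<omega>\<bar> > K * \<bar>a n\<bar>} < e)"

definition tendsto_in_prob :: "'o measure \<Rightarrow> (nat \<Rightarrow> 'o \<Rightarrow> real) \<Rightarrow> real \<Rightarrow> bool" where
  "tendsto_in_prob M X c \<longleftrightarrow>
     (\<forall>e>0. (\<lambda>n. measure M {\<omega> \<in> space M. \<bar>X n \<omega> - c\<bar> > e}) \<longlonglongrightarrow> 0)"

text \<open>Normal law with given mean and variance; variance 0 yields the point mass
  (the library density with standard deviation 0 would not be a probability density).\<close>

definition normal_law :: "real \<Rightarrow> real \<Rightarrow> real measure" where
  "normal_law \<mu> v = distr std_normal_distribution borel (\<lambda>x. \<mu> + sqrt v * x)"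


section \<open>Mean-square spaces of functions of the covariates\<close>

text \<open>Throughout, \<open>P\<close> is the distribution of a generic observation \<open>W\<close>, so integrals over \<open>P\<close> are
  expectations over \<open>W\<close>, and \<open>X\<close>, \<open>Y\<close> etc. are coordinate functions of an observation.
  Functions are not identified when they agree almost surely.\<close>

definition L2_norm :: "'w measure \<Rightarrow> ('w \<Rightarrow> real) \<Rightarrow> real" where
  "L2_norm P a = sqrt (\<integral>w. (a w)\<^sup>2 \<partial>P)"

definition L2_functions :: "'w measure \<Rightarrow> 'x measure \<Rightarrow> ('w \<Rightarrow> 'x) \<Rightarrow> ('x \<Rightarrow> real) set" where
  "L2_functions P MX X = {\<gamma> \<in> borel_measurable MX. integrable P (\<lambda>w. (\<gamma> (X w))\<^sup>2)}"

definition closed_L2_subspace ::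
    "'w measure \<Rightarrow> 'x measure \<Rightarrow> ('w \<Rightarrow> 'x) \<Rightarrow> ('x \<Rightarrow> real) set \<Rightarrow> bool" where
  "closed_L2_subspace P MX X \<Gamma> \<longleftrightarrow>
     \<Gamma> \<subseteq> L2_functions P MX X \<and>
     (\<lambda>x. 0) \<in> \<Gamma> \<and>
     (\<forall>\<gamma>\<in>\<Gamma>. \<forall>\<gamma>'\<in>\<Gamma>. (\<lambda>x. \<gamma> x + \<gamma>' x) \<in> \<Gamma>) \<and>
     (\<forall>\<gamma>\<in>\<Gamma>. \<forall>c. (\<lambda>x. c * \<gamma> x) \<in> \<Gamma>) \<and>
     (\<forall>g \<gamma>. (\<forall>k::nat. g k \<in> \<Gamma>) \<longrightarrow> \<gamma> \<in> L2_functions P MX X \<longrightarrow>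
        (\<lambda>k. L2_norm P (\<lambda>w. g k (X w) - \<gamma> (X w))) \<longlonglongrightarrow> 0 \<longrightarrow> \<gamma> \<in> \<Gamma>)"


section \<open>The weighted average derivative functional\<close>

definition score :: "(real \<Rightarrow> real) \<Rightarrow> real \<Rightarrow> real" where
  "score pdf u = - (inverse (pdf u) * deriv pdf u)"

definition wad_moment ::
    "(real \<Rightarrow> real) \<Rightarrow> ('w \<Rightarrow> real) \<Rightarrow> ('w \<Rightarrow> 'z) \<Rightarrow> 'w \<Rightarrow> (real \<times> 'z \<Rightarrow> real) \<Rightarrow> real" where
  "wad_moment pdf U Z w \<gamma> = score pdf (U w) * \<gamma> (U w, Z w)"

definition wad_riesz :: "(real \<Rightarrow> 'z \<Rightarrow> real) \<Rightarrow> (real \<Rightarrow> real) \<Rightarrow> real \<times> 'z \<Rightarrow> real" where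
  "wad_riesz f pdf x = inverse (f (fst x) (snd x)) * pdf (fst x) * score pdf (fst x)"


section \<open>Dictionary, Gram matrices and Lasso\<close>

text \<open>The dictionary is the sequence \<open>b 0, b 1, \<dots>\<close>; with \<open>p\<close> terms it is indexed by \<open>{..<p}\<close>, and
  a vector of \<open>p\<close> coefficients is a function on the naturals of which only the values on
  \<open>{..<p}\<close> are ever used. In the sample quantities, \<open>T\<close> is the set of observations used and
  \<open>d i\<close> is the \<open>i\<close>-th observation.\<close>

definition lin_comb :: "(nat \<Rightarrow> 'x \<Rightarrow> real) \<Rightarrow> nat \<Rightarrow> (nat \<Rightarrow> real) \<Rightarrow> 'x \<Rightarrow> real" where
  "lin_comb b p \<rho> x = (\<Sum>j<p. b j x * \<rho> j)"

definition gram_matrix :: "'w measure \<Rightarrow> ('w \<Rightarrow> 'x) \<Rightarrow> (nat \<Rightarrow> 'x \<Rightarrow> real) \<Rightarrow> nat \<Rightarrow> real mat" where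
  "gram_matrix P X b p = mat p p (\<lambda>(j, k). \<integral>w. b j (X w) * b k (X w) \<partial>P)"

definition M_hat ::
    "('w \<Rightarrow> ('x \<Rightarrow> real) \<Rightarrow> real) \<Rightarrow> (nat \<Rightarrow> 'x \<Rightarrow> real) \<Rightarrow> nat set \<Rightarrow> (nat \<Rightarrow> 'w) \<Rightarrow> nat \<Rightarrow> real" where
  "M_hat m b T d j = (\<Sum>i\<in>T. m (d i) (b j)) / real (card T)"

definition G_hat ::
    "('w \<Rightarrow> 'x) \<Rightarrow> (nat \<Rightarrow> 'x \<Rightarrow> real) \<Rightarrow> nat set \<Rightarrow> (nat \<Rightarrow> 'w) \<Rightarrow> nat \<Rightarrow> nat \<Rightarrow> real" where
  "G_hat X b T d j k = (\<Sum>i\<in>T. b j (X (d i)) * b k (X (d i))) / real (card T)"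

definition quad_form :: "nat \<Rightarrow> (nat \<Rightarrow> nat \<Rightarrow> real) \<Rightarrow> (nat \<Rightarrow> real) \<Rightarrow> real" where
  "quad_form p G \<rho> = (\<Sum>j<p. \<Sum>k<p. \<rho> j * G j k * \<rho> k)"

definition lasso_objective ::
    "nat \<Rightarrow> real \<Rightarrow> (nat \<Rightarrow> real) \<Rightarrow> (nat \<Rightarrow> nat \<Rightarrow> real) \<Rightarrow> (nat \<Rightarrow> real) \<Rightarrow> real" where
  "lasso_objective p r M G \<rho> =
     - 2 * (\<Sum>j<p. M j * \<rho> j) + quad_form p G \<rho> + 2 * r * (\<Sum>j<p. \<bar>\<rho> j\<bar>)"


section \<open>Cross-fitted estimators\<close>

text \<open>Observations are numbered \<open>0, \<dots>, n - 1\<close> and folds \<open>0, \<dots>, L - 1\<close>. ``About equal size'' is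
  read asymptotically: each fold contains a fraction of the sample tending to \<open>1 / L\<close>.\<close>

definition cross_fit_folds :: "nat \<Rightarrow> (nat \<Rightarrow> nat \<Rightarrow> nat set) \<Rightarrow> bool" where
  "cross_fit_folds L I \<longleftrightarrow>
     (\<forall>n. (\<Union>l<L. I n l) = {..<n} \<and> disjoint_family_on (I n) {..<L}) \<and>
     (\<forall>l<L. (\<lambda>n. real (card (I n l)) / real n) \<longlonglongrightarrow> 1 / real L)"

definition theta_hat ::
    "('w \<Rightarrow> ('x \<Rightarrow> real) \<Rightarrow> real) \<Rightarrow> ('w \<Rightarrow> 'x) \<Rightarrow> ('w \<Rightarrow> real) \<Rightarrow> nat \<Rightarrow> nat \<Rightarrow> (nat \<Rightarrow> nat set) \<Rightarrow>
     (nat \<Rightarrow> 'x \<Rightarrow> real) \<Rightarrow> (nat \<Rightarrow> 'x \<Rightarrow> real) \<Rightarrow> (nat \<Rightarrow> 'w) \<Rightarrow> real" where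
  "theta_hat m X Y n L I \<gamma> \<alpha> d =
     (\<Sum>l<L. \<Sum>i\<in>I l. m (d i) (\<gamma> l) + \<alpha> l (X (d i)) * (Y (d i) - \<gamma> l (X (d i)))) / real n"

definition V_hat ::
    "('w \<Rightarrow> ('x \<Rightarrow> real) \<Rightarrow> real) \<Rightarrow> ('w \<Rightarrow> 'x) \<Rightarrow> ('w \<Rightarrow> real) \<Rightarrow> nat \<Rightarrow> nat \<Rightarrow> (nat \<Rightarrow> nat set) \<Rightarrow>
     (nat \<Rightarrow> 'x \<Rightarrow> real) \<Rightarrow> (nat \<Rightarrow> 'x \<Rightarrow> real) \<Rightarrow> (nat \<Rightarrow> 'w) \<Rightarrow> real" where
  "V_hat m X Y n L I \<gamma> \<alpha> d =
     (\<Sum>l<L. \<Sum>i\<in>I l. (m (d i) (\<gamma> l) - theta_hat m X Y n L I \<gamma> \<alpha> d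
        + \<alpha> l (X (d i)) * (Y (d i) - \<gamma> l (X (d i))))\<^sup>2) / real n"


section \<open>Rate, sparsity and eigenvalue conditions\<close>

definition eps_rate :: "(nat \<Rightarrow> nat) \<Rightarrow> nat \<Rightarrow> real" where
  "eps_rate p n = sqrt (ln (real (p n)) / real n)"

definition sparse_approx ::
    "'w measure \<Rightarrow> ('w \<Rightarrow> 'x) \<Rightarrow> (nat \<Rightarrow> 'x \<Rightarrow> real) \<Rightarrow> (nat \<Rightarrow> nat) \<Rightarrow> ('x \<Rightarrow> real) \<Rightarrow>
     real \<Rightarrow> real \<Rightarrow> bool" where
  "sparse_approx P X b p \<alpha> C \<xi> \<longleftrightarrow>
     (\<forall>n\<ge>1. \<forall>s\<ge>1. real s \<le> C * eps_rate p n powr (- 2 / (2 * \<xi> + 1)) \<longrightarrow>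
        (\<exists>\<rho>. card {j \<in> {..<p n}. \<rho> j \<noteq> 0} = s \<and>
             L2_norm P (\<lambda>w. \<alpha> (X w) - lin_comb b (p n) \<rho> (X w)) \<le> C * real s powr (- \<xi>)))"

definition restricted_eigenvalue_ge ::
    "nat \<Rightarrow> (nat \<Rightarrow> nat \<Rightarrow> real) \<Rightarrow> nat \<Rightarrow> real \<Rightarrow> bool" where
  "restricted_eigenvalue_ge p G s c \<longleftrightarrow>
     (\<forall>J \<rho>. J \<subseteq> {..<p} \<and> card J \<le> s \<and>
        (\<Sum>j\<in>{..<p} - J. \<bar>\<rho> j\<bar>) \<le> 3 * (\<Sum>j\<in>J. \<bar>\<rho> j\<bar>) \<and> (\<exists>j\<in>J. \<rho> j \<noteq> 0) \<longrightarrow>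
        quad_form p G \<rho> / (\<Sum>j\<in>J. (\<rho> j)\<^sup>2) \<ge> c)"

text \<open>\<open>T n l\<close> are the observations outside the \<open>l\<close>-th fold and \<open>W i \<omega>\<close> is the \<open>i\<close>-th
  observation.\<close>

definition eigenvalue_condition ::
    "'o measure \<Rightarrow> (nat \<Rightarrow> 'o \<Rightarrow> 'w) \<Rightarrow> 'w measure \<Rightarrow> ('w \<Rightarrow> 'x) \<Rightarrow> (nat \<Rightarrow> 'x \<Rightarrow> real) \<Rightarrow>
     (nat \<Rightarrow> nat) \<Rightarrow> nat \<Rightarrow> (nat \<Rightarrow> nat \<Rightarrow> nat set) \<Rightarrow> bool" where
  "eigenvalue_condition M W P X b p L T \<longleftrightarrow>
     (\<exists>B. \<forall>n\<ge>1. \<forall>k. eigenvalue (gram_matrix P X b (p n)) k \<longrightarrow> k \<le> B) \<and>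
     (\<exists>C>0. \<exists>c>0. \<forall>l<L. \<forall>s :: nat \<Rightarrow> nat.
        (\<lambda>n. real (s n) * (eps_rate p n)\<^sup>2) \<longlonglongrightarrow> C \<longrightarrow>
        with_prob_approaching_one M
          (\<lambda>n \<omega>. restricted_eigenvalue_ge (p n) (G_hat X b (T n l) (\<lambda>i. W i \<omega>)) (s n) c))"

text \<open>In the last clause \<open>J\<close> collects the indices of the \<open>\<lfloor>C \<surd>n\<rfloor>\<close> largest absolute coefficients,
  with ties broken arbitrarily.\<close>

definition summable_expansion ::
    "'w measure \<Rightarrow> ('w \<Rightarrow> 'x) \<Rightarrow> (nat \<Rightarrow> 'x \<Rightarrow> real) \<Rightarrow> (nat \<Rightarrow> nat) \<Rightarrow> ('x \<Rightarrow> real) \<Rightarrow> bool" where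
  "summable_expansion P X b p \<alpha> \<longleftrightarrow>
     (\<exists>\<rho>0 :: nat \<Rightarrow> real.
        (AE w in P. (\<lambda>j. \<rho>0 j * b j (X w)) sums \<alpha> (X w)) \<and>
        summable (\<lambda>j. \<bar>\<rho>0 j\<bar>) \<and>
        (\<exists>C>0. \<forall>n\<ge>1. \<exists>J\<subseteq>{..<p n}. card J = nat \<lfloor>C * sqrt (real n)\<rfloor> \<and>
           (\<forall>j\<in>J. \<forall>k. k \<notin> J \<longrightarrow> \<bar>\<rho>0 k\<bar> \<le> \<bar>\<rho>0 j\<bar>)))"

end

theory Submission
  imports Defs "HOL-Real_Asymp.Real_Asymp"
begin

text \<open>Write \<open>\<delta>\<close> and \<open>\<eta>\<close> for the errors of the two learners on a fold. The held-out summand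
  differs from \<open>\<psi> + \<theta>\<close> by \<open>[m(w, \<delta>) - \<alpha>\<delta>] + \<eta>(Y - \<gamma>) - \<eta>\<delta>\<close>, where \<open>\<alpha>\<close> and \<open>\<gamma>\<close> are the two
  projections on \<open>\<Gamma>\<close>. Given the training sample the first two terms have mean zero, because
  \<open>\<delta>\<close> and \<open>\<eta>\<close> lie in \<open>\<Gamma>\<close>, and vanishing variance; the third is small since the product of the
  two rates is of smaller order than \<open>n\<close> to the power \<open>-1/2\<close>.

  For the rate of the Lasso, a sparse approximation of \<open>\<alpha>\<close> is first improved by coordinate descent
  until every correlation of its residual with the dictionary is of the order of the penalty. Each
  step costs one more term and a fixed decrease of the squared error, so the result is still sparse
  (and its coefficients still have bounded sum), while the score of the Lasso at the improved
  coefficients is pure noise. This noise is controlled by Bernstein's inequality rather than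
  Hoeffding's, as the second moments are bounded but the suprema are not.\<close>


section \<open>Events of probability approaching one\<close>

text \<open>The obstacle is the bias of the Lasso score. A sparse approximation of
  \<open>\<alpha>\<close> with root mean squared error \<open>e\<close> only has correlations
  bounded by \<open>Cb * e\<close> with the dictionary, and \<open>e\<close> is of order
  \<open>\<epsilon>\<close> to the power \<open>2 * \<xi> / (2 * \<xi> + 1)\<close>, which is of
  larger order than the penalty \<open>r\<close>. As a comparison vector for the Lasso it would
  leave a bias that the penalty cannot absorb. The number of descent steps that repair this is of
  order \<open>e\<^sup>2 / r\<^sup>2\<close>, hence at most of order \<open>\<epsilon>\<close> to
  the power \<open>- 2 / (2 * \<xi> + 1)\<close>, which is the size of the support one starts with,
  so the rate does not suffer. A step at correlation \<open>E\<close> raises the sum of absolute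
  coefficients by at most \<open>\<bar>E\<bar> / Cb\<^sup>2\<close> and lowers the squared error by
  at least \<open>E\<^sup>2 / Cb\<^sup>2\<close>. Since \<open>\<bar>E\<bar>\<close> exceeds the
  threshold \<open>t\<close>, the potential formed by \<open>t\<close> times the coefficient sum
  plus the squared error never increases. Thus \<open>r\<close> times the coefficient sum stays
  bounded, and this is the range condition of Bernstein's inequality at deviations of order
  \<open>r\<close>.\<close>

lemma with_prob_approaching_one_conj:
  assumes "prob_space M" "with_prob_approaching_one M Q" "with_prob_approaching_one M R"
  shows "with_prob_approaching_one M (\<lambda>n \<omega>. Q n \<omega> \<and> R n \<omega>)"
proof -
  interpret prob_space M by fact
  obtain A B where A: "\<And>n. A n \<in> events" "\<And>n \<omega>. \<omega> \<in> A n \<Longrightarrow> Q n \<omega>" "(\<lambda>n. prob (A n)) \<longlonglongrightarrow> 1"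
    and B: "\<And>n. B n \<in> events" "\<And>n \<omega>. \<omega> \<in> B n \<Longrightarrow> R n \<omega>" "(\<lambda>n. prob (B n)) \<longlonglongrightarrow> 1"
    using assms(2,3) unfolding with_prob_approaching_one_def by blast
  have "prob (A n \<inter> B n) \<ge> prob (A n) + prob (B n) - 1" for n
  proof -
    have "prob (A n \<union> B n) = prob (A n) + prob (B n) - prob (A n \<inter> B n)"
      using A B by (intro measure_Un3) (auto simp: fmeasurable_eq_sets)
    then show ?thesis using prob_le_1[of "A n \<union> B n"] by simp
  qed
  moreover have "(\<lambda>n. prob (A n) + prob (B n) - 1) \<longlonglongrightarrow> 1"
    using tendsto_diff[OF tendsto_add[OF A(3) B(3)] tendsto_const[of 1]] by simp
  ultimately have "(\<lambda>n. prob (A n \<inter> B n)) \<longlonglongrightarrow> 1"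
    using real_tendsto_sandwich[of "\<lambda>n. prob (A n) + prob (B n) - 1" "\<lambda>n. prob (A n \<inter> B n)"
        sequentially "\<lambda>_. 1" 1] by simp
  then show ?thesis
    using A B unfolding with_prob_approaching_one_def
    by (intro exI[of _ "\<lambda>n. A n \<inter> B n"]) auto
qed

lemma with_prob_approaching_one_mono:
  assumes "with_prob_approaching_one M Q"
    and "eventually (\<lambda>n. \<forall>\<omega>\<in>space M. Q n \<omega> \<longrightarrow> R n \<omega>) sequentially"
  shows "with_prob_approaching_one M R"
proof -
  obtain A where A: "\<And>n. A n \<in> sets M" "\<And>n \<omega>. \<omega> \<in> A n \<Longrightarrow> Q n \<omega>" "(\<lambda>n. measure M (A n)) \<longlonglongrightarrow> 1"
    using assms(1) unfolding with_prob_approaching_one_def by blast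
  obtain N where N: "\<And>n \<omega>. n \<ge> N \<Longrightarrow> \<omega> \<in> space M \<Longrightarrow> Q n \<omega> \<Longrightarrow> R n \<omega>"
    using assms(2) unfolding eventually_sequentially by blast
  \<comment> \<open>Before \<open>N\<close> the implication may fail; the empty set satisfies
    \<open>R\<close> vacuously and leaves the limit unchanged.\<close>
  let ?B = "\<lambda>n. if n \<ge> N then A n else {}"
  have "(\<lambda>n. measure M (?B n)) \<longlonglongrightarrow> 1"
    using A(3) by (rule Lim_transform_eventually) (auto simp: eventually_sequentially)
  moreover have "R n \<omega>" if "\<omega> \<in> ?B n" for n \<omega>
    using that N[of n \<omega>] A(2)[of \<omega> n] sets.sets_into_space[OF A(1)[of n]]
    by (auto split: if_splits)
  ultimately show ?thesis
    using A(1) unfolding with_prob_approaching_one_def by (intro exI[of _ ?B]) auto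
qed

lemma with_prob_approaching_oneI:
  assumes "prob_space M" "\<And>n. {\<omega> \<in> space M. \<not> Q n \<omega>} \<in> sets M"
    and "(\<lambda>n. measure M {\<omega> \<in> space M. \<not> Q n \<omega>}) \<longlonglongrightarrow> 0"
  shows "with_prob_approaching_one M Q"
proof -
  interpret prob_space M by fact
  let ?A = "\<lambda>n. space M - {\<omega> \<in> space M. \<not> Q n \<omega>}"
  have "prob (?A n) = 1 - prob {\<omega> \<in> space M. \<not> Q n \<omega>}" for n
    using assms(2) by (rule prob_compl)
  then have "(\<lambda>n. prob (?A n)) \<longlonglongrightarrow> 1"
    using tendsto_diff[OF tendsto_const[of 1] assms(3)] by simp
  then show ?thesis using assms(2) unfolding with_prob_approaching_one_def
    by (intro exI[of _ ?A]) auto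
qed


text \<open>Lets a probability bound that is available only on the part of \<open>B n\<close> where
  \<open>Q\<close> holds carry over to all of \<open>B n\<close>. \<open>Q\<close> may be
  nonmeasurable: outside a measurable inner event of \<open>Q\<close> only vanishing mass is
  lost.\<close>

lemma prob_diff_with_prob_approaching_one:
  fixes S B :: "nat \<Rightarrow> 'o set"
  assumes "prob_space M" "with_prob_approaching_one M Q"
    and S: "\<And>n. S n \<in> sets M" and B: "\<And>n. B n \<in> sets M"
    and sub: "eventually (\<lambda>n. \<forall>\<omega>\<in>B n. Q n \<omega> \<longrightarrow> \<omega> \<in> S n) sequentially"
    and lim: "(\<lambda>n. measure M (S n)) \<longlonglongrightarrow> 0"
  shows "(\<lambda>n. measure M (B n)) \<longlonglongrightarrow> 0"
proof -
  interpret prob_space M by fact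
  obtain A where A: "\<And>n. A n \<in> events" "\<And>n \<omega>. \<omega> \<in> A n \<Longrightarrow> Q n \<omega>" "(\<lambda>n. prob (A n)) \<longlonglongrightarrow> 1"
    using assms(2) unfolding with_prob_approaching_one_def by blast
  have "eventually (\<lambda>n. prob (B n) \<le> prob (S n) + (1 - prob (A n))) sequentially"
    using sub
  proof eventually_elim
    case (elim n)
    have "prob (B n) \<le> prob (S n \<union> (space M - A n))"
      using elim A(1)[of n] A(2)[of _ n] S[of n] B[of n] sets.sets_into_space[OF B[of n]]
      by (intro finite_measure_mono) auto
    also have "\<dots> \<le> prob (S n) + prob (space M - A n)"
      using A S by (intro measure_Un_le) auto
    finally show ?case using prob_compl[OF A(1)] by simp
  qed
  moreover have "(\<lambda>n. prob (S n) + (1 - prob (A n))) \<longlonglongrightarrow> 0"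
    using tendsto_add[OF lim tendsto_diff[OF tendsto_const[of 1] A(3)]] by simp
  ultimately show ?thesis
    using real_tendsto_sandwich[of "\<lambda>_. 0" "\<lambda>n. prob (B n)" sequentially
        "\<lambda>n. prob (S n) + (1 - prob (A n))" 0] by simp
qed

section \<open>Deterministic Lasso inequalities\<close>

lemma sum_abs_le_sqrt_card:
  fixes v :: "'i \<Rightarrow> real"
  shows "(\<Sum>j\<in>J. \<bar>v j\<bar>) \<le> sqrt (real (card J)) * sqrt (\<Sum>j\<in>J. (v j)\<^sup>2)"
proof -
  have "(\<Sum>j\<in>J. \<bar>v j\<bar>)\<^sup>2 \<le> (\<Sum>j\<in>J. 1\<^sup>2) * (\<Sum>j\<in>J. \<bar>v j\<bar>\<^sup>2)"
    using Cauchy_Schwarz_ineq_sum[of "\<lambda>_. 1" "\<lambda>j. \<bar>v j\<bar>" J] by simp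
  then have "(\<Sum>j\<in>J. \<bar>v j\<bar>)\<^sup>2 \<le> real (card J) * (\<Sum>j\<in>J. (v j)\<^sup>2)"
    by simp
  then have "\<bar>\<Sum>j\<in>J. \<bar>v j\<bar>\<bar> \<le> sqrt (real (card J) * (\<Sum>j\<in>J. (v j)\<^sup>2))"
    using real_le_rsqrt by (metis real_sqrt_abs real_sqrt_le_iff)
  then show ?thesis by (simp add: real_sqrt_mult)
qed

lemma largest_subset:
  fixes g :: "'i \<Rightarrow> real"
  assumes "finite A" "k \<le> card A"
  shows "\<exists>N\<subseteq>A. card N = k \<and> (\<forall>i\<in>N. \<forall>j\<in>A - N. g j \<le> g i)"
  using assms(2)
proof (induction k)
  case 0
  then show ?case by (intro exI[of _ "{}"]) auto
next
  case (Suc k)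
  then obtain N where N: "N \<subseteq> A" "card N = k" "\<forall>i\<in>N. \<forall>j\<in>A - N. g j \<le> g i" by auto
  have fin: "finite N" "finite (A - N)" using N(1) assms(1) finite_subset by auto
  have ne: "A - N \<noteq> {}"
    using N Suc.prems fin by (metis Diff_eq_empty_iff Suc_n_not_le_n subset_antisym)
  obtain i where i: "i \<in> A - N" "\<And>j. j \<in> A - N \<Longrightarrow> g j \<le> g i"
    using finite_imageI[OF fin(2), of g] ne Max_in[of "g ` (A - N)"] Max_ge[of "g ` (A - N)"]
    by (metis (no_types, lifting) image_iff image_is_empty imageI)
  have "card (insert i N) = Suc k" using i N fin by simp
  then show ?case using i N by (intro exI[of _ "insert i N"]) auto
qed

text \<open>Once the \<open>k\<close> largest entries are removed, each remaining one is at most the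
  absolute sum divided by \<open>k\<close>, since \<open>k\<close> entries at least as large add up
  to no more than that sum. The inequality \<open>card N \<le> k\<close> covers index sets with
  fewer than \<open>k\<close> elements, where \<open>N = A\<close>.\<close>

lemma tail_sum_squares_le:
  fixes g :: "'i \<Rightarrow> real"
  assumes "finite A" "k \<ge> 1"
  shows "\<exists>N\<subseteq>A. card N \<le> k \<and> real k * (\<Sum>j\<in>A - N. (g j)\<^sup>2) \<le> (\<Sum>j\<in>A. \<bar>g j\<bar>)\<^sup>2"
proof (cases "k \<le> card A")
  case True
  obtain N where N: "N \<subseteq> A" "card N = k" "\<forall>i\<in>N. \<forall>j\<in>A - N. \<bar>g j\<bar> \<le> \<bar>g i\<bar>"
    using largest_subset[OF assms(1) True, of "\<lambda>i. \<bar>g i\<bar>"] by auto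
  let ?S = "\<Sum>j\<in>A. \<bar>g j\<bar>"
  have N_le: "(\<Sum>i\<in>N. \<bar>g i\<bar>) \<le> ?S" "(\<Sum>i\<in>A - N. \<bar>g i\<bar>) \<le> ?S"
    using assms(1) N(1) by (auto intro!: sum_mono2)
  have le: "real k * \<bar>g j\<bar> \<le> ?S" if "j \<in> A - N" for j
  proof -
    have "real k * \<bar>g j\<bar> = (\<Sum>i\<in>N. \<bar>g j\<bar>)" using N by simp
    also have "\<dots> \<le> (\<Sum>i\<in>N. \<bar>g i\<bar>)" using N(3) that by (intro sum_mono) auto
    finally show ?thesis using N_le by simp
  qed
  have "real k * (\<Sum>j\<in>A - N. (g j)\<^sup>2) = (\<Sum>j\<in>A - N. (real k * \<bar>g j\<bar>) * \<bar>g j\<bar>)"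
    by (simp add: sum_distrib_left power2_eq_square mult.assoc flip: abs_mult)
  also have "\<dots> \<le> (\<Sum>j\<in>A - N. ?S * \<bar>g j\<bar>)"
    using le by (intro sum_mono mult_right_mono) auto
  also have "\<dots> = ?S * (\<Sum>j\<in>A - N. \<bar>g j\<bar>)" by (simp add: sum_distrib_left)
  also have "\<dots> \<le> ?S * ?S" using N_le by (intro mult_left_mono) (auto intro: sum_nonneg)
  finally show ?thesis using N by (intro exI[of _ N]) (auto simp: power2_eq_square)
next
  case False
  then show ?thesis by (intro exI[of _ A]) auto
qed

text \<open>Optimality of \<open>v\<close> against an arbitrary center \<open>u\<close>: expanding
  the quadratic part around \<open>u\<close> leaves the score \<open>M - G u\<close> applied to
  \<open>v - u\<close>. The score bound \<open>r / 2\<close> makes this at most half as large as the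
  penalty of the same vector, and that slack drives both bounds below.\<close>

lemma lasso_basic_inequality:
  fixes G :: "nat \<Rightarrow> nat \<Rightarrow> real"
  assumes sym: "\<And>j k. G j k = G k j"
    and opt: "is_arg_min (lasso_objective p r M G) (\<lambda>_. True) v"
    and noise: "\<And>j. j < p \<Longrightarrow> \<bar>M j - (\<Sum>k<p. G j k * u k)\<bar> \<le> r / 2"
  shows "quad_form p G (\<lambda>j. v j - u j) + 2 * r * (\<Sum>j<p. \<bar>v j\<bar>)
    \<le> r * (\<Sum>j<p. \<bar>v j - u j\<bar>) + 2 * r * (\<Sum>j<p. \<bar>u j\<bar>)"
proof -
  let ?q = "\<lambda>a b. \<Sum>j<p. \<Sum>k<p. a j * G j k * b k"
  let ?N = "\<lambda>j. M j - (\<Sum>k<p. G j k * u k)"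
  have q_swap: "?q a b = ?q b a" for a b
    by (subst sum.swap) (intro sum.cong refl, metis sym mult.commute mult.left_commute)
  have quad: "quad_form p G (\<lambda>j. v j - u j) = quad_form p G v - 2 * ?q v u + quad_form p G u"
  proof -
    have "quad_form p G (\<lambda>j. v j - u j) = ?q v v - ?q v u - ?q u v + ?q u u"
      by (simp add: quad_form_def algebra_simps sum.distrib sum_subtractf)
    then show ?thesis using q_swap[of u v] by (simp add: quad_form_def)
  qed
  have le: "lasso_objective p r M G v \<le> lasso_objective p r M G u"
    using opt unfolding is_arg_min_def by (simp add: not_less)
  have "(\<Sum>j<p. ?N j * (v j - u j))
      = (\<Sum>j<p. M j * v j) - (\<Sum>j<p. M j * u j) - ?q v u + quad_form p G u"
    by (simp add: quad_form_def algebra_simps sum.distrib sum_subtractf sum_distrib_left)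
  moreover have "(\<Sum>j<p. ?N j * (v j - u j)) \<le> (\<Sum>j<p. r / 2 * \<bar>v j - u j\<bar>)"
  proof (rule sum_mono)
    fix j assume "j \<in> {..<p}"
    have "?N j * (v j - u j) \<le> \<bar>?N j\<bar> * \<bar>v j - u j\<bar>" by (simp flip: abs_mult)
    also have "\<dots> \<le> r / 2 * \<bar>v j - u j\<bar>"
      using noise \<open>j \<in> {..<p}\<close> by (intro mult_right_mono) auto
    finally show "?N j * (v j - u j) \<le> r / 2 * \<bar>v j - u j\<bar>" .
  qed
  moreover have "(\<Sum>j<p. r / 2 * \<bar>v j - u j\<bar>) = r / 2 * (\<Sum>j<p. \<bar>v j - u j\<bar>)"
    by (simp only: sum_distrib_left)
  ultimately have "(\<Sum>j<p. M j * v j) - (\<Sum>j<p. M j * u j) - ?q v u + quad_form p G u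
      \<le> r * (\<Sum>j<p. \<bar>v j - u j\<bar>) / 2"
    by (metis (no_types, lifting) times_divide_eq_left)
  then show ?thesis using le quad by (simp add: lasso_objective_def)
qed

text \<open>The triangle inequality for \<open>v - u\<close> uses up only half of the penalty on
  \<open>v\<close>; no eigenvalue enters. This is the version for the absolutely summable expansion,
  where the center is controlled through its coefficient sum.\<close>

lemma lasso_slow_bound:
  assumes sym: "\<And>j k. G j k = G k j"
    and psd: "\<And>v. quad_form p G v \<ge> 0" and "r > 0"
    and opt: "is_arg_min (lasso_objective p r M G) (\<lambda>_. True) v"
    and noise: "\<And>j. j < p \<Longrightarrow> \<bar>M j - (\<Sum>k<p. G j k * u k)\<bar> \<le> r / 2"
  shows "(\<Sum>j<p. \<bar>v j\<bar>) \<le> 3 * (\<Sum>j<p. \<bar>u j\<bar>)"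
    and "quad_form p G (\<lambda>j. v j - u j) \<le> 3 * r * (\<Sum>j<p. \<bar>u j\<bar>)"
proof -
  have "(\<Sum>j<p. \<bar>v j - u j\<bar>) \<le> (\<Sum>j<p. \<bar>v j\<bar>) + (\<Sum>j<p. \<bar>u j\<bar>)"
    by (simp add: sum.distrib[symmetric] sum_mono)
  then have "r * (\<Sum>j<p. \<bar>v j - u j\<bar>) \<le> r * ((\<Sum>j<p. \<bar>v j\<bar>) + (\<Sum>j<p. \<bar>u j\<bar>))"
    using \<open>r > 0\<close> by simp
  with lasso_basic_inequality[OF sym opt noise]
  have *: "quad_form p G (\<lambda>j. v j - u j) + r * (\<Sum>j<p. \<bar>v j\<bar>) \<le> 3 * r * (\<Sum>j<p. \<bar>u j\<bar>)"
    by (simp add: algebra_simps)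
  moreover have "r * (\<Sum>j<p. \<bar>v j\<bar>) \<ge> 0" using \<open>r > 0\<close> by (simp add: sum_nonneg)
  ultimately show "quad_form p G (\<lambda>j. v j - u j) \<le> 3 * r * (\<Sum>j<p. \<bar>u j\<bar>)" by linarith
  have "r * (\<Sum>j<p. \<bar>v j\<bar>) \<le> r * (3 * (\<Sum>j<p. \<bar>u j\<bar>))"
    using * psd[of "\<lambda>j. v j - u j"] by simp
  then show "(\<Sum>j<p. \<bar>v j\<bar>) \<le> 3 * (\<Sum>j<p. \<bar>u j\<bar>)" using \<open>r > 0\<close> by simp
qed

text \<open>The restricted eigenvalue is applied to the support of \<open>u\<close> enlarged by the \<open>k\<close> largest
  remaining entries of the error, so that it controls the whole error vector.\<close>

lemma lasso_fast_bound:
  assumes sym: "\<And>j k. G j k = G k j"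
    and psd: "\<And>v. quad_form p G v \<ge> 0" and "r > 0" and "c > 0"
    and opt: "is_arg_min (lasso_objective p r M G) (\<lambda>_. True) v"
    and noise: "\<And>j. j < p \<Longrightarrow> \<bar>M j - (\<Sum>k<p. G j k * u k)\<bar> \<le> r / 2"
    and supp: "card {j \<in> {..<p}. u j \<noteq> 0} \<le> k" and "k \<ge> 1" and "2 * k \<le> s"
    and re: "restricted_eigenvalue_ge p G s c"
  shows "(\<Sum>j<p. (v j - u j)\<^sup>2) \<le> 90 * r\<^sup>2 * real k / c\<^sup>2"
proof -
  define J where "J = {j \<in> {..<p}. u j \<noteq> 0}"
  define d where "d = (\<lambda>j. v j - u j)"
  have J: "J \<subseteq> {..<p}" "finite J" by (auto simp: J_def)
  have split: "(\<Sum>j<p. h j) = (\<Sum>j\<in>J. h j) + (\<Sum>j\<in>{..<p} - J. h j)" for h :: "nat \<Rightarrow> real"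
    using J by (subst sum.subset_diff[of J]) auto
  \<comment> \<open>Off the support of \<open>u\<close> the vectors \<open>v\<close> and
    \<open>v - u\<close> agree, so the penalty there bounds the error itself; on the support the
    reverse triangle inequality is used. The factor 3 is the cone constant of the restricted
    eigenvalue.\<close>
  have cone: "quad_form p G d + r * (\<Sum>j\<in>{..<p} - J. \<bar>d j\<bar>) \<le> 3 * r * (\<Sum>j\<in>J. \<bar>d j\<bar>)"
  proof -
    have out: "u j = 0" "\<bar>v j\<bar> = \<bar>d j\<bar>" if "j \<in> {..<p} - J" for j
      using that by (auto simp: J_def d_def)
    have "(\<Sum>j\<in>J. \<bar>u j\<bar>) \<le> (\<Sum>j\<in>J. \<bar>v j\<bar>) + (\<Sum>j\<in>J. \<bar>d j\<bar>)"
      unfolding sum.distrib[symmetric] by (intro sum_mono) (auto simp: d_def)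
    then have "r * (\<Sum>j\<in>J. \<bar>u j\<bar>) \<le> r * ((\<Sum>j\<in>J. \<bar>v j\<bar>) + (\<Sum>j\<in>J. \<bar>d j\<bar>))"
      using \<open>r > 0\<close> by simp
    moreover have "(\<Sum>j\<in>{..<p} - J. \<bar>u j\<bar>) = 0" using out by simp
    moreover have "(\<Sum>j\<in>{..<p} - J. \<bar>v j\<bar>) = (\<Sum>j\<in>{..<p} - J. \<bar>d j\<bar>)"
      using out by (intro sum.cong) auto
    ultimately show ?thesis
      using lasso_basic_inequality[OF sym opt noise] unfolding d_def[symmetric]
      by (simp add: split d_def algebra_simps)
  qed
  have l1: "(\<Sum>j\<in>{..<p} - J. \<bar>d j\<bar>) \<le> 3 * (\<Sum>j\<in>J. \<bar>d j\<bar>)"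
  proof -
    have "r * (\<Sum>j\<in>{..<p} - J. \<bar>d j\<bar>) \<le> r * (3 * (\<Sum>j\<in>J. \<bar>d j\<bar>))"
      using cone psd[of d] by simp
    then show ?thesis using \<open>r > 0\<close> by simp
  qed
  \<comment> \<open>\<open>J\<close> and \<open>N\<close> have at most \<open>k\<close> elements
    each, which is the reason for requiring \<open>2 * k \<le> s\<close>.\<close>
  obtain N where N: "N \<subseteq> {..<p} - J" "card N \<le> k"
    "real k * (\<Sum>j\<in>{..<p} - J - N. (d j)\<^sup>2) \<le> (\<Sum>j\<in>{..<p} - J. \<bar>d j\<bar>)\<^sup>2"
    using tail_sum_squares_le[of "{..<p} - J" k d] \<open>k \<ge> 1\<close> by auto
  define J' where "J' = J \<union> N"
  have finN: "finite N" using N(1) finite_subset by blast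
  have J': "J' \<subseteq> {..<p}" "finite J'" "J \<subseteq> J'" using J N finN by (auto simp: J'_def)
  have cJ': "card J' \<le> s"
    using card_Un_le[of J N] N(2) supp \<open>2 * k \<le> s\<close> by (simp only: J'_def J_def)
  let ?n = "\<lambda>A. \<Sum>j\<in>A. (d j)\<^sup>2"
  have JJ: "(\<Sum>j\<in>J. \<bar>d j\<bar>) \<le> sqrt (real k) * sqrt (?n J')"
  proof -
    have "(\<Sum>j\<in>J. \<bar>d j\<bar>) \<le> sqrt (real (card J)) * sqrt (?n J)" by (rule sum_abs_le_sqrt_card)
    also have "\<dots> \<le> sqrt (real k) * sqrt (?n J')"
      using supp[folded J_def] J' by (intro mult_mono real_sqrt_le_mono sum_mono2) (auto intro: sum_nonneg)
    finally show ?thesis .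
  qed
  \<comment> \<open>The form is at least \<open>c\<close> times the squared norm of \<open>d\<close>
    on \<open>J'\<close> and at most \<open>3 * r * sqrt k\<close> times that norm, so one factor of
    the norm cancels.\<close>
  have J'_bound: "c * sqrt (?n J') \<le> 3 * r * sqrt (real k)"
  proof (cases "\<exists>j\<in>J'. d j \<noteq> 0")
    case True
    then have pos: "?n J' > 0" using J'(2) by (meson sum_pos2 zero_le_power2 zero_less_power2)
    have "(\<Sum>j\<in>{..<p} - J'. \<bar>d j\<bar>) \<le> (\<Sum>j\<in>{..<p} - J. \<bar>d j\<bar>)"
      using J' by (intro sum_mono2) auto
    moreover have "(\<Sum>j\<in>J. \<bar>d j\<bar>) \<le> (\<Sum>j\<in>J'. \<bar>d j\<bar>)"
      using J' by (intro sum_mono2) auto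
    ultimately have "quad_form p G d / ?n J' \<ge> c"
      using re[unfolded restricted_eigenvalue_ge_def, rule_format, of J' d] J'(1) cJ' True l1
      by linarith
    then have "c * ?n J' \<le> quad_form p G d" using pos by (simp add: field_simps)
    also have "\<dots> \<le> 3 * r * (\<Sum>j\<in>J. \<bar>d j\<bar>)"
    proof -
      have "0 \<le> r * (\<Sum>j\<in>{..<p} - J. \<bar>d j\<bar>)" using \<open>r > 0\<close> by (simp add: sum_nonneg)
      then show ?thesis using cone by linarith
    qed
    also have "\<dots> \<le> 3 * r * (sqrt (real k) * sqrt (?n J'))"
      using JJ \<open>r > 0\<close> by (intro mult_left_mono) auto
    finally have "(c * sqrt (?n J')) * sqrt (?n J') \<le> (3 * r * sqrt (real k)) * sqrt (?n J')"
      using pos by (simp add: mult.assoc)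
    then show ?thesis using pos by (simp add: mult_le_cancel_right)
  next
    case False
    then have "?n J' = 0" by auto
    then show ?thesis using \<open>r > 0\<close> by simp
  qed
  have nn: "?n J' \<ge> 0" by (intro sum_nonneg) auto
  have "c\<^sup>2 * ?n J' \<le> 9 * r\<^sup>2 * real k"
  proof -
    have "(c * sqrt (?n J'))\<^sup>2 \<le> (3 * r * sqrt (real k))\<^sup>2"
      using J'_bound \<open>c > 0\<close> nn by (intro power_mono) auto
    then show ?thesis using nn by (simp add: power_mult_distrib)
  qed
  then have head: "?n J' \<le> 9 * r\<^sup>2 * real k / c\<^sup>2" using \<open>c > 0\<close> by (simp add: field_simps)
  \<comment> \<open>The squares outside \<open>J'\<close> are at most 9 times those inside, by the
    tail bound, the cone condition and Cauchy-Schwarz. The whole error is therefore at most 10 times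
    its head, and the head carries another factor 9, which gives the constant 90.\<close>
  have "real k * ?n ({..<p} - J') \<le> (\<Sum>j\<in>{..<p} - J. \<bar>d j\<bar>)\<^sup>2"
    using N(3) by (simp add: J'_def Diff_eq Int_assoc)
  also have "\<dots> \<le> (3 * (\<Sum>j\<in>J. \<bar>d j\<bar>))\<^sup>2"
    using l1 by (intro power_mono) (auto intro: sum_nonneg)
  also have "\<dots> \<le> (3 * (sqrt (real k) * sqrt (?n J')))\<^sup>2"
    using JJ by (intro power_mono) (auto intro: sum_nonneg)
  also have "\<dots> = real k * (9 * ?n J')" using nn by (simp add: power_mult_distrib)
  finally have tail: "?n ({..<p} - J') \<le> 9 * ?n J'" using \<open>k \<ge> 1\<close> by simp
  have "(\<Sum>j<p. (d j)\<^sup>2) = ?n J' + ?n ({..<p} - J')"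
    using J' by (subst sum.subset_diff[of J']) auto
  also have "\<dots> \<le> 10 * ?n J'" using tail by simp
  also have "\<dots> \<le> 90 * r\<^sup>2 * real k / c\<^sup>2" using head by simp
  finally show ?thesis by (simp add: d_def)
qed

section \<open>The largest eigenvalue bounds the quadratic form\<close>

text \<open>A first-order condition without derivatives. It serves the maximizer of a quadratic form
  on the sphere as well as the orthogonality of a mean-square projection.\<close>

lemma linear_coeff_zero_if_quadratic_nonpos:
  fixes a c :: real
  assumes "\<And>t. a * t + c * t\<^sup>2 \<le> 0"
  shows "a = 0"
proof (rule ccontr)
  assume "a \<noteq> 0"
  \<comment> \<open>The maximizer of \<open>a * t - (\<bar>c\<bar> + 1) * t\<^sup>2\<close>; adding
    1 keeps the denominator positive when \<open>c = 0\<close>.\<close>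
  define t where "t = a / (2 * (\<bar>c\<bar> + 1))"
  have "a * t + c * t\<^sup>2 \<ge> a * t - (\<bar>c\<bar> + 1) * t\<^sup>2"
    using mult_right_mono[of "- (\<bar>c\<bar> + 1)" c "t\<^sup>2"] abs_ge_minus_self[of c]
    by (simp add: algebra_simps)
  also have "a * t - (\<bar>c\<bar> + 1) * t\<^sup>2 = a\<^sup>2 / (4 * (\<bar>c\<bar> + 1))"
  proof -
    have "a * (a / (2 * d)) - d * (a / (2 * d))\<^sup>2 = a\<^sup>2 / (4 * d)" if "d > 0" for d :: real
      using that by (simp add: field_simps power2_eq_square)
    from this[of "\<bar>c\<bar> + 1"] show ?thesis by (simp add: t_def)
  qed
  finally have "a\<^sup>2 / (4 * (\<bar>c\<bar> + 1)) \<le> 0" using assms[of t] by simp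
  then show False using \<open>a \<noteq> 0\<close> by (simp add: divide_le_0_iff)
qed

text \<open>Rayleigh quotient: the form attains its maximum on the unit sphere, the maximizer is an
  eigenvector, and the maximal value is its eigenvalue, hence at most \<open>B\<close>. Homogeneity
  extends the bound to every vector.\<close>

lemma quad_form_le_eigenvalue_bound:
  fixes G :: "nat \<Rightarrow> nat \<Rightarrow> real"
  assumes sym: "\<And>j k. G j k = G k j"
    and ev: "\<And>k. eigenvalue (mat p p (\<lambda>(j, k). G j k)) k \<Longrightarrow> k \<le> B"
  shows "quad_form p G v \<le> B * (\<Sum>j<p. (v j)\<^sup>2)"
proof -
  let ?n = "\<lambda>v :: nat \<Rightarrow> real. \<Sum>j<p. (v j)\<^sup>2"
  \<comment> \<open>Coefficient vectors are functions on all naturals. Pinning the coordinates from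
    \<open>p\<close> on to 0 makes this product of intervals and points compact.\<close>
  define S where "S = (\<Pi>\<^sub>E j\<in>UNIV. if j < p then {-1..1::real} else {0})"
  define K where "K = S \<inter> {v. ?n v = 1}"
  have "compact S"
    using compactin_PiE[of "\<lambda>_::nat. euclideanreal" UNIV "\<lambda>j. if j < p then {-1..1::real} else {0}"]
    by (simp add: S_def euclidean_product_topology)
  have cont: "continuous_on UNIV (\<lambda>v::nat \<Rightarrow> real. v j)" for j
    by (rule continuous_on_product_coordinates)
  have "closed {v. ?n v = 1}"
    using cont by (intro closed_Collect_eq continuous_intros) auto
  then have "compact K" using \<open>compact S\<close> unfolding K_def by (rule compact_Int_closed[rotated])
  have cq: "continuous_on K (quad_form p G)"
    unfolding quad_form_def using continuous_on_subset[OF cont] by (intro continuous_intros) auto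
  have normalize: "(\<lambda>j. if j < p then w j / sqrt (?n w) else 0) \<in> K" if "?n w > 0" for w
  proof -
    have "\<bar>w j\<bar> \<le> sqrt (?n w)" if "j < p" for j
    proof -
      have "(w j)\<^sup>2 \<le> ?n w" using that by (intro member_le_sum) auto
      then show ?thesis using real_sqrt_le_mono by fastforce
    qed
    then have "\<bar>w j / sqrt (?n w)\<bar> \<le> 1" if "j < p" for j
      using that \<open>?n w > 0\<close> by simp
    then have "-1 \<le> w j / sqrt (?n w)" "w j / sqrt (?n w) \<le> 1" if "j < p" for j
      using that by (metis abs_le_iff minus_le_iff)+
    moreover have "(\<Sum>j<p. (w j / sqrt (?n w))\<^sup>2) = 1"
      using \<open>?n w > 0\<close> by (simp add: power_divide flip: sum_divide_distrib)
    ultimately show ?thesis by (auto simp: K_def S_def PiE_def extensional_def)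
  qed
  have scale: "quad_form p G (\<lambda>j. if j < p then w j / c else 0) = quad_form p G w / c\<^sup>2"
    if "c > 0" for w c
    using that by (simp add: quad_form_def power2_eq_square sum_divide_distrib)
  have nn: "?n w \<ge> 0" for w by (intro sum_nonneg) auto
  show ?thesis
  proof (cases "?n v > 0")
    case False
    then have "?n v = 0" using nn[of v] by linarith
    then have "\<forall>j<p. v j = 0" by (subst (asm) sum_nonneg_eq_0_iff) auto
    then show ?thesis using \<open>?n v = 0\<close> by (simp add: quad_form_def)
  next
    case True
    then have "K \<noteq> {}" using normalize by auto
    then obtain m where m: "m \<in> K" "\<And>w. w \<in> K \<Longrightarrow> quad_form p G w \<le> quad_form p G m"
      using continuous_attains_sup[OF \<open>compact K\<close> _ cq] by blast
    define \<mu> where "\<mu> = quad_form p G m"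
    have n1: "?n m = 1" using m by (simp add: K_def)
    have le: "quad_form p G w \<le> \<mu> * ?n w" for w
    proof (cases "?n w > 0")
      case True
      then have "quad_form p G w / ?n w \<le> \<mu>"
        using m(2)[OF normalize[OF True]] scale[of "sqrt (?n w)" w] by (simp add: \<mu>_def)
      then show ?thesis using True by (simp add: field_simps)
    next
      case False
      then have "?n w = 0" using nn[of w] by linarith
      then have "\<forall>j<p. w j = 0" by (subst (asm) sum_nonneg_eq_0_iff) auto
      then show ?thesis using \<open>?n w = 0\<close> by (simp add: quad_form_def)
    qed
    \<comment> \<open>Perturbing the maximizer by \<open>t\<close> in coordinate \<open>i\<close>
      turns \<open>le\<close> into a nonpositive quadratic polynomial in \<open>t\<close> that
      vanishes at 0. Its linear coefficient being 0 is row \<open>i\<close> of the eigenvector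
      equation.\<close>
    have stationary: "(\<Sum>k<p. G i k * m k) = \<mu> * m i" if "i < p" for i
    proof -
      let ?e = "\<lambda>t j. m j + t * (if j = i then 1 else 0)"
      let ?g = "\<Sum>k<p. G i k * m k"
      have g': "(\<Sum>k<p. m k * G k i) = ?g" by (simp add: sym[of i] mult.commute)
      have "quad_form p G (?e t) = \<mu> + 2 * t * ?g + t\<^sup>2 * G i i" for t
      proof -
        have "quad_form p G (?e t) = quad_form p G m
            + (\<Sum>j<p. \<Sum>k<p. m j * G j k * (t * (if k = i then 1 else 0)))
            + (\<Sum>j<p. \<Sum>k<p. t * (if j = i then 1 else 0) * G j k * m k)
            + (\<Sum>j<p. \<Sum>k<p. t * (if j = i then 1 else 0) * G j k * (t * (if k = i then 1 else 0)))"
          by (simp add: quad_form_def algebra_simps sum.distrib)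
        also have "(\<Sum>j<p. \<Sum>k<p. m j * G j k * (t * (if k = i then 1 else 0))) = t * ?g"
        proof -
          have "(\<Sum>k<p. m j * G j k * (t * (if k = i then 1 else 0))) = t * (m j * G j i)" for j
            using that by (simp add: if_distrib sum.delta' cong: if_cong)
          then show ?thesis using g' by (simp flip: sum_distrib_left)
        qed
        also have "(\<Sum>j<p. \<Sum>k<p. t * (if j = i then 1 else 0) * G j k * m k) = t * ?g"
        proof -
          have "(\<Sum>k<p. t * (if j = i then 1 else 0) * G j k * m k)
              = (if j = i then t * ?g else 0)" for j
            by (simp add: sum_distrib_left mult.assoc)
          then show ?thesis using that by (simp add: sum.delta')
        qed
        also have "(\<Sum>j<p. \<Sum>k<p. t * (if j = i then 1 else 0) * G j k * (t * (if k = i then 1 else 0)))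
            = t\<^sup>2 * G i i"
        proof -
          have "(\<Sum>k<p. t * (if j = i then 1 else 0) * G j k * (t * (if k = i then 1 else 0)))
              = (if j = i then t\<^sup>2 * G i i else 0)" for j
            using that by (simp add: if_distrib sum.delta' power2_eq_square cong: if_cong)
          then show ?thesis using that by (simp add: sum.delta')
        qed
        finally show ?thesis by (simp add: \<mu>_def)
      qed
      moreover have "?n (?e t) = 1 + 2 * t * m i + t\<^sup>2" for t
      proof -
        have "(?e t j)\<^sup>2 = (m j)\<^sup>2 + (if j = i then 2 * t * m i + t\<^sup>2 else 0)" for j
          by (simp add: power2_sum)
        then show ?thesis using that n1 by (simp add: sum.distrib sum.delta')
      qed
      ultimately have "(2 * ?g - 2 * \<mu> * m i) * t + (G i i - \<mu>) * t\<^sup>2 \<le> 0" for t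
        using le[of "?e t"] by (simp add: algebra_simps)
      then have "2 * ?g - 2 * \<mu> * m i = 0" by (rule linear_coeff_zero_if_quadratic_nonpos)
      then show ?thesis by simp
    qed
    have "eigenvector (mat p p (\<lambda>(j, k). G j k)) (vec p m) \<mu>"
      unfolding eigenvector_def
    proof (intro conjI)
      show "vec p m \<noteq> 0\<^sub>v (dim_row (mat p p (\<lambda>(j, k). G j k)))"
      proof
        assume "vec p m = 0\<^sub>v (dim_row (mat p p (\<lambda>(j, k). G j k)))"
        then have "m j = 0" if "j < p" for j
          using that by (metis dim_row_mat(1) index_vec index_zero_vec(1))
        then show False using n1 by simp
      qed
      show "mat p p (\<lambda>(j, k). G j k) *\<^sub>v vec p m = \<mu> \<cdot>\<^sub>v vec p m"
        using stationary by (intro eq_vecI) (auto simp: scalar_prod_def atLeast0LessThan)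
    qed simp
    then have "\<mu> \<le> B" using ev eigenvalue_def by blast
    then show ?thesis using le[of v] nn[of v] by (smt (verit) mult_right_mono)
  qed
qed

section \<open>Bernstein's inequality for i.i.d. observations\<close>

text \<open>For a centered variable with \<open>\<bar>l * X\<bar> \<le> 1\<close> this bounds the
  moment generating function by one plus \<open>l\<^sup>2\<close> times the second moment, so that
  the variance and not the range determines the exponent of the tail bound.\<close>

lemma exp_le_quadratic:
  fixes x :: real
  assumes "\<bar>x\<bar> \<le> 1"
  shows "exp x \<le> 1 + x + x\<^sup>2"
proof (cases "x \<ge> 0")
  case True
  then show ?thesis using exp_bound[of x] assms by simp
next
  case False
  \<comment> \<open>For negative \<open>x\<close>, \<open>exp x\<close> is the reciprocal of
    \<open>exp y\<close>, to which the quadratic Taylor lower bound applies.\<close>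
  define y where "y = - x"
  have y: "y \<ge> 0" using False by (simp add: y_def)
  have pos: "1 + y + y\<^sup>2 / 2 > 0" using y by (simp add: add_pos_nonneg)
  have "(1 - y + y\<^sup>2) * (1 + y + y\<^sup>2 / 2) = 1 + y\<^sup>2 / 2 + y ^ 3 / 2 + y ^ 4 / 2"
    by (simp add: field_simps power2_eq_square power3_eq_cube power4_eq_xxxx)
  then have "1 \<le> (1 - y + y\<^sup>2) * (1 + y + y\<^sup>2 / 2)" using y by simp
  then have "1 / (1 + y + y\<^sup>2 / 2) \<le> 1 - y + y\<^sup>2"
    using pos by (simp add: pos_divide_le_eq)
  moreover have "exp x \<le> 1 / (1 + y + y\<^sup>2 / 2)"
  proof -
    have "exp x = 1 / exp y" by (simp add: y_def exp_minus field_simps)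
    then show ?thesis using exp_lower_Taylor_quadratic[OF y] pos by (simp add: frac_le)
  qed
  ultimately show ?thesis by (simp add: y_def)
qed

locale iid_sample = M: prob_space M + P: prob_space P
  for M :: "'o measure" and P :: "'w measure" +
  fixes W :: "nat \<Rightarrow> 'o \<Rightarrow> 'w"
  assumes W_indep: "M.indep_vars (\<lambda>_. P) W UNIV" and W_distr: "\<And>i. distr M P (W i) = P"
begin

abbreviation whp :: "(nat \<Rightarrow> 'o \<Rightarrow> bool) \<Rightarrow> bool" where
  "whp \<equiv> with_prob_approaching_one M"

lemma W_measurable [measurable]: "W i \<in> measurable M P"
  using W_indep unfolding M.indep_vars_def by auto

lemma integral_W:
  fixes g :: "'w \<Rightarrow> real"
  assumes "g \<in> borel_measurable P"
  shows "(\<integral>\<omega>. g (W i \<omega>) \<partial>M) = (\<integral>w. g w \<partial>P)"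
  using integral_distr[OF W_measurable[of i] assms] by (simp add: W_distr)

lemma integrable_W:
  fixes g :: "'w \<Rightarrow> real"
  assumes "integrable P g"
  shows "integrable M (\<lambda>\<omega>. g (W i \<omega>))"
  using integrable_distr_eq[OF W_measurable[of i], of g] assms by (simp add: W_distr)

lemma AE_W:
  assumes "AE w in P. Q w"
  shows "AE \<omega> in M. Q (W i \<omega>)"
proof -
  have "AE w in distr M P (W i). Q w" unfolding W_distr by (rule assms)
  then show ?thesis by (rule AE_distrD[OF W_measurable])
qed

lemma indep_vars_W:
  fixes g :: "nat \<Rightarrow> 'w \<Rightarrow> real"
  assumes "\<And>i. i \<in> I \<Longrightarrow> g i \<in> borel_measurable P"
  shows "M.indep_vars (\<lambda>_. borel) (\<lambda>i \<omega>. g i (W i \<omega>)) I"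
  using M.indep_vars_compose2[OF M.indep_vars_subset[OF W_indep subset_UNIV], of I g "\<lambda>_. borel"] assms
  by simp

text \<open>Chernoff bound with \<open>l = t / (2 * s)\<close>, the minimizer of
  \<open>l\<^sup>2 * s - l * t\<close>. The condition \<open>t * B \<le> 2 * s\<close> says exactly
  that \<open>l * B \<le> 1\<close>, so the quadratic bound on the exponential is available; the
  range \<open>B\<close> does not appear in the exponent.\<close>

lemma bernstein_upper_tail:
  fixes X :: "'w \<Rightarrow> real"
  assumes [measurable]: "X \<in> borel_measurable P" and bdd: "AE w in P. \<bar>X w\<bar> \<le> B"
    and mean: "(\<integral>w. X w \<partial>P) = 0" and var: "(\<integral>w. (X w)\<^sup>2 \<partial>P) \<le> s" and "s > 0"
    and "t > 0" and tB: "t * B \<le> 2 * s" and "finite T"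
  shows "M.prob {\<omega> \<in> space M. (\<Sum>i\<in>T. X (W i \<omega>)) \<ge> real (card T) * t}
    \<le> exp (- (real (card T) * t\<^sup>2 / (4 * s)))"
proof -
  define l where "l = t / (2 * s)"
  have l: "l > 0" "l * B \<le> 1" using assms by (auto simp: l_def field_simps)
  have lX: "AE w in P. \<bar>l * X w\<bar> \<le> 1"
    using bdd
  proof eventually_elim
    case (elim w)
    have "\<bar>l * X w\<bar> \<le> l * B" using elim l by (simp add: abs_mult)
    then show ?case using l by simp
  qed
  have intX: "integrable P X" "integrable P (\<lambda>w. (X w)\<^sup>2)"
  proof -
    show "integrable P X" using bdd by (intro P.integrable_const_bound[of X B]) auto
    have "AE w in P. norm ((X w)\<^sup>2) \<le> B\<^sup>2"
      using bdd by eventually_elim (simp add: abs_le_square_iff[symmetric])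
    then show "integrable P (\<lambda>w. (X w)\<^sup>2)" by (intro P.integrable_const_bound[of _ "B\<^sup>2"]) auto
  qed
  have int_exp: "integrable P (\<lambda>w. exp (l * X w))"
  proof (rule P.integrable_const_bound[of _ "exp 1"])
    show "AE w in P. norm (exp (l * X w)) \<le> exp 1" using lX by eventually_elim auto
  qed simp
  have mgf: "(\<integral>w. exp (l * X w) \<partial>P) \<le> exp (l\<^sup>2 * s)"
  proof -
    have "(\<integral>w. exp (l * X w) \<partial>P) \<le> (\<integral>w. 1 + l * X w + l\<^sup>2 * (X w)\<^sup>2 \<partial>P)"
    proof (rule integral_mono_AE)
      show "AE w in P. exp (l * X w) \<le> 1 + l * X w + l\<^sup>2 * (X w)\<^sup>2"
        using lX by eventually_elim (use exp_le_quadratic in \<open>force simp: power_mult_distrib\<close>)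
    qed (use int_exp intX in auto)
    also have "\<dots> = 1 + l\<^sup>2 * (\<integral>w. (X w)\<^sup>2 \<partial>P)" using intX mean by (simp add: P.prob_space)
    also have "\<dots> \<le> 1 + l\<^sup>2 * s" using var by (simp add: mult_left_mono)
    also have "\<dots> \<le> exp (l\<^sup>2 * s)" by (rule exp_ge_add_one_self)
    finally show ?thesis .
  qed
  have prod: "(\<integral>\<omega>. (\<Prod>i\<in>T. exp (l * X (W i \<omega>))) \<partial>M) = (\<Prod>i\<in>T. (\<integral>\<omega>. exp (l * X (W i \<omega>)) \<partial>M))"
    and int_prod: "integrable M (\<lambda>\<omega>. \<Prod>i\<in>T. exp (l * X (W i \<omega>)))"
    using M.indep_vars_lebesgue_integral[OF \<open>finite T\<close> indep_vars_W[of T "\<lambda>_ w. exp (l * X w)"]]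
      M.indep_vars_integrable[OF \<open>finite T\<close> indep_vars_W[of T "\<lambda>_ w. exp (l * X w)"]]
      integrable_W[OF int_exp] by simp_all
  let ?S = "\<lambda>\<omega>. \<Sum>i\<in>T. X (W i \<omega>)"
  have "{\<omega> \<in> space M. ?S \<omega> \<ge> real (card T) * t}
      = {\<omega> \<in> space M. (\<Prod>i\<in>T. exp (l * X (W i \<omega>))) \<ge> exp (l * (real (card T) * t))}"
    using l \<open>finite T\<close> by (simp add: exp_sum[symmetric] sum_distrib_left[symmetric])
  also have "M.prob \<dots> \<le> (\<integral>\<omega>. (\<Prod>i\<in>T. exp (l * X (W i \<omega>))) \<partial>M) / exp (l * (real (card T) * t))"
    by (rule integral_Markov_inequality_measure[OF int_prod, of "{}"]) (auto simp: prod_nonneg)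
  also have "\<dots> \<le> exp (l\<^sup>2 * s) ^ card T / exp (l * (real (card T) * t))"
    unfolding prod using mgf
    by (intro divide_right_mono) (auto simp: integral_W[of "\<lambda>w. exp (l * X w)"] intro!: power_mono)
  also have "\<dots> = exp (- (real (card T) * t\<^sup>2 / (4 * s)))"
  proof -
    have "real (card T) * (l\<^sup>2 * s) - l * (real (card T) * t) = - (real (card T) * t\<^sup>2 / (4 * s))"
      using \<open>s > 0\<close> by (simp add: l_def field_simps power2_eq_square)
    then show ?thesis by (simp add: exp_of_nat_mult[symmetric] exp_diff[symmetric])
  qed
  finally show ?thesis .
qed

text \<open>Centering at most doubles the range and does not increase the second moment, so
  \<open>t * B \<le> s\<close> here becomes \<open>t * (2 * B) \<le> 2 * s\<close> in the one-sided
  bound.\<close>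

lemma bernstein_two_sided:
  fixes X :: "'w \<Rightarrow> real"
  assumes [measurable]: "X \<in> borel_measurable P" and bdd: "AE w in P. \<bar>X w\<bar> \<le> B"
    and var: "(\<integral>w. (X w)\<^sup>2 \<partial>P) \<le> s" and "s > 0"
    and "t > 0" and tB: "t * B \<le> s" and "finite T" and "T \<noteq> {}"
  shows "M.prob {\<omega> \<in> space M. \<bar>(\<Sum>i\<in>T. X (W i \<omega>)) / real (card T) - (\<integral>w. X w \<partial>P)\<bar> > t}
    \<le> 2 * exp (- (real (card T) * t\<^sup>2 / (4 * s)))"
proof -
  let ?m = "\<integral>w. X w \<partial>P"
  have cT: "real (card T) > 0" using \<open>finite T\<close> \<open>T \<noteq> {}\<close> by (simp add: card_gt_0_iff)
  have intX: "integrable P X" "integrable P (\<lambda>w. (X w)\<^sup>2)"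
  proof -
    show "integrable P X" using bdd by (intro P.integrable_const_bound[of X B]) auto
    have "AE w in P. norm ((X w)\<^sup>2) \<le> B\<^sup>2"
      using bdd by eventually_elim (simp add: abs_le_square_iff[symmetric])
    then show "integrable P (\<lambda>w. (X w)\<^sup>2)" by (intro P.integrable_const_bound[of _ "B\<^sup>2"]) auto
  qed
  have m: "\<bar>?m\<bar> \<le> B"
  proof -
    have "\<bar>?m\<bar> \<le> (\<integral>w. \<bar>X w\<bar> \<partial>P)" by (rule integral_abs_bound)
    also have "\<dots> \<le> (\<integral>w. B \<partial>P)" using intX bdd by (intro integral_mono_AE) auto
    finally show ?thesis by (simp add: P.prob_space)
  qed
  have bdd': "AE w in P. \<bar>X w - ?m\<bar> \<le> 2 * B" "AE w in P. \<bar>?m - X w\<bar> \<le> 2 * B"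
    using bdd m by (auto elim!: eventually_mono)
  have mean': "(\<integral>w. X w - ?m \<partial>P) = 0" "(\<integral>w. ?m - X w \<partial>P) = 0"
    using intX by (simp_all add: P.prob_space)
  have var': "(\<integral>w. (X w - ?m)\<^sup>2 \<partial>P) \<le> s" "(\<integral>w. (?m - X w)\<^sup>2 \<partial>P) \<le> s"
  proof -
    have "(\<integral>w. (X w - ?m)\<^sup>2 \<partial>P) = (\<integral>w. (X w)\<^sup>2 \<partial>P) - ?m\<^sup>2"
      using P.variance_eq[OF intX] by simp
    then show *: "(\<integral>w. (X w - ?m)\<^sup>2 \<partial>P) \<le> s" using var by (simp add: add_increasing2 diff_le_eq)
    then show "(\<integral>w. (?m - X w)\<^sup>2 \<partial>P) \<le> s" by (simp add: power2_commute)
  qed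
  let ?U = "{\<omega> \<in> space M. (\<Sum>i\<in>T. X (W i \<omega>) - ?m) \<ge> real (card T) * t}"
  let ?L = "{\<omega> \<in> space M. (\<Sum>i\<in>T. ?m - X (W i \<omega>)) \<ge> real (card T) * t}"
  have sub: "{\<omega> \<in> space M. \<bar>(\<Sum>i\<in>T. X (W i \<omega>)) / real (card T) - ?m\<bar> > t} \<subseteq> ?U \<union> ?L"
    using cT by (auto simp: abs_if sum_subtractf field_simps split: if_splits)
  have "M.prob {\<omega> \<in> space M. \<bar>(\<Sum>i\<in>T. X (W i \<omega>)) / real (card T) - ?m\<bar> > t} \<le> M.prob (?U \<union> ?L)"
    using sub by (intro M.finite_measure_mono) auto
  also have "\<dots> \<le> M.prob ?U + M.prob ?L" by (intro measure_Un_le) auto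
  also have "\<dots> \<le> exp (- (real (card T) * t\<^sup>2 / (4 * s))) + exp (- (real (card T) * t\<^sup>2 / (4 * s)))"
    using bernstein_upper_tail[of "\<lambda>w. X w - ?m" "2 * B" s t T, OF _ bdd'(1) mean'(1) var'(1)]
      bernstein_upper_tail[of "\<lambda>w. ?m - X w" "2 * B" s t T, OF _ bdd'(2) mean'(2) var'(2)] assms
    by (intro add_mono) auto
  finally show ?thesis by simp
qed

text \<open>A union over at most \<open>p\<^sup>2\<close> functions (the size needed for all Gram
  entries) costs \<open>2 * ln p\<close> in the exponent, while \<open>n * r\<^sup>2\<close> exceeds
  every multiple of \<open>ln p\<close> because \<open>eps_rate p\<close> is \<open>o(r)\<close>. As
  \<open>p\<close> may stay bounded, the limit 0 comes from the freedom in that multiple: the bound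
  \<open>2 * exp (- A * ln 2)\<close> holds eventually for every \<open>A > 0\<close>.\<close>

lemma bernstein_union:
  fixes X :: "nat \<Rightarrow> 'j \<Rightarrow> 'w \<Rightarrow> real"
  assumes meas: "\<And>n j. j \<in> J n \<Longrightarrow> X n j \<in> borel_measurable P"
    and bdd: "\<And>n j. j \<in> J n \<Longrightarrow> AE w in P. \<bar>X n j w\<bar> \<le> B n"
    and var: "eventually (\<lambda>n. \<forall>j\<in>J n. (\<integral>w. (X n j w)\<^sup>2 \<partial>P) \<le> s) sequentially" and "s > 0"
    and rB: "eventually (\<lambda>n. r n * B n \<le> s) sequentially"
    and r: "\<And>n. n \<ge> 1 \<Longrightarrow> r n > 0" "eps_rate p \<in> o(r)" and p: "\<And>n. n \<ge> 1 \<Longrightarrow> p n \<ge> 2"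
    and J: "\<And>n. finite (J n)" "\<And>n. card (J n) \<le> (p n)\<^sup>2"
    and T: "\<And>n. finite (T n)" "c0 > 0" "eventually (\<lambda>n. real (card (T n)) \<ge> c0 * real n) sequentially"
    and \<kappa>: "\<kappa> > 0" "\<kappa> \<le> 1"
  shows "whp (\<lambda>n \<omega>. \<forall>j\<in>J n.
    \<bar>(\<Sum>i\<in>T n. X n j (W i \<omega>)) / real (card (T n)) - (\<integral>w. X n j w \<partial>P)\<bar> \<le> \<kappa> * r n)"
proof (rule with_prob_approaching_oneI[OF M.prob_space_axioms])
  let ?D = "\<lambda>n j \<omega>. \<bar>(\<Sum>i\<in>T n. X n j (W i \<omega>)) / real (card (T n)) - (\<integral>w. X n j w \<partial>P)\<bar>"
  let ?E = "\<lambda>n. {\<omega> \<in> space M. \<not> (\<forall>j\<in>J n. ?D n j \<omega> \<le> \<kappa> * r n)}"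
  let ?F = "\<lambda>n j. {\<omega> \<in> space M. ?D n j \<omega> > \<kappa> * r n}"
  have E: "?E n = (\<Union>j\<in>J n. ?F n j)" for n by (auto simp: not_le)
  have F: "?F n j \<in> M.events" if "j \<in> J n" for n j
  proof -
    note meas[OF that, measurable]
    show ?thesis by measurable
  qed
  then show "?E n \<in> M.events" for n unfolding E using J by auto
  define K where "K = c0 * \<kappa>\<^sup>2 / (4 * s)"
  have "K > 0" using T \<kappa> \<open>s > 0\<close> by (simp add: K_def)
  have bound: "eventually (\<lambda>n. M.prob (?E n) \<le> 2 * exp (- A * ln 2)) sequentially" if "A > 0" for A
  proof -
    \<comment> \<open>Eventually \<open>r n\<close> is at least \<open>m\<close> times the basic
      rate. The value is chosen so that the exponent becomes \<open>(2 + A) * ln p\<close>: 2 for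
      the union over \<open>p\<^sup>2\<close> functions and \<open>A\<close> to spare.\<close>
    define m where "m = sqrt ((2 + A) / K)"
    have m: "m > 0" "K * m\<^sup>2 = 2 + A" using \<open>K > 0\<close> that by (auto simp: m_def)
    have "eventually (\<lambda>n. norm (eps_rate p n) \<le> 1 / m * norm (r n)) sequentially"
      using landau_o.smallD[OF r(2), of "1 / m"] m by simp
    then show ?thesis using var rB T(3) eventually_ge_at_top[of 1]
    proof eventually_elim
      case (elim n)
      have rn: "r n > 0" and pn: "p n \<ge> 2" using r p elim by auto
      have lnp: "ln (real (p n)) \<ge> ln 2" "ln (real (p n)) > 0" using pn by auto
      have "(eps_rate p n)\<^sup>2 = ln (real (p n)) / real n" using lnp by (simp add: eps_rate_def)
      moreover have "(m * eps_rate p n)\<^sup>2 \<le> (r n)\<^sup>2"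
      proof -
        have "\<bar>m * eps_rate p n\<bar> \<le> \<bar>r n\<bar>" using elim(1) m by (simp add: abs_mult field_simps)
        then show ?thesis by (simp only: abs_le_square_iff)
      qed
      ultimately have "m\<^sup>2 * ln (real (p n)) / real n \<le> (r n)\<^sup>2" by (simp add: power_mult_distrib)
      then have nr: "m\<^sup>2 * ln (real (p n)) \<le> real n * (r n)\<^sup>2" using elim by (simp add: field_simps)
      have "0 < c0 * real n" using elim \<open>c0 > 0\<close> by simp
      then have T0: "T n \<noteq> {}" using elim(4) by auto
      have e: "exp (- (real (card (T n)) * (\<kappa> * r n)\<^sup>2 / (4 * s))) \<le> exp (- (2 + A) * ln (real (p n)))"
      proof -
        have "(2 + A) * ln (real (p n)) = K * (m\<^sup>2 * ln (real (p n)))" using m by (simp add: mult.assoc[symmetric])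
        also have "\<dots> \<le> K * (real n * (r n)\<^sup>2)" using nr \<open>K > 0\<close> by simp
        also have "\<dots> = (c0 * real n) * (\<kappa> * r n)\<^sup>2 / (4 * s)" by (simp add: K_def power_mult_distrib)
        also have "\<dots> \<le> real (card (T n)) * (\<kappa> * r n)\<^sup>2 / (4 * s)"
          using mult_right_mono[OF elim(4), of "(\<kappa> * r n)\<^sup>2"] \<open>s > 0\<close>
          by (intro divide_right_mono) auto
        finally show ?thesis by (simp add: algebra_simps)
      qed
      have "M.prob (?E n) \<le> (\<Sum>j\<in>J n. M.prob (?F n j))"
        unfolding E by (rule measure_UNION_le[OF J(1) F])
      also have "\<dots> \<le> (\<Sum>j\<in>J n. 2 * exp (- (2 + A) * ln (real (p n))))"
      proof (rule sum_mono)
        fix j assume j: "j \<in> J n"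
        have "\<kappa> * r n * B n \<le> s"
        proof (cases "B n \<ge> 0")
          case True
          then have "\<kappa> * (r n * B n) \<le> 1 * (r n * B n)" using \<kappa> rn by (intro mult_right_mono) auto
          then show ?thesis using elim by (simp add: mult.assoc)
        next
          case False
          then have "\<kappa> * r n * B n \<le> 0" using \<kappa> rn by (simp add: mult_nonneg_nonpos)
          then show ?thesis using \<open>s > 0\<close> by simp
        qed
        then have "M.prob (?F n j) \<le> 2 * exp (- (real (card (T n)) * (\<kappa> * r n)\<^sup>2 / (4 * s)))"
          using bernstein_two_sided[of "X n j" "B n" s "\<kappa> * r n" "T n"] meas[OF j] bdd[OF j] elim j
            \<open>s > 0\<close> \<kappa> rn T(1) T0 by simp
        then show "M.prob (?F n j) \<le> 2 * exp (- (2 + A) * ln (real (p n)))"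
          using e by linarith
      qed
      also have "\<dots> = real (card (J n)) * (2 * exp (- (2 + A) * ln (real (p n))))" by simp
      also have "\<dots> \<le> (real (p n))\<^sup>2 * (2 * exp (- (2 + A) * ln (real (p n))))"
        using J(2)[of n] by (intro mult_right_mono) (auto simp flip: of_nat_power)
      also have "\<dots> = 2 * exp (- A * ln (real (p n)))"
      proof -
        have "(real (p n))\<^sup>2 = exp (2 * ln (real (p n)))"
          using pn by (simp add: exp_of_nat_mult[of 2, simplified] power2_eq_square exp_double)
        then show ?thesis by (simp add: exp_add[symmetric] algebra_simps)
      qed
      also have "\<dots> \<le> 2 * exp (- A * ln 2)" using lnp that by simp
      finally show ?case .
    qed
  qed
  show "(\<lambda>n. M.prob (?E n)) \<longlonglongrightarrow> 0"
  proof (rule order_tendstoI)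
    fix a :: real assume "a < 0"
    then show "eventually (\<lambda>n. a < M.prob (?E n)) sequentially"
      by (intro always_eventually allI less_le_trans[OF _ measure_nonneg]) auto
  next
    fix a :: real assume "0 < a"
    define A where "A = max 1 (- ln (a / 4) / ln 2)"
    have "A > 0" by (simp add: A_def)
    have "- A * ln 2 \<le> ln (a / 4)"
    proof -
      have "- ln (a / 4) / ln 2 \<le> A" by (simp add: A_def)
      then show ?thesis by (simp add: field_simps)
    qed
    then have "2 * exp (- A * ln 2) \<le> 2 * exp (ln (a / 4))" by simp
    then have "2 * exp (- A * ln 2) < a" using \<open>0 < a\<close> by simp
    then show "eventually (\<lambda>n. M.prob (?E n) < a) sequentially"
      using bound[OF \<open>A > 0\<close>] by (auto elim: eventually_mono)
  qed
qed

end

section \<open>Sums over a held-out fold\<close>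

context iid_sample
begin

abbreviation sample :: "nat set \<Rightarrow> 'o \<Rightarrow> nat \<Rightarrow> 'w" where
  "sample T \<omega> \<equiv> restrict (\<lambda>i. W i \<omega>) T"

lemma sample_measurable [measurable]: "sample T \<in> measurable M (PiM T (\<lambda>_. P))"
  by (rule measurable_restrict) simp

lemma
  fixes g :: "'w \<Rightarrow> real"
  assumes [measurable]: "g \<in> borel_measurable P" and sq: "integrable P (\<lambda>w. (g w)\<^sup>2)"
    and mean: "(\<integral>w. g w \<partial>P) = 0" and "finite J"
  shows integrable_square_sum_W: "integrable M (\<lambda>\<omega>. (\<Sum>i\<in>J. g (W i \<omega>))\<^sup>2)"
    and second_moment_sum_W: "(\<integral>\<omega>. (\<Sum>i\<in>J. g (W i \<omega>))\<^sup>2 \<partial>M) = real (card J) * (\<integral>w. (g w)\<^sup>2 \<partial>P)"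
proof -
  have int: "integrable P g" by (rule P.square_integrable_imp_integrable[OF _ sq]) simp
  have prod: "integrable M (\<lambda>\<omega>. g (W i \<omega>) * g (W j \<omega>)) \<and>
    (\<integral>\<omega>. g (W i \<omega>) * g (W j \<omega>) \<partial>M) = (if i = j then (\<integral>w. (g w)\<^sup>2 \<partial>P) else 0)" for i j
  proof (cases "i = j")
    case True
    then show ?thesis using integrable_W[OF sq, of j] integral_W[of "\<lambda>w. (g w)\<^sup>2" j]
      by (simp add: power2_eq_square)
  next
    case False
    note * = indep_vars_W[of "{i, j}" "\<lambda>_. g"]
    show ?thesis
      using M.indep_vars_lebesgue_integral[OF _ *] M.indep_vars_integrable[OF _ *] False
        integrable_W[OF int] integral_W[of g] mean by simp
  qed
  have sq_eq: "(\<Sum>i\<in>J. g (W i \<omega>))\<^sup>2 = (\<Sum>i\<in>J. \<Sum>j\<in>J. g (W i \<omega>) * g (W j \<omega>))" for \<omega>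
    by (simp add: power2_eq_square sum_product)
  show "integrable M (\<lambda>\<omega>. (\<Sum>i\<in>J. g (W i \<omega>))\<^sup>2)"
    unfolding sq_eq using prod by (intro Bochner_Integration.integrable_sum) auto
  show "(\<integral>\<omega>. (\<Sum>i\<in>J. g (W i \<omega>))\<^sup>2 \<partial>M) = real (card J) * (\<integral>w. (g w)\<^sup>2 \<partial>P)"
    unfolding sq_eq using prod \<open>finite J\<close>
    by (simp add: Bochner_Integration.integral_sum Bochner_Integration.integrable_sum)
qed

lemma prob_sum_W_le_L2:
  fixes g :: "'w \<Rightarrow> real"
  assumes [measurable]: "g \<in> borel_measurable P" and "integrable P (\<lambda>w. (g w)\<^sup>2)"
    and "(\<integral>w. g w \<partial>P) = 0" and "finite J" and "t > 0"
  shows "M.prob {\<omega> \<in> space M. \<bar>\<Sum>i\<in>J. g (W i \<omega>)\<bar> > t} \<le> real (card J) * (\<integral>w. (g w)\<^sup>2 \<partial>P) / t\<^sup>2"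
proof -
  have "M.prob {\<omega> \<in> space M. \<bar>\<Sum>i\<in>J. g (W i \<omega>)\<bar> > t} \<le> M.prob {\<omega> \<in> space M. \<bar>\<Sum>i\<in>J. g (W i \<omega>)\<bar> \<ge> t}"
    by (intro M.finite_measure_mono) auto
  also have "\<dots> \<le> (\<integral>\<omega>. (\<Sum>i\<in>J. g (W i \<omega>))\<^sup>2 \<partial>M) / t\<^sup>2"
    by (rule M.second_moment_method) (use assms integrable_square_sum_W in auto)
  finally show ?thesis using assms second_moment_sum_W by simp
qed

lemma prob_sum_W_le_L1:
  fixes g :: "'w \<Rightarrow> real"
  assumes "integrable P g" and "finite J" and "t > 0"
  shows "M.prob {\<omega> \<in> space M. \<bar>\<Sum>i\<in>J. g (W i \<omega>)\<bar> > t} \<le> real (card J) * (\<integral>w. \<bar>g w\<bar> \<partial>P) / t"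
proof -
  have [measurable]: "g \<in> borel_measurable P" using assms by auto
  have int: "integrable M (\<lambda>\<omega>. \<Sum>i\<in>J. \<bar>g (W i \<omega>)\<bar>)"
    using integrable_W[OF integrable_abs[OF assms(1)]] by auto
  have "M.prob {\<omega> \<in> space M. \<bar>\<Sum>i\<in>J. g (W i \<omega>)\<bar> > t} \<le> M.prob {\<omega> \<in> space M. (\<Sum>i\<in>J. \<bar>g (W i \<omega>)\<bar>) \<ge> t}"
    by (intro M.finite_measure_mono) (auto intro: order_trans[OF less_imp_le sum_abs])
  also have "\<dots> \<le> (\<integral>\<omega>. (\<Sum>i\<in>J. \<bar>g (W i \<omega>)\<bar>) \<partial>M) / t"
    by (rule integral_Markov_inequality_measure[OF int, of "{}"]) (use assms in \<open>auto intro: sum_nonneg\<close>)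
  also have "(\<integral>\<omega>. (\<Sum>i\<in>J. \<bar>g (W i \<omega>)\<bar>) \<partial>M) = real (card J) * (\<integral>w. \<bar>g w\<bar> \<partial>P)"
    using integrable_W[OF integrable_abs[OF assms(1)]] integral_W[of "\<lambda>w. \<bar>g w\<bar>"]
    by (simp add: Bochner_Integration.integral_sum)
  finally show ?thesis .
qed

text \<open>Conditioning on the training sample, done by Fubini: disjoint blocks of an independent
  sample have a product law, so the probability of \<open>B\<close> is the average of the
  probabilities of its sections, each at most \<open>q\<close>.\<close>

lemma prob_sample_split_le:
  assumes "T \<inter> J = {}" and B: "B \<in> sets (PiM T (\<lambda>_. P) \<Otimes>\<^sub>M PiM J (\<lambda>_. P))"
    and le: "\<And>d. d \<in> space (PiM T (\<lambda>_. P)) \<Longrightarrow> M.prob {\<omega> \<in> space M. (d, sample J \<omega>) \<in> B} \<le> q"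
  shows "M.prob {\<omega> \<in> space M. (sample T \<omega>, sample J \<omega>) \<in> B} \<le> q"
proof -
  let ?PT = "PiM T (\<lambda>_. P)" and ?PJ = "PiM J (\<lambda>_. P)"
  have ind: "M.indep_var ?PT (sample T) ?PJ (sample J)"
    using assms(1) by (intro M.indep_var_restrict[OF W_indep]) auto
  then have eq: "distr M ?PT (sample T) \<Otimes>\<^sub>M distr M ?PJ (sample J)
      = distr M (?PT \<Otimes>\<^sub>M ?PJ) (\<lambda>\<omega>. (sample T \<omega>, sample J \<omega>))"
    unfolding M.indep_var_distribution_eq by blast
  interpret DT: prob_space "distr M ?PT (sample T)" by (rule M.prob_space_distr) simp
  interpret DJ: prob_space "distr M ?PJ (sample J)" by (rule M.prob_space_distr) simp
  \<comment> \<open>A point of the space yields a nonempty set of training samples, from which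
    \<open>q \<ge> 0\<close> follows.\<close>
  obtain \<omega>0 where "\<omega>0 \<in> space M" using M.not_empty by auto
  then have "sample T \<omega>0 \<in> space ?PT" using measurable_space[OF sample_measurable] by blast
  then have q: "q \<ge> 0" using le[of "sample T \<omega>0"] measure_nonneg order_trans by blast
  have pair [measurable]: "(\<lambda>\<omega>. (sample T \<omega>, sample J \<omega>)) \<in> measurable M (?PT \<Otimes>\<^sub>M ?PJ)" by simp
  have "ennreal (M.prob {\<omega> \<in> space M. (sample T \<omega>, sample J \<omega>) \<in> B})
      = emeasure M ((\<lambda>\<omega>. (sample T \<omega>, sample J \<omega>)) -` B \<inter> space M)"
    unfolding M.emeasure_eq_measure by (intro arg_cong[of _ _ ennreal] arg_cong[of _ _ M.prob]) auto
  also have "\<dots> = emeasure (distr M (?PT \<Otimes>\<^sub>M ?PJ) (\<lambda>\<omega>. (sample T \<omega>, sample J \<omega>))) B"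
    by (rule emeasure_distr[OF pair B, symmetric])
  also have "\<dots> = emeasure (distr M ?PT (sample T) \<Otimes>\<^sub>M distr M ?PJ (sample J)) B"
    unfolding eq ..
  also have "\<dots> = (\<integral>\<^sup>+d. emeasure (distr M ?PJ (sample J)) (Pair d -` B) \<partial>distr M ?PT (sample T))"
    using B by (intro DJ.emeasure_pair_measure_alt)
      (auto simp: sets_pair_measure_cong[of "distr M ?PT (sample T)" ?PT "distr M ?PJ (sample J)" ?PJ])
  also have "\<dots> \<le> (\<integral>\<^sup>+d. ennreal q \<partial>distr M ?PT (sample T))"
  proof (rule nn_integral_mono)
    fix d assume d: "d \<in> space (distr M ?PT (sample T))"
    have "Pair d -` B \<in> sets ?PJ" by (rule sets_Pair1[OF B])
    then have "emeasure (distr M ?PJ (sample J)) (Pair d -` B)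
        = emeasure M (sample J -` (Pair d -` B) \<inter> space M)"
      by (rule emeasure_distr[OF sample_measurable])
    also have "\<dots> = ennreal (M.prob {\<omega> \<in> space M. (d, sample J \<omega>) \<in> B})"
      unfolding M.emeasure_eq_measure by (intro arg_cong[of _ _ ennreal] arg_cong[of _ _ M.prob]) auto
    also have "\<dots> \<le> ennreal q" using le[of d] d by (intro ennreal_leI) auto
    finally show "emeasure (distr M ?PJ (sample J)) (Pair d -` B) \<le> ennreal q" .
  qed
  also have "\<dots> = ennreal q" using DT.emeasure_space_1 by simp
  finally show ?thesis using q by simp
qed

text \<open>\<open>A\<close> depends on the training sample alone, so with that sample fixed it is
  either true, and the hypothesis applies to a fixed function \<open>g d\<close>, or false, and the
  section is empty.\<close>

lemma prob_crossfit_le: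
  fixes g :: "(nat \<Rightarrow> 'w) \<Rightarrow> 'w \<Rightarrow> real"
  assumes TJ: "T \<inter> J = {}" "finite J"
    and g [measurable]: "(\<lambda>(d, w). g d w) \<in> borel_measurable (PiM T (\<lambda>_. P) \<Otimes>\<^sub>M P)"
    and A: "{d \<in> space (PiM T (\<lambda>_. P)). A d} \<in> sets (PiM T (\<lambda>_. P))"
    and le: "\<And>d. d \<in> space (PiM T (\<lambda>_. P)) \<Longrightarrow> A d \<Longrightarrow>
      M.prob {\<omega> \<in> space M. \<bar>\<Sum>i\<in>J. g d (W i \<omega>)\<bar> > t} \<le> q" and "q \<ge> 0"
  shows "{\<omega> \<in> space M. A (sample T \<omega>) \<and> \<bar>\<Sum>i\<in>J. g (sample T \<omega>) (W i \<omega>)\<bar> > t} \<in> M.events"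
    and "M.prob {\<omega> \<in> space M. A (sample T \<omega>) \<and> \<bar>\<Sum>i\<in>J. g (sample T \<omega>) (W i \<omega>)\<bar> > t} \<le> q"
proof -
  let ?PT = "PiM T (\<lambda>_. P)" and ?PJ = "PiM J (\<lambda>_. P)"
  have gi: "(\<lambda>x. g (fst x) (snd x i)) \<in> borel_measurable (?PT \<Otimes>\<^sub>M ?PJ)" if "i \<in> J" for i
  proof -
    have "(\<lambda>x. (fst x, snd x i)) \<in> measurable (?PT \<Otimes>\<^sub>M ?PJ) (?PT \<Otimes>\<^sub>M P)"
      using that by (intro measurable_Pair) (auto intro!: measurable_compose[OF measurable_snd])
    from measurable_compose[OF this g] show ?thesis by simp
  qed
  have [measurable]: "Measurable.pred ?PT A" using A by (simp add: pred_def)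
  define B where "B = {x \<in> space (?PT \<Otimes>\<^sub>M ?PJ). A (fst x) \<and> \<bar>\<Sum>i\<in>J. g (fst x) (snd x i)\<bar> > t}"
  have B [measurable]: "B \<in> sets (?PT \<Otimes>\<^sub>M ?PJ)"
  proof -
    have [measurable]: "(\<lambda>x. \<Sum>i\<in>J. g (fst x) (snd x i)) \<in> borel_measurable (?PT \<Otimes>\<^sub>M ?PJ)"
      using gi by (rule borel_measurable_sum)
    show ?thesis unfolding B_def by measurable
  qed
  have inB: "(d, sample J \<omega>) \<in> B \<longleftrightarrow> A d \<and> \<bar>\<Sum>i\<in>J. g d (W i \<omega>)\<bar> > t"
    if "d \<in> space ?PT" "\<omega> \<in> space M" for d \<omega>
  proof -
    have "sample J \<omega> \<in> space ?PJ" using that measurable_space[OF sample_measurable] by blast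
    then show ?thesis using that by (auto simp: B_def space_pair_measure)
  qed
  have eq: "{\<omega> \<in> space M. A (sample T \<omega>) \<and> \<bar>\<Sum>i\<in>J. g (sample T \<omega>) (W i \<omega>)\<bar> > t}
      = {\<omega> \<in> space M. (sample T \<omega>, sample J \<omega>) \<in> B}"
    using inB measurable_space[OF sample_measurable, of _ T] by blast
  show "{\<omega> \<in> space M. A (sample T \<omega>) \<and> \<bar>\<Sum>i\<in>J. g (sample T \<omega>) (W i \<omega>)\<bar> > t} \<in> M.events"
    unfolding eq by measurable
  show "M.prob {\<omega> \<in> space M. A (sample T \<omega>) \<and> \<bar>\<Sum>i\<in>J. g (sample T \<omega>) (W i \<omega>)\<bar> > t} \<le> q"
    unfolding eq
  proof (rule prob_sample_split_le[OF TJ(1) B])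
    fix d assume d: "d \<in> space ?PT"
    then have eq': "{\<omega> \<in> space M. (d, sample J \<omega>) \<in> B}
        = {\<omega> \<in> space M. A d \<and> \<bar>\<Sum>i\<in>J. g d (W i \<omega>)\<bar> > t}"
      using inB by blast
    show "M.prob {\<omega> \<in> space M. (d, sample J \<omega>) \<in> B} \<le> q"
      unfolding eq' using le[OF d] \<open>q \<ge> 0\<close> by (cases "A d") auto
  qed
qed

lemma measurable_section:
  assumes "(\<lambda>(d, w). g d w) \<in> borel_measurable (N \<Otimes>\<^sub>M P)" "d \<in> space N"
  shows "g d \<in> borel_measurable P"
  using measurable_compose[OF measurable_Pair1'[OF assms(2), of P] assms(1)] by simp

lemma crossfit_sum_measurable:
  fixes g :: "(nat \<Rightarrow> 'w) \<Rightarrow> 'w \<Rightarrow> real"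
  assumes g: "(\<lambda>(d, w). g d w) \<in> borel_measurable (PiM T (\<lambda>_. P) \<Otimes>\<^sub>M P)"
  shows "(\<lambda>\<omega>. \<Sum>i\<in>J. g (sample T \<omega>) (W i \<omega>)) \<in> borel_measurable M"
proof (rule borel_measurable_sum)
  fix i
  have "(\<lambda>\<omega>. (sample T \<omega>, W i \<omega>)) \<in> measurable M (PiM T (\<lambda>_. P) \<Otimes>\<^sub>M P)" by simp
  from measurable_compose[OF this g] show "(\<lambda>\<omega>. g (sample T \<omega>) (W i \<omega>)) \<in> borel_measurable M" by simp
qed

text \<open>Conditionally on the training sample the held-out sum has mean zero and second moment at
  most \<open>n\<close> times \<open>v n\<close>.\<close>

lemma crossfit_sum_L2:
  fixes g :: "nat \<Rightarrow> (nat \<Rightarrow> 'w) \<Rightarrow> 'w \<Rightarrow> real"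
  assumes g: "\<And>n. (\<lambda>(d, w). g n d w) \<in> borel_measurable (PiM (T n) (\<lambda>_. P) \<Otimes>\<^sub>M P)"
    and TJ: "\<And>n. T n \<inter> J n = {}" "\<And>n. finite (J n)" "\<And>n. card (J n) \<le> n"
    and whp: "whp (\<lambda>n \<omega>. integrable P (\<lambda>w. (g n (sample (T n) \<omega>) w)\<^sup>2) \<and>
      (\<integral>w. g n (sample (T n) \<omega>) w \<partial>P) = 0 \<and> (\<integral>w. (g n (sample (T n) \<omega>) w)\<^sup>2 \<partial>P) \<le> v n)"
    and v: "v \<longlonglongrightarrow> 0" and "e > 0"
  shows "(\<lambda>n. M.prob {\<omega> \<in> space M. \<bar>\<Sum>i\<in>J n. g n (sample (T n) \<omega>) (W i \<omega>)\<bar> > e * sqrt (real n)}) \<longlonglongrightarrow> 0"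
proof -
  let ?A = "\<lambda>n d. integrable P (\<lambda>w. (g n d w)\<^sup>2) \<and> (\<integral>w. g n d w \<partial>P) = 0 \<and> (\<integral>w. (g n d w)\<^sup>2 \<partial>P) \<le> v n"
  let ?Sum = "\<lambda>n \<omega>. \<Sum>i\<in>J n. g n (sample (T n) \<omega>) (W i \<omega>)"
  have A: "{d \<in> space (PiM (T n) (\<lambda>_. P)). ?A n d} \<in> sets (PiM (T n) (\<lambda>_. P))" for n
  proof -
    note g[of n, measurable]
    \<comment> \<open>Integrability of a section becomes a measurable condition on \<open>d\<close>
      once it is written as finiteness of a nonnegative integral.\<close>
    have "{d \<in> space (PiM (T n) (\<lambda>_. P)). ?A n d} = {d \<in> space (PiM (T n) (\<lambda>_. P)).
      (\<integral>\<^sup>+w. ennreal ((g n d w)\<^sup>2) \<partial>P) < \<infinity> \<and> (\<integral>w. g n d w \<partial>P) = 0 \<and> (\<integral>w. (g n d w)\<^sup>2 \<partial>P) \<le> v n}"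
    proof (rule Collect_cong, rule conj_cong[OF refl], rule conj_cong[OF _ refl])
      fix d assume "d \<in> space (PiM (T n) (\<lambda>_. P))"
      then have [measurable]: "g n d \<in> borel_measurable P" by (rule measurable_section[OF g])
      show "integrable P (\<lambda>w. (g n d w)\<^sup>2) = ((\<integral>\<^sup>+w. ennreal ((g n d w)\<^sup>2) \<partial>P) < \<infinity>)"
        by (simp add: integrable_iff_bounded)
    qed
    also have "\<dots> \<in> sets (PiM (T n) (\<lambda>_. P))" by measurable
    finally show ?thesis .
  qed
  have bound: "{\<omega> \<in> space M. ?A n (sample (T n) \<omega>) \<and> \<bar>?Sum n \<omega>\<bar> > e * sqrt (real n)} \<in> M.events
    \<and> M.prob {\<omega> \<in> space M. ?A n (sample (T n) \<omega>) \<and> \<bar>?Sum n \<omega>\<bar> > e * sqrt (real n)} \<le> \<bar>v n\<bar> / e\<^sup>2"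
    if "n \<ge> 1" for n
  proof -
    have le: "M.prob {\<omega> \<in> space M. \<bar>\<Sum>i\<in>J n. g n d (W i \<omega>)\<bar> > e * sqrt (real n)} \<le> \<bar>v n\<bar> / e\<^sup>2"
      if d: "d \<in> space (PiM (T n) (\<lambda>_. P))" "?A n d" for d
    proof -
      have "M.prob {\<omega> \<in> space M. \<bar>\<Sum>i\<in>J n. g n d (W i \<omega>)\<bar> > e * sqrt (real n)}
          \<le> real (card (J n)) * (\<integral>w. (g n d w)\<^sup>2 \<partial>P) / (e * sqrt (real n))\<^sup>2"
        using d \<open>n \<ge> 1\<close> \<open>e > 0\<close> TJ by (intro prob_sum_W_le_L2 measurable_section[OF g]) auto
      also have "\<dots> \<le> real n * \<bar>v n\<bar> / (e * sqrt (real n))\<^sup>2"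
        using d TJ(3)[of n] by (intro divide_right_mono mult_mono) auto
      finally show ?thesis using \<open>n \<ge> 1\<close> by (simp add: power_mult_distrib)
    qed
    show ?thesis
      using prob_crossfit_le[where g = "g n" and A = "?A n" and t = "e * sqrt (real n)" and q = "\<bar>v n\<bar> / e\<^sup>2",
          OF TJ(1,2) g A le] by simp
  qed
  \<comment> \<open>At \<open>n = 0\<close> the threshold \<open>e * sqrt n\<close> is 0 and
    Chebyshev's inequality says nothing.\<close>
  let ?S = "\<lambda>n. if n \<ge> 1 then {\<omega> \<in> space M. ?A n (sample (T n) \<omega>) \<and> \<bar>?Sum n \<omega>\<bar> > e * sqrt (real n)} else {}"
  have "(\<lambda>n. M.prob (?S n)) \<longlonglongrightarrow> 0"
  proof (rule real_tendsto_sandwich[of "\<lambda>_. 0" _ _ "\<lambda>n. \<bar>v n\<bar> / e\<^sup>2"])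
    show "(\<lambda>n. \<bar>v n\<bar> / e\<^sup>2) \<longlonglongrightarrow> 0"
      using tendsto_divide[OF tendsto_rabs[OF v] tendsto_const[of "e\<^sup>2"]] \<open>e > 0\<close> by simp
  qed (use bound in auto)
  then show ?thesis
  proof (rule prob_diff_with_prob_approaching_one[OF M.prob_space_axioms whp, rotated -1])
    show "?S n \<in> M.events" for n using bound[of n] by auto
    show "{\<omega> \<in> space M. \<bar>?Sum n \<omega>\<bar> > e * sqrt (real n)} \<in> M.events" for n
      using crossfit_sum_measurable[OF g] by measurable
    show "eventually (\<lambda>n. \<forall>\<omega>\<in>{\<omega> \<in> space M. \<bar>?Sum n \<omega>\<bar> > e * sqrt (real n)}.
        ?A n (sample (T n) \<omega>) \<longrightarrow> \<omega> \<in> ?S n) sequentially"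
      using eventually_ge_at_top[of 1] by eventually_elim auto
  qed
qed

text \<open>Markov's inequality in place of Chebyshev's, for summands whose mean is not zero. The
  scale \<open>a\<close> is left free because it is a multiple of \<open>sqrt n\<close> for the
  product of the two errors and a multiple of \<open>n\<close> for the squared remainder.\<close>

lemma crossfit_sum_L1:
  fixes g :: "nat \<Rightarrow> (nat \<Rightarrow> 'w) \<Rightarrow> 'w \<Rightarrow> real"
  assumes g: "\<And>n. (\<lambda>(d, w). g n d w) \<in> borel_measurable (PiM (T n) (\<lambda>_. P) \<Otimes>\<^sub>M P)"
    and TJ: "\<And>n. T n \<inter> J n = {}" "\<And>n. finite (J n)" "\<And>n. card (J n) \<le> n"
    and whp: "whp (\<lambda>n \<omega>. integrable P (g n (sample (T n) \<omega>)) \<and>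
      (\<integral>w. \<bar>g n (sample (T n) \<omega>) w\<bar> \<partial>P) \<le> v n)"
    and v: "(\<lambda>n. real n * v n / a n) \<longlonglongrightarrow> 0" and a: "\<And>n. n \<ge> 1 \<Longrightarrow> a n > 0"
  shows "(\<lambda>n. M.prob {\<omega> \<in> space M. \<bar>\<Sum>i\<in>J n. g n (sample (T n) \<omega>) (W i \<omega>)\<bar> > a n}) \<longlonglongrightarrow> 0"
proof -
  let ?A = "\<lambda>n d. integrable P (g n d) \<and> (\<integral>w. \<bar>g n d w\<bar> \<partial>P) \<le> v n"
  let ?Sum = "\<lambda>n \<omega>. \<Sum>i\<in>J n. g n (sample (T n) \<omega>) (W i \<omega>)"
  have A: "{d \<in> space (PiM (T n) (\<lambda>_. P)). ?A n d} \<in> sets (PiM (T n) (\<lambda>_. P))" for n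
  proof -
    note g[of n, measurable]
    have "{d \<in> space (PiM (T n) (\<lambda>_. P)). ?A n d} = {d \<in> space (PiM (T n) (\<lambda>_. P)).
      (\<integral>\<^sup>+w. ennreal \<bar>g n d w\<bar> \<partial>P) < \<infinity> \<and> (\<integral>w. \<bar>g n d w\<bar> \<partial>P) \<le> v n}"
    proof (rule Collect_cong, rule conj_cong[OF refl], rule conj_cong[OF _ refl])
      fix d assume "d \<in> space (PiM (T n) (\<lambda>_. P))"
      then have [measurable]: "g n d \<in> borel_measurable P" by (rule measurable_section[OF g])
      show "integrable P (g n d) = ((\<integral>\<^sup>+w. ennreal \<bar>g n d w\<bar> \<partial>P) < \<infinity>)"
        by (simp add: integrable_iff_bounded)
    qed
    also have "\<dots> \<in> sets (PiM (T n) (\<lambda>_. P))" by measurable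
    finally show ?thesis .
  qed
  have bound: "{\<omega> \<in> space M. ?A n (sample (T n) \<omega>) \<and> \<bar>?Sum n \<omega>\<bar> > a n} \<in> M.events
    \<and> M.prob {\<omega> \<in> space M. ?A n (sample (T n) \<omega>) \<and> \<bar>?Sum n \<omega>\<bar> > a n} \<le> \<bar>real n * v n / a n\<bar>"
    if "n \<ge> 1" for n
  proof -
    have le: "M.prob {\<omega> \<in> space M. \<bar>\<Sum>i\<in>J n. g n d (W i \<omega>)\<bar> > a n} \<le> \<bar>real n * v n / a n\<bar>"
      if d: "d \<in> space (PiM (T n) (\<lambda>_. P))" "?A n d" for d
    proof -
      have "M.prob {\<omega> \<in> space M. \<bar>\<Sum>i\<in>J n. g n d (W i \<omega>)\<bar> > a n}
          \<le> real (card (J n)) * (\<integral>w. \<bar>g n d w\<bar> \<partial>P) / a n"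
        using d a[OF \<open>n \<ge> 1\<close>] TJ by (intro prob_sum_W_le_L1) auto
      also have "\<dots> \<le> real n * v n / a n"
        using d TJ(3)[of n] a[OF \<open>n \<ge> 1\<close>] by (intro divide_right_mono mult_mono) auto
      finally show ?thesis using abs_ge_self by (rule order_trans)
    qed
    show ?thesis
      using prob_crossfit_le[where g = "g n" and A = "?A n" and t = "a n" and q = "\<bar>real n * v n / a n\<bar>",
          OF TJ(1,2) g A le] by simp
  qed
  let ?S = "\<lambda>n. if n \<ge> 1 then {\<omega> \<in> space M. ?A n (sample (T n) \<omega>) \<and> \<bar>?Sum n \<omega>\<bar> > a n} else {}"
  have "(\<lambda>n. M.prob (?S n)) \<longlonglongrightarrow> 0"
  proof (rule real_tendsto_sandwich[of "\<lambda>_. 0" _ _ "\<lambda>n. \<bar>real n * v n / a n\<bar>"])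
    show "(\<lambda>n. \<bar>real n * v n / a n\<bar>) \<longlonglongrightarrow> 0" by (rule tendsto_rabs_zero[OF v])
  qed (use bound in auto)
  then show ?thesis
  proof (rule prob_diff_with_prob_approaching_one[OF M.prob_space_axioms whp, rotated -1])
    show "?S n \<in> M.events" for n using bound[of n] by auto
    show "{\<omega> \<in> space M. \<bar>?Sum n \<omega>\<bar> > a n} \<in> M.events" for n
      using crossfit_sum_measurable[OF g] by measurable
    show "eventually (\<lambda>n. \<forall>\<omega>\<in>{\<omega> \<in> space M. \<bar>?Sum n \<omega>\<bar> > a n}.
        ?A n (sample (T n) \<omega>) \<longrightarrow> \<omega> \<in> ?S n) sequentially"
      using eventually_ge_at_top[of 1] by eventually_elim auto
  qed
qed

end

section \<open>Limit theorems\<close>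

lemma normal_law_real_distribution: "real_distribution (normal_law \<mu> v)"
proof -
  interpret real_distribution std_normal_distribution by (rule real_dist_normal_dist)
  show ?thesis unfolding normal_law_def by (intro real_distribution_distr) simp
qed

text \<open>The complex exponential is bounded by 1 and Lipschitz with constant
  \<open>\<bar>t\<bar>\<close>: where \<open>X\<close> and \<open>Y\<close> are within
  \<open>e\<close> the integrands differ by at most \<open>\<bar>t\<bar> * e\<close>, elsewhere by
  at most 2.\<close>

lemma (in prob_space) char_distr_add_diff:
  assumes [measurable]: "X \<in> borel_measurable M" "Y \<in> borel_measurable M" and "e > 0"
  shows "norm (char (distr M borel X) t - char (distr M borel Y) t)
    \<le> \<bar>t\<bar> * e + 2 * prob {\<omega> \<in> space M. \<bar>X \<omega> - Y \<omega>\<bar> > e}"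
proof -
  let ?B = "{\<omega> \<in> space M. \<bar>X \<omega> - Y \<omega>\<bar> > e}"
  have B [measurable]: "?B \<in> events" by measurable
  have int: "integrable M (\<lambda>\<omega>. iexp (t * Z \<omega>))" if [measurable]: "Z \<in> borel_measurable M" for Z
    by (rule integrable_const_bound[of _ 1]) auto
  have "char (distr M borel X) t - char (distr M borel Y) t = (CLINT \<omega>|M. iexp (t * X \<omega>) - iexp (t * Y \<omega>))"
    using int by (simp add: char_def integral_distr)
  also have "norm \<dots> \<le> (\<integral>\<omega>. norm (iexp (t * X \<omega>) - iexp (t * Y \<omega>)) \<partial>M)"
    by (rule integral_norm_bound)
  also have "\<dots> \<le> (\<integral>\<omega>. \<bar>t\<bar> * e + 2 * indicator ?B \<omega> \<partial>M)"
  proof (rule integral_mono)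
    fix \<omega> assume \<omega>: "\<omega> \<in> space M"
    have lip: "cmod (iexp a - iexp b) \<le> \<bar>a - b\<bar>" for a b :: real
    proof -
      have "iexp a - iexp b = iexp b * (iexp (a - b) - 1)"
        by (simp add: algebra_simps exp_add[symmetric])
      then have "cmod (iexp a - iexp b) = cmod (iexp (a - b) - 1)" by (simp add: norm_mult)
      also have "\<dots> \<le> \<bar>a - b\<bar>" using iexp_approx1[of "a - b" 0] by simp
      finally show ?thesis .
    qed
    show "cmod (iexp (t * X \<omega>) - iexp (t * Y \<omega>)) \<le> \<bar>t\<bar> * e + 2 * indicator ?B \<omega>"
    proof (cases "\<omega> \<in> ?B")
      case True
      have "cmod (iexp (t * X \<omega>) - iexp (t * Y \<omega>)) \<le> cmod (iexp (t * X \<omega>)) + cmod (iexp (t * Y \<omega>))"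
        by (rule norm_triangle_ineq4)
      then have "cmod (iexp (t * X \<omega>) - iexp (t * Y \<omega>)) \<le> 2" by simp
      moreover have "\<bar>t\<bar> * e \<ge> 0" using \<open>e > 0\<close> by simp
      ultimately show ?thesis using True by simp
    next
      case False
      have "cmod (iexp (t * X \<omega>) - iexp (t * Y \<omega>)) \<le> \<bar>t * X \<omega> - t * Y \<omega>\<bar>" by (rule lip)
      also have "\<dots> = \<bar>t\<bar> * \<bar>X \<omega> - Y \<omega>\<bar>" by (simp add: abs_mult flip: right_diff_distrib)
      also have "\<dots> \<le> \<bar>t\<bar> * e" using False \<omega> by (intro mult_left_mono) auto
      finally show ?thesis using False by simp
    qed
  next
    show "integrable M (\<lambda>\<omega>. norm (iexp (t * X \<omega>) - iexp (t * Y \<omega>)))" using int by simp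
    show "integrable M (\<lambda>\<omega>. \<bar>t\<bar> * e + 2 * indicator ?B \<omega>)"
      using B by (intro Bochner_Integration.integrable_add integrable_mult_right integrable_real_indicator)
        (auto simp: emeasure_eq_measure)
  qed
  also have "\<dots> = \<bar>t\<bar> * e + 2 * prob ?B"
    using B by (subst Bochner_Integration.integral_add) (auto simp: prob_space emeasure_eq_measure)
  finally show ?thesis .
qed

text \<open>Levy's continuity theorem turns both the hypothesis and the claim into pointwise
  convergence of characteristic functions, where a difference vanishing in probability disappears in
  the limit.\<close>

lemma (in prob_space) slutsky:
  fixes X Y :: "nat \<Rightarrow> 'a \<Rightarrow> real"
  assumes X: "\<And>n. X n \<in> borel_measurable M" and Y: "\<And>n. Y n \<in> borel_measurable M"
    and N: "real_distribution N" and conv: "weak_conv_m (\<lambda>n. distr M borel (X n)) N"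
    and diff: "\<And>e. e > 0 \<Longrightarrow> (\<lambda>n. prob {\<omega> \<in> space M. \<bar>X n \<omega> - Y n \<omega>\<bar> > e}) \<longlonglongrightarrow> 0"
  shows "weak_conv_m (\<lambda>n. distr M borel (Y n)) N"
proof (rule levy_continuity)
  show "real_distribution (distr M borel (Y n))" for n using Y by (rule real_distribution_distr)
  show "real_distribution N" by fact
  fix t
  have cX: "(\<lambda>n. char (distr M borel (X n)) t) \<longlonglongrightarrow> char N t"
    using real_distribution_distr[OF X] N conv by (rule levy_continuity1)
  have "(\<lambda>n. char (distr M borel (X n)) t - char (distr M borel (Y n)) t) \<longlonglongrightarrow> 0"
  proof (rule LIMSEQ_I)
    fix r :: real assume "r > 0"
    define e where "e = r / (2 * (\<bar>t\<bar> + 1))"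
    have e: "e > 0" "\<bar>t\<bar> * e < r / 2" using \<open>r > 0\<close> by (auto simp: e_def field_simps)
    have "eventually (\<lambda>n. prob {\<omega> \<in> space M. \<bar>X n \<omega> - Y n \<omega>\<bar> > e} < r / 4) sequentially"
      using order_tendstoD(2)[OF diff[OF e(1)], of "r / 4"] \<open>r > 0\<close> by simp
    then have "eventually (\<lambda>n. norm (char (distr M borel (X n)) t - char (distr M borel (Y n)) t - 0) < r) sequentially"
    proof eventually_elim
      case (elim n)
      then show ?case using char_distr_add_diff[OF X[of n] Y[of n] e(1), of t] e by simp
    qed
    then show "\<exists>no. \<forall>n\<ge>no. norm (char (distr M borel (X n)) t - char (distr M borel (Y n)) t - 0) < r"
      by (simp add: eventually_sequentially)
  qed
  from tendsto_diff[OF cX this] show "(\<lambda>n. char (distr M borel (Y n)) t) \<longlonglongrightarrow> char N t" by simp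
qed

lemma char_normal_law: "char (normal_law 0 v) t = char std_normal_distribution (t * sqrt v)"
  unfolding normal_law_def char_def by (subst integral_distr) (auto simp: mult_ac)

section \<open>Central limit theorem and weak laws of large numbers\<close>

context iid_sample
begin

text \<open>The variance may be 0, and then the sums cannot be standardized. In that case they
  vanish almost surely and the limit is the point mass at 0, which is what \<open>normal_law\<close>
  with variance 0 denotes.\<close>

lemma central_limit_W:
  fixes g :: "'w \<Rightarrow> real"
  assumes [measurable]: "g \<in> borel_measurable P" and sq: "integrable P (\<lambda>w. (g w)\<^sup>2)"
    and mean: "(\<integral>w. g w \<partial>P) = 0"
  shows "weak_conv_m (\<lambda>n. distr M borel (\<lambda>\<omega>. (\<Sum>i<n. g (W i \<omega>)) / sqrt (real n)))
    (normal_law 0 (\<integral>w. (g w)\<^sup>2 \<partial>P))"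
proof -
  let ?V = "\<integral>w. (g w)\<^sup>2 \<partial>P"
  have V: "?V \<ge> 0" by simp
  let ?S = "\<lambda>n \<omega>. \<Sum>i<n. g (W i \<omega>)"
  show ?thesis
  proof (rule levy_continuity)
    show "real_distribution (distr M borel (\<lambda>\<omega>. ?S n \<omega> / sqrt (real n)))" for n
      by (rule M.real_distribution_distr) simp
    show "real_distribution (normal_law 0 ?V)" by (rule normal_law_real_distribution)
    fix t
    show "(\<lambda>n. char (distr M borel (\<lambda>\<omega>. ?S n \<omega> / sqrt (real n))) t) \<longlonglongrightarrow> char (normal_law 0 ?V) t"
    proof (cases "?V = 0")
      case False
      define \<sigma> where "\<sigma> = sqrt ?V"
      have \<sigma>: "\<sigma> > 0" "\<sigma>\<^sup>2 = ?V" using False V by (simp_all add: \<sigma>_def order.strict_iff_order)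
      have "weak_conv_m (\<lambda>n. distr M borel (\<lambda>\<omega>. ?S n \<omega> / sqrt (real n * \<sigma>\<^sup>2))) std_normal_distribution"
      proof (rule M.central_limit_theorem_zero_mean)
        show "M.indep_vars (\<lambda>i. borel) (\<lambda>i \<omega>. g (W i \<omega>)) UNIV" by (rule indep_vars_W) simp
        show "M.expectation (\<lambda>\<omega>. g (W n \<omega>)) = 0" for n using mean by (simp add: integral_W[of g])
        show "integrable M (\<lambda>\<omega>. (g (W n \<omega>))\<^sup>2)" for n using integrable_W[OF sq] by simp
        show "M.variance (\<lambda>\<omega>. g (W n \<omega>)) = \<sigma>\<^sup>2" for n
          using mean integral_W[of "\<lambda>w. (g w)\<^sup>2" n] \<sigma> by (simp add: integral_W[of g])
        show "distr M borel (\<lambda>\<omega>. g (W n \<omega>)) = distr P borel g" for n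
        proof -
          have "distr P borel g = distr (distr M P (W n)) borel g" unfolding W_distr ..
          also have "\<dots> = distr M borel (\<lambda>\<omega>. g (W n \<omega>))"
            by (subst distr_distr) (auto simp: comp_def)
          finally show ?thesis ..
        qed
      qed fact
      then have "(\<lambda>n. char (distr M borel (\<lambda>\<omega>. ?S n \<omega> / sqrt (real n * \<sigma>\<^sup>2))) (t * \<sigma>))
          \<longlonglongrightarrow> char std_normal_distribution (t * \<sigma>)"
        by (intro levy_continuity1 M.real_distribution_distr real_dist_normal_dist) auto
      \<comment> \<open>Evaluating at \<open>t * \<sigma>\<close> undoes the
        standardization.\<close>
      moreover have "char (distr M borel (\<lambda>\<omega>. ?S n \<omega> / sqrt (real n * \<sigma>\<^sup>2))) (t * \<sigma>)
          = char (distr M borel (\<lambda>\<omega>. ?S n \<omega> / sqrt (real n))) t" for n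
        using \<sigma>(1) by (simp add: char_def integral_distr real_sqrt_mult)
      ultimately show ?thesis by (simp add: char_normal_law \<sigma>_def)
    next
      case True
      have "AE w in P. (g w)\<^sup>2 = 0" using sq True by (subst (asm) integral_nonneg_eq_0_iff_AE) auto
      then have "AE \<omega> in M. \<forall>i. g (W i \<omega>) = 0"
        unfolding AE_all_countable using AE_W by fastforce
      then have "AE \<omega> in M. ?S n \<omega> / sqrt (real n) = 0" for n by eventually_elim simp
      then have "char (distr M borel (\<lambda>\<omega>. ?S n \<omega> / sqrt (real n))) t = 1" for n
      proof -
        have "char (distr M borel (\<lambda>\<omega>. ?S n \<omega> / sqrt (real n))) t
            = (CLINT \<omega>|M. iexp (t * (?S n \<omega> / sqrt (real n))))"
          unfolding char_def by (subst integral_distr) auto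
        also have "\<dots> = (CLINT \<omega>|M. 1)"
        proof (rule integral_cong_AE)
          show "AE \<omega> in M. iexp (t * (?S n \<omega> / sqrt (real n))) = 1"
            using \<open>\<And>n. AE \<omega> in M. ?S n \<omega> / sqrt (real n) = 0\<close>[of n]
          proof eventually_elim
            case (elim \<omega>)
            show ?case unfolding elim by simp
          qed
        qed simp_all
        finally show ?thesis by (simp add: M.prob_space)
      qed
      moreover have "char (normal_law 0 ?V) t = 1"
        by (simp add: char_normal_law True char_std_normal_distribution)
      ultimately show ?thesis by simp
    qed
  qed
qed

lemma law_of_large_numbers_L2:
  fixes g :: "'w \<Rightarrow> real"
  assumes [measurable]: "g \<in> borel_measurable P" and sq: "integrable P (\<lambda>w. (g w)\<^sup>2)"
    and "(\<integral>w. g w \<partial>P) = 0" and "e > 0"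
  shows "(\<lambda>n. M.prob {\<omega> \<in> space M. \<bar>\<Sum>i<n. g (W i \<omega>)\<bar> > e * real n}) \<longlonglongrightarrow> 0"
proof -
  let ?V = "\<integral>w. (g w)\<^sup>2 \<partial>P"
  have "eventually (\<lambda>n. M.prob {\<omega> \<in> space M. \<bar>\<Sum>i<n. g (W i \<omega>)\<bar> > e * real n} \<le> ?V / e\<^sup>2 / real n) sequentially"
    using eventually_ge_at_top[of 1]
  proof eventually_elim
    case (elim n)
    then show ?case
      using prob_sum_W_le_L2[of g "{..<n}" "e * real n"] assms
      by (simp add: power_mult_distrib power2_eq_square[of "real n"] field_simps)
  qed
  moreover have "(\<lambda>n. ?V / e\<^sup>2 / real n) \<longlonglongrightarrow> 0" by (rule lim_const_over_n)
  ultimately show ?thesis using real_tendsto_sandwich[of "\<lambda>_. 0" _ sequentially "\<lambda>n. ?V / e\<^sup>2 / real n" 0] by simp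
qed

text \<open>Only first moments are assumed, so the summands are truncated before Chebyshev's
  inequality is applied.\<close>

lemma law_of_large_numbers_L1:
  fixes h :: "'w \<Rightarrow> real"
  assumes h: "integrable P h" and "e > 0"
  shows "(\<lambda>n. M.prob {\<omega> \<in> space M. \<bar>(\<Sum>i<n. h (W i \<omega>)) / real n - (\<integral>w. h w \<partial>P)\<bar> > e}) \<longlonglongrightarrow> 0"
proof (rule LIMSEQ_I)
  fix \<delta> :: real assume "\<delta> > 0"
  have [measurable]: "h \<in> borel_measurable P" using h by auto
  let ?t = "\<lambda>k w. if \<bar>h w\<bar> \<le> real k then h w else 0"
  have "(\<lambda>k. \<integral>w. \<bar>h w - ?t k w\<bar> \<partial>P) \<longlonglongrightarrow> (\<integral>w. 0 \<partial>P)"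
  proof (rule integral_dominated_convergence[where w = "\<lambda>w. \<bar>h w\<bar>"])
    show "AE w in P. (\<lambda>k. \<bar>h w - ?t k w\<bar>) \<longlonglongrightarrow> 0"
    proof (rule AE_I2)
      fix w
      obtain k0 where "\<bar>h w\<bar> \<le> real k0" using real_arch_simple by blast
      then have "eventually (\<lambda>k. \<bar>h w - ?t k w\<bar> = 0) sequentially"
        by (intro eventually_sequentiallyI[of k0]) auto
      then show "(\<lambda>k. \<bar>h w - ?t k w\<bar>) \<longlonglongrightarrow> 0" by (rule tendsto_eventually)
    qed
  qed (use h in auto)
  then have "eventually (\<lambda>k. (\<integral>w. \<bar>h w - ?t k w\<bar> \<partial>P) < min (e / 3) (e * \<delta> / 6)) sequentially"
    using order_tendstoD(2)[of "\<lambda>k. \<integral>w. \<bar>h w - ?t k w\<bar> \<partial>P" 0 sequentially "min (e / 3) (e * \<delta> / 6)"]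
      \<open>e > 0\<close> \<open>\<delta> > 0\<close> by simp
  \<comment> \<open>The truncation error is kept below \<open>e / 3\<close> to control the shift of
    the mean, and below \<open>e * \<delta> / 6\<close> so that Markov's inequality at level
    \<open>e / 3\<close> leaves probability \<open>\<delta> / 2\<close>.\<close>
  then obtain k where k: "(\<integral>w. \<bar>h w - ?t k w\<bar> \<partial>P) < min (e / 3) (e * \<delta> / 6)"
    by (auto simp: eventually_sequentially)
  define u where "u = ?t k"
  define m where "m = (\<integral>w. u w \<partial>P)"
  have [measurable]: "u \<in> borel_measurable P" by (simp add: u_def)
  have int_u: "integrable P u" by (rule P.integrable_const_bound[of _ "real k"]) (auto simp: u_def)
  have int_u2: "integrable P (\<lambda>w. (u w - m)\<^sup>2)"
  proof (rule P.integrable_const_bound[of _ "(real k + \<bar>m\<bar>)\<^sup>2"])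
    have "\<bar>u w - m\<bar> \<le> \<bar>real k + \<bar>m\<bar>\<bar>" for w by (auto simp: u_def)
    then show "AE w in P. norm ((u w - m)\<^sup>2) \<le> (real k + \<bar>m\<bar>)\<^sup>2"
      by (simp only: abs_le_square_iff real_norm_def abs_power2) simp
  qed simp
  have "(\<lambda>n. M.prob {\<omega> \<in> space M. \<bar>\<Sum>i<n. u (W i \<omega>) - m\<bar> > (e / 3) * real n}) \<longlonglongrightarrow> 0"
    using int_u \<open>e > 0\<close> int_u2 by (intro law_of_large_numbers_L2) (auto simp: m_def P.prob_space)
  from order_tendstoD(2)[OF this, of "\<delta> / 2"]
  have "eventually (\<lambda>n. M.prob {\<omega> \<in> space M. \<bar>\<Sum>i<n. u (W i \<omega>) - m\<bar> > (e / 3) * real n} < \<delta> / 2) sequentially"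
    using \<open>\<delta> > 0\<close> by simp
  then have "eventually (\<lambda>n. norm (M.prob {\<omega> \<in> space M. \<bar>(\<Sum>i<n. h (W i \<omega>)) / real n - (\<integral>w. h w \<partial>P)\<bar> > e} - 0) < \<delta>) sequentially"
    using eventually_ge_at_top[of 1]
  proof eventually_elim
    case (elim n)
    let ?A = "{\<omega> \<in> space M. \<bar>\<Sum>i<n. u (W i \<omega>) - m\<bar> > (e / 3) * real n}"
    let ?B = "{\<omega> \<in> space M. \<bar>\<Sum>i<n. h (W i \<omega>) - u (W i \<omega>)\<bar> > (e / 3) * real n}"
    have mean: "\<bar>(\<integral>w. h w \<partial>P) - m\<bar> < e / 3"
    proof -
      have "\<bar>(\<integral>w. h w \<partial>P) - m\<bar> = \<bar>\<integral>w. h w - u w \<partial>P\<bar>" using h int_u by (simp add: m_def)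
      also have "\<dots> \<le> (\<integral>w. \<bar>h w - u w\<bar> \<partial>P)" by (rule integral_abs_bound)
      finally show ?thesis using k by (simp add: u_def)
    qed
    have B: "M.prob ?B < \<delta> / 2"
    proof -
      have "M.prob ?B \<le> real (card {..<n}) * (\<integral>w. \<bar>h w - u w\<bar> \<partial>P) / ((e / 3) * real n)"
        using h int_u elim \<open>e > 0\<close> prob_sum_W_le_L1[of "\<lambda>w. h w - u w" "{..<n}" "(e / 3) * real n"] by simp
      also have "\<dots> = 3 / e * (\<integral>w. \<bar>h w - u w\<bar> \<partial>P)" using elim by simp
      also have "\<dots> < 3 / e * (e * \<delta> / 6)" using k \<open>e > 0\<close> by (intro mult_strict_left_mono) (auto simp: u_def)
      also have "\<dots> = \<delta> / 2" using \<open>e > 0\<close> by simp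
      finally show ?thesis .
    qed
    have "{\<omega> \<in> space M. \<bar>(\<Sum>i<n. h (W i \<omega>)) / real n - (\<integral>w. h w \<partial>P)\<bar> > e} \<subseteq> ?A \<union> ?B"
    proof (rule subsetI, rule ccontr)
      fix \<omega> assume \<omega>: "\<omega> \<in> {\<omega> \<in> space M. \<bar>(\<Sum>i<n. h (W i \<omega>)) / real n - (\<integral>w. h w \<partial>P)\<bar> > e}" "\<omega> \<notin> ?A \<union> ?B"
      let ?a = "(\<Sum>i<n. u (W i \<omega>) - m) / real n" and ?b = "(\<Sum>i<n. h (W i \<omega>) - u (W i \<omega>)) / real n"
      have "\<bar>?a\<bar> \<le> e / 3" "\<bar>?b\<bar> \<le> e / 3" using \<omega> elim by (auto simp: field_simps)
      moreover have "(\<Sum>i<n. h (W i \<omega>)) / real n = ?a + ?b + m"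
        using elim by (simp add: sum_subtractf field_simps)
      ultimately have "\<bar>(\<Sum>i<n. h (W i \<omega>)) / real n - (\<integral>w. h w \<partial>P)\<bar> \<le> e" using mean by linarith
      then show False using \<omega> by simp
    qed
    then have "M.prob {\<omega> \<in> space M. \<bar>(\<Sum>i<n. h (W i \<omega>)) / real n - (\<integral>w. h w \<partial>P)\<bar> > e} \<le> M.prob (?A \<union> ?B)"
      by (intro M.finite_measure_mono) auto
    also have "\<dots> \<le> M.prob ?A + M.prob ?B" by (intro measure_Un_le) auto
    finally show ?case using elim B by simp
  qed
  then show "\<exists>no. \<forall>n\<ge>no. norm (M.prob {\<omega> \<in> space M. \<bar>(\<Sum>i<n. h (W i \<omega>)) / real n - (\<integral>w. h w \<partial>P)\<bar> > e} - 0) < \<delta>"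
    by (simp add: eventually_sequentially)
qed

end

section \<open>Bounded dictionaries\<close>

lemma integrable_mult_L2:
  fixes f g :: "'a \<Rightarrow> real"
  assumes [measurable]: "f \<in> borel_measurable M" "g \<in> borel_measurable M"
    and "integrable M (\<lambda>x. (f x)\<^sup>2)" "integrable M (\<lambda>x. (g x)\<^sup>2)"
  shows "integrable M (\<lambda>x. f x * g x)"
proof (rule Bochner_Integration.integrable_bound[of M "\<lambda>x. (f x)\<^sup>2 + (g x)\<^sup>2"])
  have "\<bar>u * v\<bar> \<le> u\<^sup>2 + v\<^sup>2" for u v :: real
    using sum_squares_bound[of "\<bar>u\<bar>" "\<bar>v\<bar>"] zero_le_power2[of u] zero_le_power2[of v]
    unfolding abs_mult power2_abs by linarith
  then show "AE x in M. norm (f x * g x) \<le> norm ((f x)\<^sup>2 + (g x)\<^sup>2)" by simp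
qed (use assms in auto)

lemma integrable_add_square:
  fixes f g :: "'a \<Rightarrow> real"
  assumes "f \<in> borel_measurable M" "g \<in> borel_measurable M"
    and "integrable M (\<lambda>x. (f x)\<^sup>2)" "integrable M (\<lambda>x. (g x)\<^sup>2)"
  shows "integrable M (\<lambda>x. (f x + g x)\<^sup>2)" "integrable M (\<lambda>x. (f x - g x)\<^sup>2)"
  using assms integrable_mult_L2[OF assms] by (simp_all add: power2_sum power2_diff mult.assoc)

lemma Cauchy_Schwarz_integral:
  fixes f g :: "'a \<Rightarrow> real"
  assumes [measurable]: "f \<in> borel_measurable M" "g \<in> borel_measurable M"
    and f: "integrable M (\<lambda>x. (f x)\<^sup>2)" and g: "integrable M (\<lambda>x. (g x)\<^sup>2)"
  shows "(\<integral>x. \<bar>f x * g x\<bar> \<partial>M) \<le> sqrt (\<integral>x. (f x)\<^sup>2 \<partial>M) * sqrt (\<integral>x. (g x)\<^sup>2 \<partial>M)"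
proof -
  let ?F = "\<integral>x. (f x)\<^sup>2 \<partial>M" and ?G = "\<integral>x. (g x)\<^sup>2 \<partial>M" and ?I = "\<integral>x. \<bar>f x * g x\<bar> \<partial>M"
  have int: "integrable M (\<lambda>x. \<bar>f x * g x\<bar>)" using integrable_mult_L2[OF assms] by simp
  have nn: "?F \<ge> 0" "?G \<ge> 0" "?I \<ge> 0" by simp_all
  \<comment> \<open>Weighted arithmetic-geometric mean inequality;
    \<open>c = sqrt ?G / sqrt ?F\<close> later makes the two terms equal.\<close>
  have le: "2 * ?I \<le> c * ?F + ?G / c" if "c > 0" for c
  proof -
    have "2 * \<bar>u * v\<bar> \<le> c * u\<^sup>2 + v\<^sup>2 / c" for u v :: real
    proof -
      have "0 \<le> (sqrt c * \<bar>u\<bar> - \<bar>v\<bar> / sqrt c)\<^sup>2" by simp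
      then show ?thesis using that by (simp add: power2_diff power_mult_distrib power_divide abs_mult)
    qed
    then have "(\<integral>x. 2 * \<bar>f x * g x\<bar> \<partial>M) \<le> (\<integral>x. c * (f x)\<^sup>2 + (g x)\<^sup>2 / c \<partial>M)"
      using int f g by (intro integral_mono) auto
    then show ?thesis using f g by simp
  qed
  show ?thesis
  proof (cases "?F = 0 \<or> ?G = 0")
    case True
    then have "AE x in M. f x * g x = 0"
    proof
      assume "?F = 0"
      then have "AE x in M. (f x)\<^sup>2 = 0" using f by (subst (asm) integral_nonneg_eq_0_iff_AE) auto
      then show ?thesis by eventually_elim simp
    next
      assume "?G = 0"
      then have "AE x in M. (g x)\<^sup>2 = 0" using g by (subst (asm) integral_nonneg_eq_0_iff_AE) auto
      then show ?thesis by eventually_elim simp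
    qed
    then have "?I = (\<integral>x. 0 \<partial>M)" by (intro integral_cong_AE) auto
    then show ?thesis by (simp add: nn)
  next
    case False
    then have pos: "sqrt ?F > 0" "sqrt ?G > 0" using nn by (auto simp: order.strict_iff_order)
    have "2 * ?I \<le> sqrt ?G / sqrt ?F * ?F + ?G / (sqrt ?G / sqrt ?F)"
      using pos by (intro le) simp
    also have "sqrt ?G / sqrt ?F * ?F = sqrt ?G * sqrt ?F"
      using pos nn by (simp add: field_simps)
    also have "?G / (sqrt ?G / sqrt ?F) = sqrt ?G * sqrt ?F"
      using pos nn by (simp add: field_simps)
    finally show ?thesis by (simp add: mult.commute)
  qed
qed

lemma L2_norm_square: "(L2_norm P a)\<^sup>2 = (\<integral>w. (a w)\<^sup>2 \<partial>P)"
  by (simp add: L2_norm_def)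

lemma L2_norm_nonneg: "L2_norm P a \<ge> 0"
  by (simp add: L2_norm_def)

lemma lin_comb_add: "lin_comb b p (\<lambda>j. u j + v j) x = lin_comb b p u x + lin_comb b p v x"
  by (simp add: lin_comb_def algebra_simps sum.distrib)

lemma lin_comb_diff: "lin_comb b p (\<lambda>j. u j - v j) x = lin_comb b p u x - lin_comb b p v x"
  by (simp add: lin_comb_def algebra_simps sum_subtractf)

locale bounded_dictionary = prob_space P
  for P :: "'w measure" +
  fixes N :: "'x measure" and X :: "'w \<Rightarrow> 'x" and b :: "nat \<Rightarrow> 'x \<Rightarrow> real" and Cb :: real
  assumes X_measurable [measurable]: "X \<in> measurable P N"
    and b_measurable [measurable]: "\<And>j. b j \<in> borel_measurable N"
    and Cb_pos: "Cb > 0"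
    and b_bounded: "AE w in P. \<forall>j. \<bar>b j (X w)\<bar> \<le> Cb"
begin

lemma lin_comb_measurable [measurable]: "lin_comb b p \<rho> \<in> borel_measurable N"
  unfolding lin_comb_def by measurable

lemma abs_lin_comb_le:
  assumes "\<forall>j. \<bar>b j (X w)\<bar> \<le> Cb"
  shows "\<bar>lin_comb b p \<rho> (X w)\<bar> \<le> Cb * (\<Sum>j<p. \<bar>\<rho> j\<bar>)"
proof -
  have "\<bar>lin_comb b p \<rho> (X w)\<bar> \<le> (\<Sum>j<p. \<bar>b j (X w) * \<rho> j\<bar>)" unfolding lin_comb_def by (rule sum_abs)
  also have "\<dots> \<le> (\<Sum>j<p. Cb * \<bar>\<rho> j\<bar>)"
    using assms by (intro sum_mono) (auto simp: abs_mult intro: mult_right_mono)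
  finally show ?thesis by (simp add: sum_distrib_left)
qed

lemma AE_lin_comb_le: "AE w in P. \<bar>lin_comb b p \<rho> (X w)\<bar> \<le> Cb * (\<Sum>j<p. \<bar>\<rho> j\<bar>)"
  using b_bounded by eventually_elim (rule abs_lin_comb_le)

lemma integrable_square_bounded:
  fixes f :: "'w \<Rightarrow> real"
  assumes [measurable]: "f \<in> borel_measurable P" and "AE w in P. \<bar>f w\<bar> \<le> K"
  shows "integrable P (\<lambda>w. (f w)\<^sup>2)"
proof (rule integrable_const_bound[of _ "K\<^sup>2"])
  show "AE w in P. norm ((f w)\<^sup>2) \<le> K\<^sup>2"
    using assms(2) by eventually_elim (simp add: abs_le_square_iff[symmetric])
qed simp

lemma integrable_lin_comb_square: "integrable P (\<lambda>w. (lin_comb b p \<rho> (X w))\<^sup>2)"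
  by (rule integrable_square_bounded[OF _ AE_lin_comb_le]) simp

lemma integrable_b_square: "integrable P (\<lambda>w. (b j (X w))\<^sup>2)"
  by (rule integrable_square_bounded[of _ Cb]) (use b_bounded in \<open>auto elim: eventually_mono\<close>)

lemma integral_b_square_le: "(\<integral>w. (b j (X w))\<^sup>2 \<partial>P) \<le> Cb\<^sup>2"
proof -
  have "(\<integral>w. (b j (X w))\<^sup>2 \<partial>P) \<le> (\<integral>w. Cb\<^sup>2 \<partial>P)"
  proof (rule integral_mono_AE)
    show "AE w in P. (b j (X w))\<^sup>2 \<le> Cb\<^sup>2"
      using b_bounded by eventually_elim (use Cb_pos in \<open>auto simp: abs_le_square_iff[symmetric]\<close>)
  qed (use integrable_b_square in auto)
  then show ?thesis by (simp add: prob_space)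
qed

lemma quad_form_gram:
  "quad_form p (\<lambda>j k. \<integral>w. b j (X w) * b k (X w) \<partial>P) v = (\<integral>w. (lin_comb b p v (X w))\<^sup>2 \<partial>P)"
proof -
  have int: "integrable P (\<lambda>w. b j (X w) * b k (X w))" for j k
    by (rule integrable_mult_L2) (use integrable_b_square in auto)
  have "(\<integral>w. (lin_comb b p v (X w))\<^sup>2 \<partial>P)
      = (\<integral>w. (\<Sum>j<p. \<Sum>k<p. (v j * v k) * (b j (X w) * b k (X w))) \<partial>P)"
    by (simp add: lin_comb_def power2_eq_square sum_product mult_ac)
  also have "\<dots> = (\<Sum>j<p. \<Sum>k<p. (v j * v k) * (\<integral>w. b j (X w) * b k (X w) \<partial>P))"
    using int by (simp add: Bochner_Integration.integral_sum Bochner_Integration.integrable_sum)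
  finally show ?thesis by (simp add: quad_form_def mult_ac)
qed

lemma G_hat_quad_form:
  "quad_form p (G_hat X b T d) v = (\<Sum>i\<in>T. (lin_comb b p v (X (d i)))\<^sup>2) / real (card T)"
proof -
  have "quad_form p (G_hat X b T d) v
      = (\<Sum>j<p. \<Sum>k<p. \<Sum>i\<in>T. v j * (b j (X (d i)) * b k (X (d i))) * v k) / real (card T)"
    by (simp add: quad_form_def G_hat_def sum_divide_distrib sum_distrib_left sum_distrib_right)
  also have "(\<Sum>j<p. \<Sum>k<p. \<Sum>i\<in>T. v j * (b j (X (d i)) * b k (X (d i))) * v k)
      = (\<Sum>i\<in>T. \<Sum>j<p. \<Sum>k<p. v j * (b j (X (d i)) * b k (X (d i))) * v k)"
    by (simp only: sum.swap[of _ T])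
  also have "\<dots> = (\<Sum>i\<in>T. (lin_comb b p v (X (d i)))\<^sup>2)"
    by (simp add: lin_comb_def power2_eq_square sum_product mult_ac)
  finally show ?thesis .
qed

lemma G_hat_mult:
  "(\<Sum>k<p. G_hat X b T d j k * v k) = (\<Sum>i\<in>T. b j (X (d i)) * lin_comb b p v (X (d i))) / real (card T)"
proof -
  have "(\<Sum>k<p. G_hat X b T d j k * v k)
      = (\<Sum>k<p. \<Sum>i\<in>T. b j (X (d i)) * (b k (X (d i)) * v k)) / real (card T)"
    by (simp add: G_hat_def sum_divide_distrib sum_distrib_right mult.assoc)
  also have "(\<Sum>k<p. \<Sum>i\<in>T. b j (X (d i)) * (b k (X (d i)) * v k))
      = (\<Sum>i\<in>T. \<Sum>k<p. b j (X (d i)) * (b k (X (d i)) * v k))"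
    by (rule sum.swap)
  finally show ?thesis by (simp add: lin_comb_def sum_distrib_left)
qed

lemma G_hat_sym: "G_hat X b T d j k = G_hat X b T d k j"
  by (simp add: G_hat_def mult.commute)

lemma G_hat_psd: "quad_form p (G_hat X b T d) v \<ge> 0"
  unfolding G_hat_quad_form by (intro divide_nonneg_nonneg sum_nonneg) auto

text \<open>Coordinate descent: as long as some correlation with the residual exceeds \<open>t\<close>, moving in that
  coordinate lowers the squared error by at least \<open>t\<^sup>2 / Cb\<^sup>2\<close> and adds at most one term.  The final
  coefficients make the bias of the Lasso score negligible without needing to be a projection.\<close>

lemma greedy_approximation:
  fixes a :: "'x \<Rightarrow> real"
  assumes a [measurable]: "a \<in> borel_measurable N" and a2: "integrable P (\<lambda>w. (a (X w))\<^sup>2)" and t: "t > 0"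
    and "(\<integral>w. (a (X w) - lin_comb b p \<rho> (X w))\<^sup>2 \<partial>P) \<le> real k * (t\<^sup>2 / Cb\<^sup>2)"
  shows "\<exists>u. (\<forall>j<p. \<bar>\<integral>w. (a (X w) - lin_comb b p u (X w)) * b j (X w) \<partial>P\<bar> \<le> t) \<and>
    card {j \<in> {..<p}. u j \<noteq> 0} \<le> card {j \<in> {..<p}. \<rho> j \<noteq> 0} + k \<and>
    t * (\<Sum>j<p. \<bar>u j\<bar>) + (\<integral>w. (a (X w) - lin_comb b p u (X w))\<^sup>2 \<partial>P)
      \<le> t * (\<Sum>j<p. \<bar>\<rho> j\<bar>) + (\<integral>w. (a (X w) - lin_comb b p \<rho> (X w))\<^sup>2 \<partial>P) \<and>
    (\<integral>w. (a (X w) - lin_comb b p u (X w))\<^sup>2 \<partial>P) \<le> (\<integral>w. (a (X w) - lin_comb b p \<rho> (X w))\<^sup>2 \<partial>P)"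
  using assms(4)
\<comment> \<open>\<open>k\<close> is the remaining error budget in units of
  \<open>t\<^sup>2 / Cb\<^sup>2\<close>. Every move spends at least one unit; with none left the
  residual vanishes almost everywhere and all correlations are 0.\<close>
proof (induction k arbitrary: \<rho>)
  case (0 \<rho>)
  let ?e = "\<lambda>w. a (X w) - lin_comb b p \<rho> (X w)"
  have e2: "integrable P (\<lambda>w. (?e w)\<^sup>2)"
    by (rule integrable_add_square(2)) (use a2 integrable_lin_comb_square in auto)
  have "(\<integral>w. (?e w)\<^sup>2 \<partial>P) = 0" using 0 by (simp add: antisym)
  then have "AE w in P. (?e w)\<^sup>2 = 0" using e2 by (subst (asm) integral_nonneg_eq_0_iff_AE) auto
  then have "AE w in P. ?e w * b j (X w) = 0" for j by eventually_elim simp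
  then have "(\<integral>w. ?e w * b j (X w) \<partial>P) = 0" for j by (rule integral_eq_zero_AE)
  then show ?case using t by (intro exI[of _ \<rho>]) auto
next
  case (Suc k \<rho>)
  let ?e = "\<lambda>w. a (X w) - lin_comb b p \<rho> (X w)"
  have e2: "integrable P (\<lambda>w. (?e w)\<^sup>2)"
    by (rule integrable_add_square(2)) (use a2 integrable_lin_comb_square in auto)
  show ?case
  proof (cases "\<forall>j<p. \<bar>\<integral>w. ?e w * b j (X w) \<partial>P\<bar> \<le> t")
    case True
    then show ?thesis by (intro exI[of _ \<rho>]) auto
  next
    case False
    then obtain i where i: "i < p" "\<bar>\<integral>w. ?e w * b i (X w) \<partial>P\<bar> > t" by (auto simp: not_le)
    define E where "E = (\<integral>w. ?e w * b i (X w) \<partial>P)"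
    \<comment> \<open>The step length minimizes \<open>- 2 * s * E + s\<^sup>2 * Cb\<^sup>2\<close>,
      the change of the squared error with the second moment of \<open>b i\<close> replaced by its
      upper bound.\<close>
    define s where "s = E / Cb\<^sup>2"
    define \<rho>1 where "\<rho>1 = (\<lambda>j. \<rho> j + (if j = i then s else 0))"
    have lc: "lin_comb b p \<rho>1 x = lin_comb b p \<rho> x + s * b i x" for x
      unfolding \<rho>1_def lin_comb_add using i by (simp add: lin_comb_def if_distrib sum.delta' cong: if_cong)
    have eb: "integrable P (\<lambda>w. ?e w * b i (X w))"
      by (rule integrable_mult_L2) (use e2 integrable_b_square in auto)
    have "(\<integral>w. (a (X w) - lin_comb b p \<rho>1 (X w))\<^sup>2 \<partial>P)
        = (\<integral>w. (?e w)\<^sup>2 - 2 * s * (?e w * b i (X w)) + s\<^sup>2 * (b i (X w))\<^sup>2 \<partial>P)"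
      by (intro Bochner_Integration.integral_cong refl) (simp add: lc power2_eq_square algebra_simps)
    also have "\<dots> = (\<integral>w. (?e w)\<^sup>2 \<partial>P) - 2 * s * E + s\<^sup>2 * (\<integral>w. (b i (X w))\<^sup>2 \<partial>P)"
      using e2 eb integrable_b_square by (simp add: E_def)
    also have "\<dots> \<le> (\<integral>w. (?e w)\<^sup>2 \<partial>P) - 2 * s * E + s\<^sup>2 * Cb\<^sup>2"
      using integral_b_square_le[of i] by (intro add_left_mono mult_left_mono) auto
    also have "\<dots> = (\<integral>w. (?e w)\<^sup>2 \<partial>P) - E\<^sup>2 / Cb\<^sup>2"
      using Cb_pos by (simp add: s_def field_simps power2_eq_square)
    finally have err: "(\<integral>w. (a (X w) - lin_comb b p \<rho>1 (X w))\<^sup>2 \<partial>P) \<le> (\<integral>w. (?e w)\<^sup>2 \<partial>P) - E\<^sup>2 / Cb\<^sup>2" .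
    have E: "\<bar>E\<bar> > t" using i by (simp add: E_def)
    have tE: "t\<^sup>2 / Cb\<^sup>2 \<le> E\<^sup>2 / Cb\<^sup>2" "t * \<bar>s\<bar> \<le> E\<^sup>2 / Cb\<^sup>2"
    proof -
      have "t\<^sup>2 \<le> E\<^sup>2" using E t by (simp add: abs_le_square_iff[symmetric])
      then show "t\<^sup>2 / Cb\<^sup>2 \<le> E\<^sup>2 / Cb\<^sup>2" by (simp add: divide_right_mono)
      have "t * \<bar>E\<bar> \<le> \<bar>E\<bar> * \<bar>E\<bar>" using E by (intro mult_right_mono) auto
      then have "t * \<bar>E\<bar> \<le> E\<^sup>2" by (simp add: power2_eq_square)
      then show "t * \<bar>s\<bar> \<le> E\<^sup>2 / Cb\<^sup>2" by (simp add: s_def abs_divide divide_right_mono)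
    qed
    have "(\<integral>w. (a (X w) - lin_comb b p \<rho>1 (X w))\<^sup>2 \<partial>P) \<le> real k * (t\<^sup>2 / Cb\<^sup>2)"
    proof -
      have "real (Suc k) * (t\<^sup>2 / Cb\<^sup>2) = real k * (t\<^sup>2 / Cb\<^sup>2) + t\<^sup>2 / Cb\<^sup>2"
        by (simp only: of_nat_Suc distrib_right mult_1_left add.commute)
      then show ?thesis using err tE(1) Suc.prems by linarith
    qed
    from Suc.IH[OF this] obtain u where u:
      "\<forall>j<p. \<bar>\<integral>w. (a (X w) - lin_comb b p u (X w)) * b j (X w) \<partial>P\<bar> \<le> t"
      "card {j \<in> {..<p}. u j \<noteq> 0} \<le> card {j \<in> {..<p}. \<rho>1 j \<noteq> 0} + k"
      "t * (\<Sum>j<p. \<bar>u j\<bar>) + (\<integral>w. (a (X w) - lin_comb b p u (X w))\<^sup>2 \<partial>P)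
        \<le> t * (\<Sum>j<p. \<bar>\<rho>1 j\<bar>) + (\<integral>w. (a (X w) - lin_comb b p \<rho>1 (X w))\<^sup>2 \<partial>P)"
      "(\<integral>w. (a (X w) - lin_comb b p u (X w))\<^sup>2 \<partial>P) \<le> (\<integral>w. (a (X w) - lin_comb b p \<rho>1 (X w))\<^sup>2 \<partial>P)"
      by blast
    have c1: "card {j \<in> {..<p}. \<rho>1 j \<noteq> 0} \<le> card {j \<in> {..<p}. \<rho> j \<noteq> 0} + 1"
    proof -
      have "card {j \<in> {..<p}. \<rho>1 j \<noteq> 0} \<le> card (insert i {j \<in> {..<p}. \<rho> j \<noteq> 0})"
        by (intro card_mono) (auto simp: \<rho>1_def)
      also have "\<dots> \<le> card {j \<in> {..<p}. \<rho> j \<noteq> 0} + 1" by (simp add: card_insert_if)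
      finally show ?thesis .
    qed
    have l1: "(\<Sum>j<p. \<bar>\<rho>1 j\<bar>) \<le> (\<Sum>j<p. \<bar>\<rho> j\<bar>) + \<bar>s\<bar>"
    proof -
      have "(\<Sum>j<p. \<bar>\<rho>1 j\<bar>) \<le> (\<Sum>j<p. \<bar>\<rho> j\<bar> + (if j = i then \<bar>s\<bar> else 0))"
        by (intro sum_mono) (auto simp: \<rho>1_def)
      also have "\<dots> = (\<Sum>j<p. \<bar>\<rho> j\<bar>) + \<bar>s\<bar>" using i by (simp add: sum.distrib)
      finally show ?thesis .
    qed
    \<comment> \<open>The increase \<open>t * \<bar>s\<bar>\<close> of the weighted coefficient sum
      is paid for by the decrease \<open>E\<^sup>2 / Cb\<^sup>2\<close> of the squared error,
      because \<open>t < \<bar>E\<bar>\<close>. So the sum of the two does not grow.\<close>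
    have "t * (\<Sum>j<p. \<bar>\<rho>1 j\<bar>) \<le> t * (\<Sum>j<p. \<bar>\<rho> j\<bar>) + t * \<bar>s\<bar>"
      using mult_left_mono[OF l1, of t] t by (simp add: distrib_left)
    moreover have "E\<^sup>2 / Cb\<^sup>2 \<ge> 0" by simp
    ultimately have "(\<integral>w. (a (X w) - lin_comb b p u (X w))\<^sup>2 \<partial>P) \<le> (\<integral>w. (?e w)\<^sup>2 \<partial>P)"
      "t * (\<Sum>j<p. \<bar>u j\<bar>) + (\<integral>w. (a (X w) - lin_comb b p u (X w))\<^sup>2 \<partial>P)
        \<le> t * (\<Sum>j<p. \<bar>\<rho> j\<bar>) + (\<integral>w. (?e w)\<^sup>2 \<partial>P)"
      using u(3,4) err tE(2) by linarith+
    then show ?thesis using u(1,2) c1 by (intro exI[of _ u]) auto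
  qed
qed

end

section \<open>The weighted average derivative functional\<close>

text \<open>A pointwise limit of difference quotients where \<open>pdf\<close> is positive. Where
  \<open>pdf\<close> is 0 the convention \<open>inverse 0 = 0\<close> makes both the quotients and
  the score 0, whatever the value of \<open>deriv\<close> there.\<close>

lemma score_measurable:
  assumes [measurable]: "pdf \<in> borel_measurable borel" and nonneg: "\<And>u. pdf u \<ge> 0"
    and diff: "\<And>u. pdf u > 0 \<Longrightarrow> pdf differentiable (at u)"
  shows "score pdf \<in> borel_measurable borel"
proof (rule borel_measurable_LIMSEQ_real)
  let ?q = "\<lambda>n u. - (inverse (pdf u) * ((pdf (u + 1 / real (Suc n)) - pdf u) / (1 / real (Suc n))))"
  show "?q n \<in> borel_measurable borel" for n by measurable
  fix u
  show "(\<lambda>n. ?q n u) \<longlonglongrightarrow> score pdf u"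
  proof (cases "pdf u > 0")
    case True
    then have "(pdf has_field_derivative deriv pdf u) (at u)"
      using diff by (simp add: DERIV_deriv_iff_real_differentiable)
    then have "((\<lambda>h. (pdf (u + h) - pdf u) / h) \<longlongrightarrow> deriv pdf u) (at 0)"
      by (simp add: DERIV_def)
    moreover have "filterlim (\<lambda>n. 1 / real (Suc n)) (at 0) sequentially"
      using LIMSEQ_Suc[OF lim_1_over_n] by (auto simp: filterlim_at)
    ultimately have "(\<lambda>n. (pdf (u + 1 / real (Suc n)) - pdf u) / (1 / real (Suc n))) \<longlonglongrightarrow> deriv pdf u"
      by (rule filterlim_compose)
    then show ?thesis unfolding score_def by (intro tendsto_intros)
  next
    case False
    then have "pdf u = 0" using nonneg[of u] by simp
    then show ?thesis by (simp add: score_def)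
  qed
qed

text \<open>The moment bounds use the Riesz representation only, applied to \<open>\<gamma>(u, z) = S(u) h(u, z)\<close>.\<close>

locale wad_functional = prob_space P
  for P :: "'w measure" +
  fixes MZ :: "'z measure" and D U :: "'w \<Rightarrow> real" and Z :: "'w \<Rightarrow> 'z" and X :: "'w \<Rightarrow> real \<times> 'z"
    and pdf :: "real \<Rightarrow> real" and \<alpha>0 :: "real \<times> 'z \<Rightarrow> real" and C K :: real
  assumes D_measurable [measurable]: "D \<in> borel_measurable P"
    and U_measurable [measurable]: "U \<in> borel_measurable P"
    and Z_measurable [measurable]: "Z \<in> measurable P MZ"
    and X_eq: "X = (\<lambda>w. (D w, Z w))"
    and score_borel [measurable]: "score pdf \<in> borel_measurable borel"
    and score_bounded: "\<And>u. \<bar>score pdf u\<bar> \<le> C" and C_pos: "C > 0"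
    and \<alpha>0_bounded: "AE w in P. \<bar>\<alpha>0 (X w)\<bar> \<le> K" and K_nonneg: "K \<ge> 0"
    and riesz: "\<And>\<gamma>. \<gamma> \<in> L2_functions P (borel \<Otimes>\<^sub>M MZ) X \<Longrightarrow>
      integrable P (\<lambda>w. wad_moment pdf U Z w \<gamma>) \<and> integrable P (\<lambda>w. \<alpha>0 (X w) * \<gamma> (X w)) \<and>
      (\<integral>w. wad_moment pdf U Z w \<gamma> \<partial>P) = (\<integral>w. \<alpha>0 (X w) * \<gamma> (X w) \<partial>P)"
begin

lemma X_measurable [measurable]: "X \<in> measurable P (borel \<Otimes>\<^sub>M MZ)"
  unfolding X_eq by measurable

lemma wad_moment_measurable:
  assumes [measurable]: "\<gamma> \<in> borel_measurable (borel \<Otimes>\<^sub>M MZ)"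
  shows "(\<lambda>w. wad_moment pdf U Z w \<gamma>) \<in> borel_measurable P"
  unfolding wad_moment_def by measurable

text \<open>The moment evaluates at \<open>(U, Z)\<close> while norms are taken at \<open>X\<close>;
  the Riesz identity is the bridge between the two laws. A bounded \<open>h\<close> puts the test
  function into the mean-square space, and at \<open>X\<close> the representer and the score are
  bounded by \<open>K\<close> and \<open>C\<close>.\<close>

lemma nn_integral_score_bounded_le:
  assumes [measurable]: "h \<in> borel_measurable (borel \<Otimes>\<^sub>M MZ)" and h: "\<And>x. 0 \<le> h x" "\<And>x. h x \<le> B"
  shows "(\<integral>\<^sup>+w. ennreal ((score pdf (U w))\<^sup>2 * h (U w, Z w)) \<partial>P)
    \<le> ennreal (C * K) * (\<integral>\<^sup>+w. ennreal (h (X w)) \<partial>P)"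
proof -
  let ?\<gamma> = "\<lambda>x. score pdf (fst x) * h x"
  have B: "B \<ge> 0" using h(1,2)[of undefined] by linarith
  have bnd: "\<bar>?\<gamma> x\<bar> \<le> C * B" for x
    using score_bounded[of "fst x"] h[of x] B by (auto simp: abs_mult intro!: mult_mono)
  have L2: "?\<gamma> \<in> L2_functions P (borel \<Otimes>\<^sub>M MZ) X"
    unfolding L2_functions_def
  proof safe
    show "integrable P (\<lambda>w. (?\<gamma> (X w))\<^sup>2)"
    proof (rule integrable_const_bound[of _ "(C * B)\<^sup>2"])
      have "(?\<gamma> x)\<^sup>2 \<le> (C * B)\<^sup>2" for x
        using power_mono[OF bnd[of x] abs_ge_zero, of 2] by simp
      then show "AE w in P. norm ((?\<gamma> (X w))\<^sup>2) \<le> (C * B)\<^sup>2" by simp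
    qed measurable
  qed measurable
  have int_h: "integrable P (\<lambda>w. h (X w))"
    using h by (intro integrable_const_bound[of _ B]) auto
  have eq: "wad_moment pdf U Z w ?\<gamma> = (score pdf (U w))\<^sup>2 * h (U w, Z w)" for w
    by (simp add: wad_moment_def power2_eq_square)
  have "(\<integral>\<^sup>+w. ennreal ((score pdf (U w))\<^sup>2 * h (U w, Z w)) \<partial>P)
      = ennreal (\<integral>w. (score pdf (U w))\<^sup>2 * h (U w, Z w) \<partial>P)"
    using riesz[OF L2] h unfolding eq by (intro nn_integral_eq_integral) auto
  also have "(\<integral>w. (score pdf (U w))\<^sup>2 * h (U w, Z w) \<partial>P) = (\<integral>w. \<alpha>0 (X w) * ?\<gamma> (X w) \<partial>P)"
    using riesz[OF L2] unfolding eq by blast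
  also have "\<dots> \<le> (\<integral>w. (C * K) * h (X w) \<partial>P)"
  proof (rule integral_mono_AE)
    show "AE w in P. \<alpha>0 (X w) * ?\<gamma> (X w) \<le> (C * K) * h (X w)"
      using \<alpha>0_bounded
    proof eventually_elim
      case (elim w)
      have "\<alpha>0 (X w) * ?\<gamma> (X w) \<le> \<bar>\<alpha>0 (X w)\<bar> * \<bar>score pdf (fst (X w))\<bar> * h (X w)"
        using h(1)[of "X w"] by (metis abs_ge_self abs_mult abs_of_nonneg mult.assoc)
      also have "\<dots> \<le> K * C * h (X w)"
        using elim score_bounded h(1) K_nonneg by (intro mult_right_mono mult_mono) auto
      finally show ?case by (simp add: mult.commute)
    qed
  qed (use riesz[OF L2] int_h in auto)
  also have "\<dots> = (C * K) * (\<integral>w. h (X w) \<partial>P)" by simp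
  also have "ennreal ((C * K) * (\<integral>w. h (X w) \<partial>P)) = ennreal (C * K) * (\<integral>\<^sup>+w. ennreal (h (X w)) \<partial>P)"
    using int_h h C_pos K_nonneg by (simp add: nn_integral_eq_integral ennreal_mult)
  finally show ?thesis using ennreal_leI by blast
qed

text \<open>Monotone convergence along the truncations \<open>min h k\<close>. Nonnegative integrals
  are used so that the inequality gives integrability together with the bound.\<close>

lemma nn_integral_score_le:
  assumes [measurable]: "h \<in> borel_measurable (borel \<Otimes>\<^sub>M MZ)" and h: "\<And>x. 0 \<le> h x"
  shows "(\<integral>\<^sup>+w. ennreal ((score pdf (U w))\<^sup>2 * h (U w, Z w)) \<partial>P)
    \<le> ennreal (C * K) * (\<integral>\<^sup>+w. ennreal (h (X w)) \<partial>P)"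
proof -
  let ?f = "\<lambda>k w. ennreal ((score pdf (U w))\<^sup>2 * min (h (U w, Z w)) (real k))"
  have sup: "ennreal ((score pdf (U w))\<^sup>2 * h (U w, Z w)) = (SUP k. ?f k w)" for w
  proof (rule antisym)
    obtain k where k: "h (U w, Z w) \<le> real k" using real_arch_simple by blast
    show "ennreal ((score pdf (U w))\<^sup>2 * h (U w, Z w)) \<le> (SUP k. ?f k w)"
      by (rule SUP_upper2[of k]) (use k in auto)
    show "(SUP k. ?f k w) \<le> ennreal ((score pdf (U w))\<^sup>2 * h (U w, Z w))"
      by (intro SUP_least ennreal_leI mult_left_mono) auto
  qed
  have "(\<integral>\<^sup>+w. ennreal ((score pdf (U w))\<^sup>2 * h (U w, Z w)) \<partial>P) = (SUP k. \<integral>\<^sup>+w. ?f k w \<partial>P)"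
    unfolding sup
  proof (rule nn_integral_monotone_convergence_SUP)
    show "incseq ?f"
      by (auto simp: incseq_def le_fun_def intro!: ennreal_leI mult_left_mono)
  qed measurable
  also have "\<dots> \<le> ennreal (C * K) * (\<integral>\<^sup>+w. ennreal (h (X w)) \<partial>P)"
  proof (rule SUP_least)
    fix k
    have "(\<integral>\<^sup>+w. ?f k w \<partial>P) \<le> ennreal (C * K) * (\<integral>\<^sup>+w. ennreal (min (h (X w)) (real k)) \<partial>P)"
      using h by (intro nn_integral_score_bounded_le[of "\<lambda>x. min (h x) (real k)" "real k"]) auto
    also have "\<dots> \<le> ennreal (C * K) * (\<integral>\<^sup>+w. ennreal (h (X w)) \<partial>P)"
      by (intro mult_left_mono nn_integral_mono ennreal_leI) auto
    finally show "(\<integral>\<^sup>+w. ?f k w \<partial>P) \<le> ennreal (C * K) * (\<integral>\<^sup>+w. ennreal (h (X w)) \<partial>P)" .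
  qed
  finally show ?thesis .
qed

lemma
  assumes "\<gamma> \<in> L2_functions P (borel \<Otimes>\<^sub>M MZ) X"
  shows integrable_wad_moment_square: "integrable P (\<lambda>w. (wad_moment pdf U Z w \<gamma>)\<^sup>2)"
    and wad_moment_square_le:
      "(\<integral>w. (wad_moment pdf U Z w \<gamma>)\<^sup>2 \<partial>P) \<le> C * K * (\<integral>w. (\<gamma> (X w))\<^sup>2 \<partial>P)"
proof -
  have [measurable]: "\<gamma> \<in> borel_measurable (borel \<Otimes>\<^sub>M MZ)" and int: "integrable P (\<lambda>w. (\<gamma> (X w))\<^sup>2)"
    using assms by (auto simp: L2_functions_def)
  note [measurable] = wad_moment_measurable
  have nn: "(\<integral>\<^sup>+w. ennreal ((wad_moment pdf U Z w \<gamma>)\<^sup>2) \<partial>P) \<le> ennreal (C * K * (\<integral>w. (\<gamma> (X w))\<^sup>2 \<partial>P))"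
  proof -
    have "(\<integral>\<^sup>+w. ennreal ((wad_moment pdf U Z w \<gamma>)\<^sup>2) \<partial>P)
        \<le> ennreal (C * K) * (\<integral>\<^sup>+w. ennreal ((\<gamma> (X w))\<^sup>2) \<partial>P)"
      using nn_integral_score_le[of "\<lambda>x. (\<gamma> x)\<^sup>2"] by (simp add: wad_moment_def power_mult_distrib)
    also have "\<dots> = ennreal (C * K * (\<integral>w. (\<gamma> (X w))\<^sup>2 \<partial>P))"
      using int C_pos K_nonneg by (simp add: nn_integral_eq_integral ennreal_mult)
    finally show ?thesis .
  qed
  show int': "integrable P (\<lambda>w. (wad_moment pdf U Z w \<gamma>)\<^sup>2)"
    using nn by (intro integrableI_bounded) (auto simp: top.not_eq_extremum intro: le_less_trans)
  have "ennreal (\<integral>w. (wad_moment pdf U Z w \<gamma>)\<^sup>2 \<partial>P) \<le> ennreal (C * K * (\<integral>w. (\<gamma> (X w))\<^sup>2 \<partial>P))"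
    using nn int' by (simp add: nn_integral_eq_integral)
  then show "(\<integral>w. (wad_moment pdf U Z w \<gamma>)\<^sup>2 \<partial>P) \<le> C * K * (\<integral>w. (\<gamma> (X w))\<^sup>2 \<partial>P)"
    using C_pos K_nonneg by (subst (asm) ennreal_le_iff) auto
qed

text \<open>A null set of the law of \<open>X\<close> need not be null for the law of
  \<open>(U, Z)\<close>. The score comparison shows that the score vanishes almost surely wherever
  \<open>(U, Z)\<close> falls into such a set, which is enough since the moment contains the score
  as a factor.\<close>

lemma AE_wad_moment_bounded:
  assumes [measurable]: "\<gamma> \<in> borel_measurable (borel \<Otimes>\<^sub>M MZ)" and bnd: "AE w in P. \<bar>\<gamma> (X w)\<bar> \<le> B" and "B \<ge> 0"
  shows "AE w in P. \<bar>wad_moment pdf U Z w \<gamma>\<bar> \<le> C * B"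
proof -
  \<comment> \<open>Indicator of the exceptional set where the bound on \<open>\<gamma>\<close>
    fails.\<close>
  let ?h = "\<lambda>x. if \<bar>\<gamma> x\<bar> \<le> B then 0 else 1 :: real"
  have "(\<integral>\<^sup>+w. ennreal (?h (X w)) \<partial>P) = (\<integral>\<^sup>+w. 0 \<partial>P)"
    using bnd by (intro nn_integral_cong_AE) (auto elim!: eventually_mono)
  then have "(\<integral>\<^sup>+w. ennreal ((score pdf (U w))\<^sup>2 * ?h (U w, Z w)) \<partial>P) = 0"
    using nn_integral_score_le[of ?h] by simp
  then have "AE w in P. ennreal ((score pdf (U w))\<^sup>2 * ?h (U w, Z w)) = 0"
    by (subst (asm) nn_integral_0_iff_AE) auto
  then show ?thesis
  proof eventually_elim
    case (elim w)
    show ?case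
    proof (cases "score pdf (U w) = 0")
      case True
      then show ?thesis using C_pos \<open>B \<ge> 0\<close> by (simp add: wad_moment_def)
    next
      case False
      then have "\<bar>\<gamma> (U w, Z w)\<bar> \<le> B" using elim by (auto split: if_splits)
      then show ?thesis using score_bounded[of "U w"] \<open>B \<ge> 0\<close> C_pos
        by (auto simp: wad_moment_def abs_mult intro!: mult_mono)
    qed
  qed
qed

end

section \<open>Convergence rates of the Lasso Riesz representer\<close>

text \<open>Describes a single fold: \<open>T n\<close> is its training set and
  \<open>\<rho>hat n\<close> the Lasso solution computed from it. The eigenvalue bound enters in the
  form \<open>gram_le\<close>, which converts a bound on coefficients into a mean-square
  bound.\<close>

locale lasso_riesz = iid_sample M P W + dict: bounded_dictionary P N X b Cb
  for M :: "'o measure" and P :: "'w measure" and W :: "nat \<Rightarrow> 'o \<Rightarrow> 'w"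
    and N :: "'x measure" and X :: "'w \<Rightarrow> 'x" and b :: "nat \<Rightarrow> 'x \<Rightarrow> real" and Cb :: real +
  fixes m :: "'w \<Rightarrow> ('x \<Rightarrow> real) \<Rightarrow> real" and \<alpha> :: "'x \<Rightarrow> real" and p :: "nat \<Rightarrow> nat"
    and r :: "nat \<Rightarrow> real" and T :: "nat \<Rightarrow> nat set" and \<rho>hat :: "nat \<Rightarrow> 'o \<Rightarrow> nat \<Rightarrow> real"
    and Cm Ca c0 B :: real
  assumes m_b_measurable [measurable]: "\<And>j. (\<lambda>w. m w (b j)) \<in> borel_measurable P"
    and m_b_bounded: "\<And>j. AE w in P. \<bar>m w (b j)\<bar> \<le> Cm" and Cm_pos: "Cm > 0"
    and m_b_riesz: "\<And>j. (\<integral>w. m w (b j) \<partial>P) = (\<integral>w. \<alpha> (X w) * b j (X w) \<partial>P)"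
    and \<alpha>_measurable [measurable]: "\<alpha> \<in> borel_measurable N"
    and \<alpha>_bounded: "AE w in P. \<bar>\<alpha> (X w)\<bar> \<le> Ca" and Ca_pos: "Ca > 0"
    and p_ge_2: "\<And>n. n \<ge> 1 \<Longrightarrow> p n \<ge> 2" and r_pos: "\<And>n. n \<ge> 1 \<Longrightarrow> r n > 0"
    and eps_small: "eps_rate p \<in> o(r)"
    and r_small: "\<And>c::real. c > 0 \<Longrightarrow> r \<in> o(\<lambda>n. real n powr c * eps_rate p n)"
    and p_poly: "\<exists>C>0. \<forall>n\<ge>1. real (p n) \<le> C * real n powr C"
    and T_finite: "\<And>n. finite (T n)" and c0_pos: "c0 > 0"
    and T_large: "eventually (\<lambda>n. real (card (T n)) \<ge> c0 * real n) sequentially"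
    and B_pos: "B > 0"
    and gram_le: "\<And>n v. n \<ge> 1 \<Longrightarrow> (\<integral>w. (lin_comb b (p n) v (X w))\<^sup>2 \<partial>P) \<le> B * (\<Sum>j<p n. (v j)\<^sup>2)"
    and lasso: "with_prob_approaching_one M
      (\<lambda>n \<omega>. is_arg_min
        (lasso_objective (p n) (r n) (M_hat m b (T n) (\<lambda>i. W i \<omega>)) (G_hat X b (T n) (\<lambda>i. W i \<omega>)))
        (\<lambda>_. True) (\<rho>hat n \<omega>))"
begin

abbreviation M_n :: "nat \<Rightarrow> 'o \<Rightarrow> nat \<Rightarrow> real" where
  "M_n n \<omega> \<equiv> M_hat m b (T n) (\<lambda>i. W i \<omega>)"

abbreviation G_n :: "nat \<Rightarrow> 'o \<Rightarrow> nat \<Rightarrow> nat \<Rightarrow> real" where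
  "G_n n \<omega> \<equiv> G_hat X b (T n) (\<lambda>i. W i \<omega>)"

abbreviation lin_sq :: "nat \<Rightarrow> (nat \<Rightarrow> real) \<Rightarrow> real" where
  "lin_sq n v \<equiv> \<integral>w. (lin_comb b (p n) v (X w))\<^sup>2 \<partial>P"

abbreviation bias :: "nat \<Rightarrow> (nat \<Rightarrow> real) \<Rightarrow> nat \<Rightarrow> real" where
  "bias n v j \<equiv> \<integral>w. (\<alpha> (X w) - lin_comb b (p n) v (X w)) * b j (X w) \<partial>P"

abbreviation \<epsilon> :: "nat \<Rightarrow> real" where "\<epsilon> \<equiv> eps_rate p"

subsection \<open>Rates\<close>

lemma ln_p: "n \<ge> 1 \<Longrightarrow> ln (real (p n)) \<ge> ln 2" "n \<ge> 1 \<Longrightarrow> ln (real (p n)) > 0"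
  using p_ge_2[of n] by auto

lemma eps_pos: "n \<ge> 1 \<Longrightarrow> \<epsilon> n > 0"
  using ln_p by (simp add: eps_rate_def)

text \<open>As \<open>p\<close> is polynomially bounded, \<open>ln p\<close> is eventually below the
  power \<open>2 * \<kappa>\<close> of \<open>n\<close>; the square root halves the
  exponent.\<close>

lemma eps_le_powr:
  assumes "\<kappa> > 0"
  shows "eventually (\<lambda>n. \<epsilon> n \<le> real n powr (\<kappa> - 1 / 2)) sequentially"
proof -
  obtain C where C: "C > 0" "\<And>n. n \<ge> 1 \<Longrightarrow> real (p n) \<le> C * real n powr C" using p_poly by auto
  have "eventually (\<lambda>n. ln C + C * ln (real n) \<le> real n powr (2 * \<kappa>)) sequentially"
    using assms by real_asymp
  then show ?thesis using eventually_ge_at_top[of 1]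
  proof eventually_elim
    case (elim n)
    have "ln (real (p n)) \<le> ln (C * real n powr C)"
      using C elim(2) p_ge_2[of n] by (subst ln_le_cancel_iff) auto
    also have "\<dots> = ln C + C * ln (real n)" using C elim by (simp add: ln_mult ln_powr)
    finally have "ln (real (p n)) \<le> real n powr (2 * \<kappa>)" using elim by simp
    then have "ln (real (p n)) / real n \<le> real n powr (2 * \<kappa>) / real n"
      using elim by (simp add: divide_right_mono)
    also have "\<dots> = real n powr (2 * \<kappa> - 1)" using elim by (simp add: powr_diff)
    also have "\<dots> = (real n powr (\<kappa> - 1 / 2))\<^sup>2"
      by (simp add: power2_eq_square powr_add[symmetric])
    finally show ?case unfolding eps_rate_def by (intro real_le_lsqrt) auto
  qed
qed

lemma eps_le_r:
  assumes "\<delta> > 0"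
  shows "eventually (\<lambda>n. \<epsilon> n \<le> \<delta> * r n) sequentially"
  using landau_o.smallD[OF eps_small assms] eventually_ge_at_top[of 1]
  by eventually_elim (use r_pos eps_pos in \<open>force simp: abs_if\<close>)

lemma r_le_eps:
  assumes "c > 0"
  shows "eventually (\<lambda>n. r n \<le> real n powr c * \<epsilon> n) sequentially"
proof -
  have "eventually (\<lambda>n. norm (r n) \<le> 1 * norm (real n powr c * \<epsilon> n)) sequentially"
    by (rule landau_o.smallD[OF r_small[OF assms]]) simp
  then show ?thesis
    using eventually_ge_at_top[of 1]
  proof eventually_elim
    case (elim n)
    have "r n \<le> norm (r n)" by simp
    also have "\<dots> \<le> real n powr c * \<epsilon> n" using elim eps_pos[of n] by (simp add: abs_mult)
    finally show ?case .
  qed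
qed

text \<open>Bookkeeping of the slack \<open>\<kappa>\<close>: one quarter absorbs the constant
  \<open>K\<close>, one half is the factor already present, which stems from comparing
  \<open>r\<close> with \<open>\<epsilon>\<close>, and the last quarter covers the logarithm in
  \<open>\<epsilon>\<close>, spent as \<open>\<kappa> / 8\<close> times
  \<open>\<beta> \<le> 2\<close>.\<close>

lemma eps_power_le:
  assumes "\<kappa> > 0" "0 < \<beta>" "\<beta> \<le> 2" "K > 0"
  shows "eventually (\<lambda>n. K * (real n powr (\<kappa> / 2) * \<epsilon> n powr \<beta>) \<le> real n powr (\<kappa> - \<beta> / 2)) sequentially"
proof -
  have "eventually (\<lambda>n. K \<le> real n powr (\<kappa> / 4)) sequentially" using assms by real_asymp
  moreover have "eventually (\<lambda>n. \<epsilon> n \<le> real n powr (\<kappa> / 8 - 1 / 2)) sequentially"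
    using assms by (intro eps_le_powr) auto
  ultimately show ?thesis using eventually_ge_at_top[of 1]
  proof eventually_elim
    case (elim n)
    have "\<epsilon> n powr \<beta> \<le> (real n powr (\<kappa> / 8 - 1 / 2)) powr \<beta>"
      using elim eps_pos[of n] assms by (intro powr_mono2) auto
    also have "\<dots> = real n powr (\<beta> * (\<kappa> / 8) - \<beta> / 2)" by (simp add: powr_powr algebra_simps)
    also have "\<dots> \<le> real n powr (\<kappa> / 4 - \<beta> / 2)"
      using elim assms mult_right_mono[of \<beta> 2 "\<kappa> / 8"] by (intro powr_mono) auto
    finally have "K * (real n powr (\<kappa> / 2) * \<epsilon> n powr \<beta>)
        \<le> real n powr (\<kappa> / 4) * (real n powr (\<kappa> / 2) * real n powr (\<kappa> / 4 - \<beta> / 2))"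
      using elim assms by (intro mult_mono mult_left_mono) auto
    also have "\<dots> = real n powr (\<kappa> - \<beta> / 2)" by (simp add: powr_add[symmetric])
    finally show ?case .
  qed
qed

lemma eps_tendsto_0: "\<epsilon> \<longlonglongrightarrow> 0"
proof (rule real_tendsto_sandwich[of "\<lambda>_. 0"])
  show "eventually (\<lambda>n. 0 \<le> \<epsilon> n) sequentially"
    using eventually_ge_at_top[of 1] by eventually_elim (use eps_pos in \<open>auto intro: less_imp_le\<close>)
  show "eventually (\<lambda>n. \<epsilon> n \<le> real n powr (1 / 4 - 1 / 2)) sequentially" by (rule eps_le_powr) simp
  show "(\<lambda>n. real n powr (1 / 4 - 1 / 2)) \<longlonglongrightarrow> 0" by real_asymp
qed simp

text \<open>For \<open>\<beta> = 1\<close> this is convergence of the penalty to 0. For a smaller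
  \<open>\<beta>\<close> it says that the penalty times the square root of the sparsity vanishes,
  which controls \<open>r\<close> times a coefficient sum.\<close>

lemma r_eps_power_tendsto_0:
  assumes "0 < \<beta>" "\<beta> \<le> 1"
  shows "(\<lambda>n. r n * \<epsilon> n powr (\<beta> - 1)) \<longlonglongrightarrow> 0"
proof (rule real_tendsto_sandwich[of "\<lambda>_. 0"])
  define \<kappa> where "\<kappa> = \<beta> / 4"
  have \<kappa>: "\<kappa> > 0" using assms by (simp add: \<kappa>_def)
  show "eventually (\<lambda>n. 0 \<le> r n * \<epsilon> n powr (\<beta> - 1)) sequentially"
    using eventually_ge_at_top[of 1]
    by eventually_elim (auto intro!: mult_nonneg_nonneg less_imp_le[OF r_pos])
  have "eventually (\<lambda>n. r n \<le> real n powr (\<kappa> / 2) * \<epsilon> n) sequentially" using \<kappa> by (intro r_le_eps) simp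
  moreover have "eventually (\<lambda>n. 1 * (real n powr (\<kappa> / 2) * \<epsilon> n powr \<beta>) \<le> real n powr (\<kappa> - \<beta> / 2)) sequentially"
    using \<kappa> assms by (intro eps_power_le) auto
  ultimately show "eventually (\<lambda>n. r n * \<epsilon> n powr (\<beta> - 1) \<le> real n powr (- \<beta> / 4)) sequentially"
    using eventually_ge_at_top[of 1]
  proof eventually_elim
    case (elim n)
    have "r n * \<epsilon> n powr (\<beta> - 1) \<le> (real n powr (\<kappa> / 2) * \<epsilon> n) * \<epsilon> n powr (\<beta> - 1)"
      using elim by (intro mult_right_mono) auto
    also have "\<dots> = real n powr (\<kappa> / 2) * \<epsilon> n powr \<beta>"
      using eps_pos[OF elim(3)] powr_add[of "\<epsilon> n" 1 "\<beta> - 1"] by simp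
    also have "\<dots> \<le> real n powr (- \<beta> / 4)" using elim by (simp add: \<kappa>_def)
    finally show ?case .
  qed
  show "(\<lambda>n. real n powr (- \<beta> / 4)) \<longlonglongrightarrow> 0" using assms by real_asymp
qed simp

lemma r_tendsto_0: "r \<longlonglongrightarrow> 0"
proof (rule Lim_transform_eventually[OF r_eps_power_tendsto_0[of 1]])
  show "eventually (\<lambda>n. r n * \<epsilon> n powr (1 - 1) = r n) sequentially"
    using eventually_ge_at_top[of 1]
    by eventually_elim (use eps_pos in \<open>auto simp: less_imp_neq[symmetric]\<close>)
qed auto

subsection \<open>Stochastic bounds\<close>

lemma integrable_\<alpha>_square: "integrable P (\<lambda>w. (\<alpha> (X w))\<^sup>2)"
  by (rule dict.integrable_square_bounded[OF _ \<alpha>_bounded]) simp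

lemma integrable_error_square: "integrable P (\<lambda>w. (\<alpha> (X w) - lin_comb b q v (X w))\<^sup>2)"
  by (rule integrable_add_square(2)) (use integrable_\<alpha>_square dict.integrable_lin_comb_square in auto)

lemma integral_\<alpha>_square_le: "(\<integral>w. (\<alpha> (X w))\<^sup>2 \<partial>P) \<le> Ca\<^sup>2"
proof -
  have "(\<integral>w. (\<alpha> (X w))\<^sup>2 \<partial>P) \<le> (\<integral>w. Ca\<^sup>2 \<partial>P)"
  proof (rule integral_mono_AE)
    show "AE w in P. (\<alpha> (X w))\<^sup>2 \<le> Ca\<^sup>2"
      using \<alpha>_bounded by eventually_elim (use Ca_pos in \<open>auto simp: abs_le_square_iff[symmetric]\<close>)
  qed (use integrable_\<alpha>_square in auto)
  then show ?thesis by (simp add: P.prob_space)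
qed

lemma integral_square_triangle:
  fixes f g :: "'w \<Rightarrow> real"
  assumes "f \<in> borel_measurable P" "g \<in> borel_measurable P"
    and "integrable P (\<lambda>x. (f x)\<^sup>2)" "integrable P (\<lambda>x. (g x)\<^sup>2)"
  shows "(\<integral>w. (f w - g w)\<^sup>2 \<partial>P) \<le> 2 * (\<integral>w. (f w)\<^sup>2 \<partial>P) + 2 * (\<integral>w. (g w)\<^sup>2 \<partial>P)"
proof -
  have "(u - v)\<^sup>2 \<le> 2 * u\<^sup>2 + 2 * v\<^sup>2" for u v :: real
    using sum_squares_bound[of "-u" v] by (simp add: power2_diff)
  then have "(\<integral>w. (f w - g w)\<^sup>2 \<partial>P) \<le> (\<integral>w. 2 * (f w)\<^sup>2 + 2 * (g w)\<^sup>2 \<partial>P)"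
    using assms integrable_add_square(2)[OF assms] by (intro integral_mono) auto
  then show ?thesis using assms by simp
qed

text \<open>For a deterministic center the score is an average of i.i.d. terms \<open>\<xi>\<close>
  whose mean is the bias, so half of the allowance \<open>r / 2\<close> goes to the bias and half to
  the noise. The second moments of \<open>\<xi>\<close> are bounded through \<open>lin_sq\<close>,
  whereas the range \<open>Bn\<close> may grow; only \<open>r n * Bn n\<close> is bounded, as
  Bernstein's inequality asks.\<close>

lemma score_bound:
  fixes u :: "nat \<Rightarrow> nat \<Rightarrow> real"
  assumes l1: "eventually (\<lambda>n. r n * (\<Sum>j<p n. \<bar>u n j\<bar>) \<le> K) sequentially"
    and sq: "eventually (\<lambda>n. (lin_sq n (u n)) \<le> K) sequentially"
    and bias: "eventually (\<lambda>n. \<forall>j<p n.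
      \<bar>bias n (u n) j\<bar> \<le> r n / 4) sequentially"
  shows "whp (\<lambda>n \<omega>. \<forall>j<p n.
    \<bar>M_n n \<omega> j - (\<Sum>k<p n. G_n n \<omega> j k * u n k)\<bar> \<le> r n / 2)"
proof -
  define \<xi> where "\<xi> = (\<lambda>n j w. m w (b j) - b j (X w) * lin_comb b (p n) (u n) (X w))"
  define Bn where "Bn = (\<lambda>n. Cm + Cb * (Cb * (\<Sum>j<p n. \<bar>u n j\<bar>)))"
  \<comment> \<open>The first entry bounds the second moments of the score terms, the second bounds
    \<open>r n * Bn n\<close> as soon as \<open>r n \<le> 1\<close>.\<close>
  define s where "s = max (2 * Cm\<^sup>2 + 2 * (Cb\<^sup>2 * \<bar>K\<bar>)) (Cm + Cb\<^sup>2 * \<bar>K\<bar>)"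
  have Cb: "Cb > 0" by (rule dict.Cb_pos)
  have s: "s > 0" using Cm_pos Cb by (auto simp: s_def less_max_iff_disj add_pos_nonneg)
  have [measurable]: "\<xi> n j \<in> borel_measurable P" for n j by (simp add: \<xi>_def)
  have b_sq: "integrable P (\<lambda>w. (b j (X w) * lin_comb b (p n) (u n) (X w))\<^sup>2)"
    "AE w in P. (b j (X w) * lin_comb b (p n) (u n) (X w))\<^sup>2 \<le> Cb\<^sup>2 * (lin_comb b (p n) (u n) (X w))\<^sup>2" for n j
  proof -
    show *: "AE w in P. (b j (X w) * lin_comb b (p n) (u n) (X w))\<^sup>2 \<le> Cb\<^sup>2 * (lin_comb b (p n) (u n) (X w))\<^sup>2"
      using dict.b_bounded
    proof eventually_elim
      case (elim w)
      have "(b j (X w))\<^sup>2 \<le> Cb\<^sup>2" using elim Cb by (simp add: abs_le_square_iff[symmetric])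
      then show ?case by (simp add: power_mult_distrib mult_right_mono)
    qed
    show "integrable P (\<lambda>w. (b j (X w) * lin_comb b (p n) (u n) (X w))\<^sup>2)"
      by (rule Bochner_Integration.integrable_bound[of P "\<lambda>w. Cb\<^sup>2 * (lin_comb b (p n) (u n) (X w))\<^sup>2"])
        (use * dict.integrable_lin_comb_square in \<open>auto elim: eventually_mono\<close>)
  qed
  have m_sq: "integrable P (\<lambda>w. (m w (b j))\<^sup>2)" "(\<integral>w. (m w (b j))\<^sup>2 \<partial>P) \<le> Cm\<^sup>2" for j
  proof -
    show *: "integrable P (\<lambda>w. (m w (b j))\<^sup>2)"
      by (rule dict.integrable_square_bounded[OF _ m_b_bounded]) simp
    have "(\<integral>w. (m w (b j))\<^sup>2 \<partial>P) \<le> (\<integral>w. Cm\<^sup>2 \<partial>P)"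
    proof (rule integral_mono_AE)
      show "AE w in P. (m w (b j))\<^sup>2 \<le> Cm\<^sup>2"
        using m_b_bounded[of j] by eventually_elim (use Cm_pos in \<open>auto simp: abs_le_square_iff[symmetric]\<close>)
    qed (use * in auto)
    then show "(\<integral>w. (m w (b j))\<^sup>2 \<partial>P) \<le> Cm\<^sup>2" by (simp add: P.prob_space)
  qed
  have mean: "(\<integral>w. \<xi> n j w \<partial>P) = (bias n (u n) j)" for n j
  proof -
    have int: "integrable P (\<lambda>w. m w (b j))" "integrable P (\<lambda>w. b j (X w) * lin_comb b (p n) (u n) (X w))"
      "integrable P (\<lambda>w. \<alpha> (X w) * b j (X w))"
      using m_sq(1)[of j] dict.integrable_b_square dict.integrable_lin_comb_square integrable_\<alpha>_square
      by (auto intro: P.square_integrable_imp_integrable integrable_mult_L2)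
    have "(\<alpha> (X w) - lin_comb b (p n) (u n) (X w)) * b j (X w)
        = \<alpha> (X w) * b j (X w) - b j (X w) * lin_comb b (p n) (u n) (X w)" for w
      by (simp add: algebra_simps)
    then show ?thesis using int by (simp add: \<xi>_def m_b_riesz)
  qed
  have noise: "whp (\<lambda>n \<omega>. \<forall>j\<in>{..<p n}.
    \<bar>(\<Sum>i\<in>T n. \<xi> n j (W i \<omega>)) / real (card (T n)) - (\<integral>w. \<xi> n j w \<partial>P)\<bar> \<le> 1 / 4 * r n)"
  proof (rule bernstein_union[of "\<lambda>n. {..<p n}" \<xi> Bn s r p T c0 "1 / 4"])
    show "AE w in P. \<bar>\<xi> n j w\<bar> \<le> Bn n" if "j \<in> {..<p n}" for n j
      using m_b_bounded[of j] dict.b_bounded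
    proof eventually_elim
      case (elim w)
      have "\<bar>b j (X w) * lin_comb b (p n) (u n) (X w)\<bar> \<le> Cb * (Cb * (\<Sum>j<p n. \<bar>u n j\<bar>))"
        unfolding abs_mult using elim(2) dict.abs_lin_comb_le[OF elim(2)] Cb by (intro mult_mono) auto
      then show ?case using elim(1) unfolding \<xi>_def Bn_def by linarith
    qed
    show "eventually (\<lambda>n. \<forall>j\<in>{..<p n}. (\<integral>w. (\<xi> n j w)\<^sup>2 \<partial>P) \<le> s) sequentially"
      using sq
    proof eventually_elim
      case (elim n)
      show ?case
      proof
        fix j assume "j \<in> {..<p n}"
        have "(\<integral>w. (\<xi> n j w)\<^sup>2 \<partial>P)
            \<le> 2 * (\<integral>w. (m w (b j))\<^sup>2 \<partial>P) + 2 * (\<integral>w. (b j (X w) * lin_comb b (p n) (u n) (X w))\<^sup>2 \<partial>P)"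
          unfolding \<xi>_def by (rule integral_square_triangle) (use m_sq b_sq in auto)
        also have "(\<integral>w. (b j (X w) * lin_comb b (p n) (u n) (X w))\<^sup>2 \<partial>P)
            \<le> (\<integral>w. Cb\<^sup>2 * (lin_comb b (p n) (u n) (X w))\<^sup>2 \<partial>P)"
          using b_sq dict.integrable_lin_comb_square by (intro integral_mono_AE) auto
        also have "\<dots> \<le> Cb\<^sup>2 * \<bar>K\<bar>" using elim by (auto intro!: mult_left_mono)
        finally show "(\<integral>w. (\<xi> n j w)\<^sup>2 \<partial>P) \<le> s" using m_sq(2)[of j] by (simp add: s_def le_max_iff_disj)
      qed
    qed
    have "eventually (\<lambda>n. r n \<le> 1) sequentially"
      using order_tendstoD(2)[OF r_tendsto_0, of 1] by (auto elim: eventually_mono)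
    then show "eventually (\<lambda>n. r n * Bn n \<le> s) sequentially"
      using l1
    proof eventually_elim
      case (elim n)
      have "r n * Bn n = r n * Cm + Cb\<^sup>2 * (r n * (\<Sum>j<p n. \<bar>u n j\<bar>))"
        by (simp add: Bn_def algebra_simps power2_eq_square)
      also have "\<dots> \<le> 1 * Cm + Cb\<^sup>2 * \<bar>K\<bar>"
        using elim Cm_pos by (intro add_mono mult_right_mono mult_left_mono) auto
      finally show ?case by (simp add: s_def le_max_iff_disj)
    qed
    show "card {..<p n} \<le> (p n)\<^sup>2" for n by (simp add: power2_eq_square)
  qed (use s r_pos p_ge_2 eps_small T_finite c0_pos T_large in auto)
  then show ?thesis
  proof (rule with_prob_approaching_one_mono)
    show "eventually (\<lambda>n. \<forall>\<omega>\<in>space M. (\<forall>j\<in>{..<p n}.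
        \<bar>(\<Sum>i\<in>T n. \<xi> n j (W i \<omega>)) / real (card (T n)) - (\<integral>w. \<xi> n j w \<partial>P)\<bar> \<le> 1 / 4 * r n) \<longrightarrow>
      (\<forall>j<p n. \<bar>M_n n \<omega> j - (\<Sum>k<p n. G_n n \<omega> j k * u n k)\<bar>
        \<le> r n / 2)) sequentially"
      using bias
    proof eventually_elim
      case (elim n)
      have eq: "M_n n \<omega> j - (\<Sum>k<p n. G_n n \<omega> j k * u n k)
          = (\<Sum>i\<in>T n. \<xi> n j (W i \<omega>)) / real (card (T n))" for j \<omega>
        by (simp add: M_hat_def dict.G_hat_mult \<xi>_def sum_subtractf diff_divide_distrib)
      show ?case
      proof (intro ballI impI allI)
        fix \<omega> j assume "\<forall>j\<in>{..<p n}.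
            \<bar>(\<Sum>i\<in>T n. \<xi> n j (W i \<omega>)) / real (card (T n)) - (\<integral>w. \<xi> n j w \<partial>P)\<bar> \<le> 1 / 4 * r n"
          and j: "j < p n"
        then have "\<bar>(\<Sum>i\<in>T n. \<xi> n j (W i \<omega>)) / real (card (T n)) - (\<integral>w. \<xi> n j w \<partial>P)\<bar> \<le> 1 / 4 * r n"
          by blast
        moreover have "\<bar>\<integral>w. \<xi> n j w \<partial>P\<bar> \<le> r n / 4" unfolding mean using elim j by blast
        ultimately show "\<bar>M_n n \<omega> j
            - (\<Sum>k<p n. G_n n \<omega> j k * u n k)\<bar> \<le> r n / 2"
          unfolding eq by linarith
      qed
    qed
  qed
qed

text \<open>A deviation of at most \<open>r\<close> in every Gram entry changes the form at
  \<open>v\<close> by at most \<open>r\<close> times the squared coefficient sum. The event is the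
  same for all \<open>v\<close>, so the bound may be used at the random Lasso error; it takes the
  place of the restricted eigenvalue in the summable case.\<close>

lemma gram_bound:
  "whp (\<lambda>n \<omega>. \<forall>v. (lin_sq n v)
    \<le> quad_form (p n) (G_n n \<omega>) v + r n * (\<Sum>j<p n. \<bar>v j\<bar>)\<^sup>2)"
proof -
  let ?f = "\<lambda>n (jk :: nat \<times> nat) w. b (fst jk) (X w) * b (snd jk) (X w)"
  define s where "s = max (Cb\<^sup>2) ((Cb\<^sup>2)\<^sup>2)"
  have Cb: "Cb > 0" by (rule dict.Cb_pos)
  have bnd: "AE w in P. \<bar>?f n jk w\<bar> \<le> Cb\<^sup>2" for n :: nat and jk
    using dict.b_bounded by eventually_elim
      (use Cb in \<open>auto simp: abs_mult power2_eq_square intro!: mult_mono\<close>)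
  have "whp (\<lambda>n \<omega>. \<forall>jk\<in>{..<p n} \<times> {..<p n}.
    \<bar>(\<Sum>i\<in>T n. ?f n jk (W i \<omega>)) / real (card (T n)) - (\<integral>w. ?f n jk w \<partial>P)\<bar> \<le> 1 * r n)"
  proof (rule bernstein_union[of "\<lambda>n. {..<p n} \<times> {..<p n}" ?f "\<lambda>_. Cb\<^sup>2" s r p T c0 1])
    show "AE w in P. \<bar>?f n jk w\<bar> \<le> Cb\<^sup>2" for n jk by (rule bnd)
    have "(\<integral>w. (?f n jk w)\<^sup>2 \<partial>P) \<le> s" for n jk
    proof -
      have *: "AE w in P. (?f n jk w)\<^sup>2 \<le> (Cb\<^sup>2)\<^sup>2"
        using bnd[of jk]
      proof eventually_elim
        case (elim w)
        then have "\<bar>?f n jk w\<bar>\<^sup>2 \<le> (Cb\<^sup>2)\<^sup>2" by (rule power_mono) simp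
        then show ?case by (simp only: power2_abs)
      qed
      have "(\<integral>w. (?f n jk w)\<^sup>2 \<partial>P) \<le> (\<integral>w. (Cb\<^sup>2)\<^sup>2 \<partial>P)"
        using * dict.integrable_square_bounded[OF _ bnd[of jk]] by (intro integral_mono_AE) auto
      then show ?thesis by (simp add: P.prob_space s_def le_max_iff_disj)
    qed
    then show "eventually (\<lambda>n. \<forall>jk\<in>{..<p n} \<times> {..<p n}. (\<integral>w. (?f n jk w)\<^sup>2 \<partial>P) \<le> s) sequentially" by simp
    have "eventually (\<lambda>n. r n \<le> 1) sequentially"
      using order_tendstoD(2)[OF r_tendsto_0, of 1] by (auto elim: eventually_mono)
    then show "eventually (\<lambda>n. r n * Cb\<^sup>2 \<le> s) sequentially"
    proof eventually_elim
      case (elim n)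
      then have "r n * Cb\<^sup>2 \<le> 1 * Cb\<^sup>2" by (intro mult_right_mono) auto
      then show ?case by (simp add: s_def le_max_iff_disj)
    qed
    show "card ({..<p n} \<times> {..<p n}) \<le> (p n)\<^sup>2" for n by (simp add: power2_eq_square)
  qed (use Cb r_pos p_ge_2 eps_small T_finite c0_pos T_large in \<open>auto simp: s_def less_max_iff_disj\<close>)
  then show ?thesis
  proof (rule with_prob_approaching_one_mono)
    show "eventually (\<lambda>n. \<forall>\<omega>\<in>space M. (\<forall>jk\<in>{..<p n} \<times> {..<p n}.
        \<bar>(\<Sum>i\<in>T n. ?f n jk (W i \<omega>)) / real (card (T n)) - (\<integral>w. ?f n jk w \<partial>P)\<bar> \<le> 1 * r n) \<longrightarrow>
      (\<forall>v. (lin_sq n v)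
        \<le> quad_form (p n) (G_n n \<omega>) v + r n * (\<Sum>j<p n. \<bar>v j\<bar>)\<^sup>2)) sequentially"
    proof (intro always_eventually allI ballI impI)
      fix n \<omega> v
      assume *: "\<forall>jk\<in>{..<p n} \<times> {..<p n}.
        \<bar>(\<Sum>i\<in>T n. ?f n jk (W i \<omega>)) / real (card (T n)) - (\<integral>w. ?f n jk w \<partial>P)\<bar> \<le> 1 * r n"
      let ?Gh = "G_n n \<omega>" and ?G = "\<lambda>j k. \<integral>w. b j (X w) * b k (X w) \<partial>P"
      have entry: "?G j k * (v j * v k) - ?Gh j k * (v j * v k) \<le> r n * (\<bar>v j\<bar> * \<bar>v k\<bar>)" if "j < p n" "k < p n" for j k
      proof -
        have "\<bar>?G j k - ?Gh j k\<bar> \<le> r n" using *[rule_format, of "(j, k)"] that by (simp add: G_hat_def)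
        then have "\<bar>?G j k - ?Gh j k\<bar> * \<bar>v j * v k\<bar> \<le> r n * \<bar>v j * v k\<bar>" by (rule mult_right_mono) simp
        moreover have "(?G j k - ?Gh j k) * (v j * v k) \<le> \<bar>?G j k - ?Gh j k\<bar> * \<bar>v j * v k\<bar>"
          by (simp only: abs_mult[symmetric] abs_ge_self)
        ultimately have "(?G j k - ?Gh j k) * (v j * v k) \<le> r n * (\<bar>v j\<bar> * \<bar>v k\<bar>)"
          unfolding abs_mult[of "v j"] by linarith
        then show ?thesis unfolding left_diff_distrib .
      qed
      have "(\<Sum>j<p n. \<Sum>k<p n. ?G j k * (v j * v k) - ?Gh j k * (v j * v k))
          \<le> (\<Sum>j<p n. \<Sum>k<p n. r n * (\<bar>v j\<bar> * \<bar>v k\<bar>))"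
        by (intro sum_mono) (simp only: lessThan_iff entry)
      moreover have "(\<Sum>j<p n. \<Sum>k<p n. ?G j k * (v j * v k) - ?Gh j k * (v j * v k))
          = quad_form (p n) ?G v - quad_form (p n) ?Gh v"
        unfolding quad_form_def sum_subtractf by (simp only: mult_ac)
      moreover have "(\<Sum>j<p n. \<Sum>k<p n. r n * (\<bar>v j\<bar> * \<bar>v k\<bar>)) = r n * (\<Sum>j<p n. \<bar>v j\<bar>)\<^sup>2"
        unfolding power2_eq_square sum_product by (simp only: sum_distrib_left)
      ultimately show "(lin_sq n v) \<le> quad_form (p n) ?Gh v + r n * (\<Sum>j<p n. \<bar>v j\<bar>)\<^sup>2"
        unfolding dict.quad_form_gram[symmetric] by simp
    qed
  qed
qed

text \<open>The sample restricted eigenvalue passes to the population because the sample Gram form of a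
  fixed vector is unbiased.\<close>

lemma population_restricted_eigenvalue:
  assumes "c > 0"
    and re: "whp
      (\<lambda>n \<omega>. restricted_eigenvalue_ge (p n) (G_n n \<omega>) (S n) c)"
  shows "eventually (\<lambda>n. \<forall>v. card {j \<in> {..<p n}. v j \<noteq> 0} \<le> S n \<longrightarrow>
    c / 2 * (\<Sum>j<p n. (v j)\<^sup>2) \<le> (lin_sq n v)) sequentially"
proof -
  obtain A where A: "\<And>n. A n \<in> M.events"
    "\<And>n \<omega>. \<omega> \<in> A n \<Longrightarrow> restricted_eigenvalue_ge (p n) (G_n n \<omega>) (S n) c"
    "(\<lambda>n. M.prob (A n)) \<longlonglongrightarrow> 1"
    using re unfolding with_prob_approaching_one_def by blast
  \<comment> \<open>Probability one half suffices because the sample form is nonnegative off the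
    event; it is the source of \<open>c / 2\<close>.\<close>
  have "eventually (\<lambda>n. M.prob (A n) > 1 / 2) sequentially" using A(3) by (rule order_tendstoD) simp
  then show ?thesis using T_large eventually_ge_at_top[of 1]
  proof eventually_elim
    case (elim n)
    have "0 < c0 * real n" using elim(3) c0_pos by simp
    then have T0: "card (T n) > 0" using elim(2) by (auto intro: gr0I)
    show ?case
    proof (intro allI impI)
      fix v :: "nat \<Rightarrow> real" assume supp: "card {j \<in> {..<p n}. v j \<noteq> 0} \<le> S n"
      let ?f = "\<lambda>w. (lin_comb b (p n) v (X w))\<^sup>2"
      let ?q = "\<lambda>\<omega>. quad_form (p n) (G_n n \<omega>) v"
      let ?s = "\<Sum>j<p n. (v j)\<^sup>2"
      have f: "?f \<in> borel_measurable P" "integrable P ?f" using dict.integrable_lin_comb_square by auto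
      have q: "?q \<omega> = (\<Sum>i\<in>T n. ?f (W i \<omega>)) / real (card (T n))" for \<omega> by (rule dict.G_hat_quad_form)
      have int_q: "integrable M ?q" unfolding q using integrable_W[OF f(2)] by auto
      have "(\<integral>\<omega>. ?q \<omega> \<partial>M) = (\<integral>w. ?f w \<partial>P)"
        unfolding q using integrable_W[OF f(2)] T0
        by (simp add: Bochner_Integration.integral_sum integral_W[OF f(1)])
      \<comment> \<open>With \<open>J\<close> the support of \<open>v\<close>, nothing is left
        outside \<open>J\<close> and the cone condition holds trivially.\<close>
      have ind: "c * ?s * indicator (A n) \<omega> \<le> ?q \<omega>" for \<omega>
      proof (cases "\<omega> \<in> A n \<and> (\<exists>j\<in>{..<p n}. v j \<noteq> 0)")
        case True
        let ?J = "{j \<in> {..<p n}. v j \<noteq> 0}"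
        have sJ: "(\<Sum>j\<in>?J. (v j)\<^sup>2) = ?s" by (rule sum.mono_neutral_left) auto
        have pos: "?s > 0" using True by (meson finite_lessThan sum_pos2 zero_le_power2 zero_less_power2)
        have "(\<Sum>j\<in>{..<p n} - ?J. \<bar>v j\<bar>) = 0" by (rule sum.neutral) auto
        moreover have "0 \<le> 3 * (\<Sum>j\<in>?J. \<bar>v j\<bar>)" by (simp add: sum_nonneg)
        ultimately have "?q \<omega> / (\<Sum>j\<in>?J. (v j)\<^sup>2) \<ge> c"
          using A(2)[of \<omega> n, unfolded restricted_eigenvalue_ge_def, rule_format, of ?J v] True supp by auto
        then show ?thesis using pos True unfolding sJ by (simp add: field_simps)
      next
        case False
        then have z: "c * ?s * indicator (A n) \<omega> = 0" by (auto simp: indicator_def)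
        show ?thesis unfolding z by (rule dict.G_hat_psd)
      qed
      have "c / 2 * ?s = c * ?s * (1 / 2)" by simp
      also have "\<dots> \<le> c * ?s * M.prob (A n)"
        using elim \<open>c > 0\<close> by (intro mult_left_mono) (auto intro!: mult_nonneg_nonneg sum_nonneg)
      also have "\<dots> = (\<integral>\<omega>. c * ?s * indicator (A n) \<omega> \<partial>M)" using A(1) by simp
      also have "\<dots> \<le> (\<integral>\<omega>. ?q \<omega> \<partial>M)"
        using ind int_q A(1) by (intro integral_mono) (auto simp: M.emeasure_eq_measure)
      finally show "c / 2 * ?s \<le> (\<integral>w. ?f w \<partial>P)"
        using \<open>(\<integral>\<omega>. ?q \<omega> \<partial>M) = (\<integral>w. ?f w \<partial>P)\<close> by simp
    qed
  qed
qed

end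

lemma eventually_choice:
  assumes "eventually (\<lambda>n. \<exists>u. Q n u) F"
  shows "\<exists>u. eventually (\<lambda>n. Q n (u n)) F"
  using assms by (intro exI[of _ "\<lambda>n. SOME u. Q n u"]) (auto elim!: eventually_mono intro: someI)

section \<open>Rate of the Lasso under sparse approximation\<close>

context lasso_riesz
begin

abbreviation error_sq :: "nat \<Rightarrow> (nat \<Rightarrow> real) \<Rightarrow> real" where
  "error_sq n v \<equiv> \<integral>w. (\<alpha> (X w) - lin_comb b (p n) v (X w))\<^sup>2 \<partial>P"

lemma lin_comb_square_le: "(lin_sq n v) \<le> 2 * Ca\<^sup>2 + 2 * error_sq n v"
proof -
  have "(\<integral>w. (\<alpha> (X w) - (\<alpha> (X w) - lin_comb b (p n) v (X w)))\<^sup>2 \<partial>P)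
      \<le> 2 * (\<integral>w. (\<alpha> (X w))\<^sup>2 \<partial>P) + 2 * error_sq n v"
    using integrable_\<alpha>_square integrable_error_square by (intro integral_square_triangle) auto
  then show ?thesis using integral_\<alpha>_square_le by simp
qed

lemma error_sq_triangle:
  "error_sq n v \<le> 2 * error_sq n u + 2 * (lin_sq n (\<lambda>j. v j - u j))"
proof -
  have "error_sq n v
      = (\<integral>w. ((\<alpha> (X w) - lin_comb b (p n) u (X w)) - lin_comb b (p n) (\<lambda>j. v j - u j) (X w))\<^sup>2 \<partial>P)"
    by (simp add: lin_comb_diff)
  also have "\<dots> \<le> 2 * error_sq n u + 2 * (lin_sq n (\<lambda>j. v j - u j))"
    using integrable_error_square dict.integrable_lin_comb_square by (intro integral_square_triangle) auto
  finally show ?thesis .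
qed

text \<open>Coordinate descent at threshold \<open>r / 4\<close>, the bias allowance of
  \<open>score_bound\<close>. The number of moves is the error measured in units of
  \<open>t\<^sup>2 / Cb\<^sup>2\<close>: the factor 16 is the square of the 4 in the threshold, and
  the 1 comes from rounding up.\<close>

lemma greedy_center:
  assumes "n \<ge> 1"
  obtains u where "\<forall>j<p n. \<bar>bias n u j\<bar> \<le> r n / 4"
    and "real (card {j \<in> {..<p n}. u j \<noteq> 0})
      \<le> real (card {j \<in> {..<p n}. \<rho> j \<noteq> 0}) + 16 * Cb\<^sup>2 * error_sq n \<rho> / (r n)\<^sup>2 + 1"
    and "r n * (\<Sum>j<p n. \<bar>u j\<bar>) \<le> r n * (\<Sum>j<p n. \<bar>\<rho> j\<bar>) + 4 * error_sq n \<rho>"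
    and "error_sq n u \<le> error_sq n \<rho>"
proof -
  define t where "t = r n / 4"
  have t: "t > 0" using r_pos[OF assms] by (simp add: t_def)
  have e: "error_sq n \<rho> \<ge> 0" by simp
  define k where "k = nat \<lceil>error_sq n \<rho> / (t\<^sup>2 / Cb\<^sup>2)\<rceil>"
  have q: "t\<^sup>2 / Cb\<^sup>2 > 0" using t dict.Cb_pos by simp
  have nn: "error_sq n \<rho> / (t\<^sup>2 / Cb\<^sup>2) \<ge> 0" using e q by (simp del: divide_divide_eq_right)
  have "error_sq n \<rho> / (t\<^sup>2 / Cb\<^sup>2) \<le> real k" unfolding k_def by (rule real_nat_ceiling_ge)
  then have "error_sq n \<rho> \<le> real k * (t\<^sup>2 / Cb\<^sup>2)" using q by (simp only: pos_divide_le_eq)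
  from dict.greedy_approximation[OF \<alpha>_measurable integrable_\<alpha>_square t this] obtain u where u:
    "\<forall>j<p n. \<bar>bias n u j\<bar> \<le> t"
    "card {j \<in> {..<p n}. u j \<noteq> 0} \<le> card {j \<in> {..<p n}. \<rho> j \<noteq> 0} + k"
    "t * (\<Sum>j<p n. \<bar>u j\<bar>) + error_sq n u \<le> t * (\<Sum>j<p n. \<bar>\<rho> j\<bar>) + error_sq n \<rho>"
    "error_sq n u \<le> error_sq n \<rho>" by blast
  have "real k \<le> error_sq n \<rho> / (t\<^sup>2 / Cb\<^sup>2) + 1"
    using of_int_ceiling_le_add_one[of "error_sq n \<rho> / (t\<^sup>2 / Cb\<^sup>2)"] nn unfolding k_def by simp
  also have "error_sq n \<rho> / (t\<^sup>2 / Cb\<^sup>2) = 16 * Cb\<^sup>2 * error_sq n \<rho> / (r n)\<^sup>2"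
    by (simp add: t_def power_divide mult.commute)
  finally have k: "real k \<le> 16 * Cb\<^sup>2 * error_sq n \<rho> / (r n)\<^sup>2 + 1" .
  have "error_sq n u \<ge> 0" by simp
  then have "t * (\<Sum>j<p n. \<bar>u j\<bar>) \<le> t * (\<Sum>j<p n. \<bar>\<rho> j\<bar>) + error_sq n \<rho>" using u(3) by linarith
  then have "4 * (t * (\<Sum>j<p n. \<bar>u j\<bar>)) \<le> 4 * (t * (\<Sum>j<p n. \<bar>\<rho> j\<bar>)) + 4 * error_sq n \<rho>" by linarith
  then have "r n * (\<Sum>j<p n. \<bar>u j\<bar>) \<le> r n * (\<Sum>j<p n. \<bar>\<rho> j\<bar>) + 4 * error_sq n \<rho>"
    by (simp add: t_def)
  moreover have "real (card {j \<in> {..<p n}. u j \<noteq> 0}) \<le> real (card {j \<in> {..<p n}. \<rho> j \<noteq> 0}) + real k"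
    using u(2) by (simp flip: of_nat_add)
  ultimately show thesis using that[of u] u(1,4) k by (simp add: t_def)
qed

lemma l1_le_support:
  fixes v :: "nat \<Rightarrow> real"
  shows "(\<Sum>j<q. \<bar>v j\<bar>) \<le> sqrt (real (card {j \<in> {..<q}. v j \<noteq> 0})) * sqrt (\<Sum>j<q. (v j)\<^sup>2)"
proof -
  let ?J = "{j \<in> {..<q}. v j \<noteq> 0}"
  have "(\<Sum>j<q. \<bar>v j\<bar>) = (\<Sum>j\<in>?J. \<bar>v j\<bar>)" by (rule sum.mono_neutral_right) auto
  also have "\<dots> \<le> sqrt (real (card ?J)) * sqrt (\<Sum>j\<in>?J. (v j)\<^sup>2)" by (rule sum_abs_le_sqrt_card)
  also have "(\<Sum>j\<in>?J. (v j)\<^sup>2) = (\<Sum>j<q. (v j)\<^sup>2)" by (rule sum.mono_neutral_left) auto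
  finally show ?thesis .
qed

lemma L2_norm_le_powr:
  assumes "error_sq n v \<le> real n powr (2 * \<kappa> - \<beta> / 2)"
  shows "L2_norm P (\<lambda>w. \<alpha> (X w) - lin_comb b (p n) v (X w)) \<le> real n powr (\<kappa> - \<beta> / 4)"
proof -
  have "(real n powr (\<kappa> - \<beta> / 4))\<^sup>2 = real n powr (2 * \<kappa> - \<beta> / 2)"
    by (simp add: power2_eq_square powr_add[symmetric])
  then show ?thesis unfolding L2_norm_def using assms by (intro real_le_lsqrt) auto
qed

text \<open>Because \<open>\<epsilon> \<le> r\<close> eventually, the number of moves stays of the
  order of the initial sparsity. A good approximation alone says nothing about the size of its
  coefficients; the population eigenvalue bound supplies that, and Cauchy-Schwarz on the support
  then bounds \<open>r\<close> times the coefficient sum.\<close>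

lemma sparse_center:
  assumes sparse: "sparse_approx P X b p \<alpha> C \<xi>" and "C > 1" "\<xi> > 0" and "c > 0"
    and re: "eventually (\<lambda>n. \<forall>v. card {j \<in> {..<p n}. v j \<noteq> 0} \<le> S n \<longrightarrow>
      c / 2 * (\<Sum>j<p n. (v j)\<^sup>2) \<le> (lin_sq n v)) sequentially"
    and S: "eventually (\<lambda>n. \<epsilon> n powr (- (2 / (2 * \<xi> + 1))) \<le> real (S n)) sequentially"
  shows "\<exists>K>0. eventually (\<lambda>n. \<exists>u.
    (\<forall>j<p n. \<bar>bias n u j\<bar> \<le> r n / 4) \<and>
    real (card {j \<in> {..<p n}. u j \<noteq> 0}) \<le> K * \<epsilon> n powr (- (2 / (2 * \<xi> + 1))) \<and>
    r n * (\<Sum>j<p n. \<bar>u j\<bar>) \<le> K \<and> (lin_sq n u) \<le> K \<and>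
    error_sq n u \<le> K * \<epsilon> n powr (2 - 2 / (2 * \<xi> + 1))) sequentially"
proof -
  \<comment> \<open>At sparsity \<open>\<epsilon>\<close> to the power \<open>- a\<close>, the
    squared approximation error and the estimation error \<open>\<epsilon>\<^sup>2\<close> times the
    sparsity are both of order \<open>\<epsilon>\<close> to the power \<open>2 - a\<close>.\<close>
  define a where "a = 2 / (2 * \<xi> + 1)"
  have a: "0 < a" "a < 2" "2 * \<xi> * a = 2 - a" using \<open>\<xi> > 0\<close> by (auto simp: a_def field_simps)
  define K0 where "K0 = C\<^sup>2 * 2 powr (2 * \<xi>)"
  define K2 where "K2 = 2 / c * (2 * Ca\<^sup>2 + 2 * K0)"
  define K where "K = 16 * Cb\<^sup>2 * K0 + 2 + (sqrt K2 + 4 * K0) + (2 * Ca\<^sup>2 + 2 * K0) + K0"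
  have K0: "K0 > 0" using \<open>C > 1\<close> by (simp add: K0_def)
  have K2: "K2 > 0" using K0 \<open>c > 0\<close> by (simp add: K2_def add_nonneg_pos)
  have K_parts: "K > 0" "16 * Cb\<^sup>2 * K0 + 2 \<le> K" "sqrt K2 + 4 * K0 \<le> K" "2 * Ca\<^sup>2 + 2 * K0 \<le> K" "K0 \<le> K"
  proof -
    have "16 * Cb\<^sup>2 * K0 \<ge> 0" "sqrt K2 \<ge> 0" "Ca\<^sup>2 \<ge> 0" using K0 K2 by auto
    then show "K > 0" "16 * Cb\<^sup>2 * K0 + 2 \<le> K" "sqrt K2 + 4 * K0 \<le> K" "2 * Ca\<^sup>2 + 2 * K0 \<le> K" "K0 \<le> K"
      using K0 unfolding K_def by linarith+
  qed
  have ev1: "eventually (\<lambda>n. \<epsilon> n \<le> 1) sequentially"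
    using order_tendstoD(2)[OF eps_tendsto_0, of 1] by (auto elim: eventually_mono)
  have ev2: "eventually (\<lambda>n. r n * \<epsilon> n powr ((1 - a / 2) - 1) \<le> 1) sequentially"
    using order_tendstoD(2)[OF r_eps_power_tendsto_0[of "1 - a / 2"], of 1] a by (auto elim: eventually_mono)
  have ev3: "eventually (\<lambda>n. \<epsilon> n \<le> 1 * r n) sequentially" by (rule eps_le_r) simp
  have "eventually (\<lambda>n. \<exists>u.
    (\<forall>j<p n. \<bar>bias n u j\<bar> \<le> r n / 4) \<and>
    real (card {j \<in> {..<p n}. u j \<noteq> 0}) \<le> K * \<epsilon> n powr (- a) \<and>
    r n * (\<Sum>j<p n. \<bar>u j\<bar>) \<le> K \<and> (lin_sq n u) \<le> K \<and>
    error_sq n u \<le> K * \<epsilon> n powr (2 - a)) sequentially"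
    using re S ev1 ev2 ev3 eventually_ge_at_top[of 1]
  proof eventually_elim
    case (elim n)
    have ep: "\<epsilon> n > 0" and rp: "r n > 0" using eps_pos r_pos elim by auto
    define E where "E = \<epsilon> n powr (- a)"
    have E1: "E \<ge> 1" unfolding E_def using ep elim(3) a by (simp add: powr_minus one_le_inverse powr_le1)
    \<comment> \<open>Since \<open>E \<ge> 1\<close>, rounding down loses at most a factor 2; this
      explains \<open>2 powr (2 * \<xi>)\<close> in \<open>K0\<close>.\<close>
    define s where "s = nat \<lfloor>E\<rfloor>"
    have s: "s \<ge> 1" "real s \<le> E" "E / 2 \<le> real s"
    proof -
      show "s \<ge> 1" "real s \<le> E" using E1 by (auto simp: s_def le_nat_iff)
      have "E - 1 \<le> real s" unfolding s_def using E1 by linarith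
      moreover have "1 \<le> real s" using \<open>s \<ge> 1\<close> by simp
      ultimately show "E / 2 \<le> real s" by linarith
    qed
    have "real s \<le> C * \<epsilon> n powr (- 2 / (2 * \<xi> + 1))"
    proof -
      have "real s \<le> 1 * E" using s by simp
      also have "\<dots> \<le> C * E" using \<open>C > 1\<close> E1 by (intro mult_right_mono) auto
      finally show ?thesis by (simp add: E_def a_def)
    qed
    then obtain \<rho> where \<rho>: "card {j \<in> {..<p n}. \<rho> j \<noteq> 0} = s"
      "L2_norm P (\<lambda>w. \<alpha> (X w) - lin_comb b (p n) \<rho> (X w)) \<le> C * real s powr (- \<xi>)"
      using sparse s(1) elim(6) unfolding sparse_approx_def by blast
    have e0: "error_sq n \<rho> \<le> K0 * \<epsilon> n powr (2 - a)"
    proof -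
      have "error_sq n \<rho> \<le> (C * real s powr (- \<xi>))\<^sup>2"
        unfolding L2_norm_square[symmetric] using \<rho>(2) L2_norm_nonneg by (rule power_mono)
      also have "\<dots> = C\<^sup>2 * real s powr (- (2 * \<xi>))"
        by (simp add: power_mult_distrib power2_eq_square[of "_ powr _"] powr_add[symmetric])
      also have "\<dots> \<le> C\<^sup>2 * (E / 2) powr (- (2 * \<xi>))"
        using s E1 \<open>\<xi> > 0\<close> by (intro mult_left_mono powr_mono2') auto
      also have "(E / 2) powr (- (2 * \<xi>)) = 2 powr (2 * \<xi>) * E powr (- (2 * \<xi>))"
        using E1 by (simp add: powr_divide powr_minus field_simps)
      also have "E powr (- (2 * \<xi>)) = \<epsilon> n powr (2 - a)"
        unfolding E_def powr_powr using a(3) by (simp add: mult.commute)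
      finally show ?thesis by (simp add: K0_def)
    qed
    have e0': "error_sq n \<rho> \<le> K0"
    proof -
      have "\<epsilon> n powr (2 - a) \<le> 1" using ep elim(3) a by (simp add: powr_le1)
      then have "K0 * \<epsilon> n powr (2 - a) \<le> K0 * 1" using K0 by (intro mult_left_mono) auto
      then show ?thesis using e0 by simp
    qed
    obtain u where u: "\<forall>j<p n. \<bar>bias n u j\<bar> \<le> r n / 4"
      "real (card {j \<in> {..<p n}. u j \<noteq> 0}) \<le> real s + 16 * Cb\<^sup>2 * error_sq n \<rho> / (r n)\<^sup>2 + 1"
      "r n * (\<Sum>j<p n. \<bar>u j\<bar>) \<le> r n * (\<Sum>j<p n. \<bar>\<rho> j\<bar>) + 4 * error_sq n \<rho>"
      "error_sq n u \<le> error_sq n \<rho>"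
      using greedy_center[OF elim(6), of \<rho>] \<rho>(1) by auto
    have card_u: "real (card {j \<in> {..<p n}. u j \<noteq> 0}) \<le> K * E"
    proof -
      have "error_sq n \<rho> / (r n)\<^sup>2 \<le> K0 * \<epsilon> n powr (2 - a) / (\<epsilon> n)\<^sup>2"
        using e0 elim(5) ep K0 by (intro frac_le power_mono) auto
      also have "\<dots> = K0 * E"
        using ep by (simp add: E_def powr_diff powr_minus field_simps)
      finally have "16 * Cb\<^sup>2 * (error_sq n \<rho> / (r n)\<^sup>2) \<le> 16 * Cb\<^sup>2 * (K0 * E)" by (intro mult_left_mono) auto
      then have "real (card {j \<in> {..<p n}. u j \<noteq> 0}) \<le> E + 16 * Cb\<^sup>2 * K0 * E + E"
        using u(2) s(2) E1 by simp
      also have "\<dots> = (16 * Cb\<^sup>2 * K0 + 2) * E" by (simp add: algebra_simps)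
      also have "\<dots> \<le> K * E" using K_parts(2) E1 by (intro mult_right_mono) auto
      finally show ?thesis .
    qed
    \<comment> \<open>The support has at most \<open>E\<close> elements, and
      \<open>r n * sqrt E\<close> tends to 0, hence is at most 1 here.\<close>
    have l1: "r n * (\<Sum>j<p n. \<bar>\<rho> j\<bar>) \<le> sqrt K2"
    proof -
      have "card {j \<in> {..<p n}. \<rho> j \<noteq> 0} \<le> S n"
        using \<rho>(1) s(2) elim(2) unfolding E_def a_def by linarith
      then have "c / 2 * (\<Sum>j<p n. (\<rho> j)\<^sup>2) \<le> 2 * Ca\<^sup>2 + 2 * K0"
        using elim(1) lin_comb_square_le[of n \<rho>] e0' by fastforce
      then have "(\<Sum>j<p n. (\<rho> j)\<^sup>2) \<le> K2" using \<open>c > 0\<close> by (simp add: K2_def field_simps)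
      then have "(\<Sum>j<p n. \<bar>\<rho> j\<bar>) \<le> sqrt E * sqrt K2"
        using s(2) \<rho>(1) E1
        by (intro order_trans[OF l1_le_support[of \<rho> "p n"]] mult_mono real_sqrt_le_mono)
          (auto intro: sum_nonneg)
      then have "r n * (\<Sum>j<p n. \<bar>\<rho> j\<bar>) \<le> (r n * sqrt E) * sqrt K2"
        using rp by (simp add: mult.assoc)
      moreover have "sqrt E = \<epsilon> n powr ((1 - a / 2) - 1)"
        unfolding E_def by (simp add: powr_half_sqrt[symmetric] powr_powr)
      ultimately have "r n * (\<Sum>j<p n. \<bar>\<rho> j\<bar>) \<le> (r n * \<epsilon> n powr ((1 - a / 2) - 1)) * sqrt K2"
        by simp
      also have "\<dots> \<le> 1 * sqrt K2" using elim(4) K2 by (intro mult_right_mono) auto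
      finally have "r n * (\<Sum>j<p n. \<bar>\<rho> j\<bar>) \<le> 1 * sqrt K2" .
      then show ?thesis by simp
    qed
    have "error_sq n u \<le> K * \<epsilon> n powr (2 - a)"
    proof -
      have "K0 * \<epsilon> n powr (2 - a) \<le> K * \<epsilon> n powr (2 - a)" using K_parts by (intro mult_right_mono) auto
      then show ?thesis using u(4) e0 by linarith
    qed
    moreover have "(lin_sq n u) \<le> K"
      using lin_comb_square_le[of n u] u(4) e0' K_parts(4) by linarith
    moreover have "r n * (\<Sum>j<p n. \<bar>u j\<bar>) \<le> K" using u(3) l1 e0' K_parts(3) by linarith
    ultimately show ?case using u(1) card_u unfolding E_def by blast
  qed
  then show ?thesis using K_parts(1) unfolding a_def by blast
qed

text \<open>The squared error is of order \<open>\<epsilon>\<close> to the power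
  \<open>\<beta>\<close>, up to a power of \<open>n\<close> absorbed by \<open>\<kappa>\<close>.
  With \<open>\<epsilon>\<close> close to \<open>n\<close> to the power \<open>- 1 / 2\<close>, the
  norm has exponent \<open>- \<beta> / 4\<close>, which equals
  \<open>- \<xi> / (2 * \<xi> + 1)\<close>.\<close>

theorem sparse_rate:
  assumes sparse: "sparse_approx P X b p \<alpha> C \<xi>" and "C > 1" "\<xi> > 0" and "C' > 0" "c > 0"
    and re: "\<And>S :: nat \<Rightarrow> nat. (\<lambda>n. real (S n) * (\<epsilon> n)\<^sup>2) \<longlonglongrightarrow> C' \<Longrightarrow> whp
      (\<lambda>n \<omega>. restricted_eigenvalue_ge (p n) (G_n n \<omega>) (S n) c)"
    and "\<kappa> > 0"
  shows "whp (\<lambda>n \<omega>.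
    L2_norm P (\<lambda>w. \<alpha> (X w) - lin_comb b (p n) (\<rho>hat n \<omega>) (X w)) \<le> real n powr (\<kappa> - \<xi> / (2 * \<xi> + 1)))"
proof -
  define a where "a = 2 / (2 * \<xi> + 1)"
  define \<beta> where "\<beta> = 2 - a"
  have a: "0 < a" "a < 2" "\<beta> / 4 = \<xi> / (2 * \<xi> + 1)" using \<open>\<xi> > 0\<close> by (auto simp: a_def \<beta>_def field_simps)
  have \<beta>: "0 < \<beta>" "\<beta> \<le> 2" using a by (auto simp: \<beta>_def)
  \<comment> \<open>A sparsity to which the eigenvalue condition applies: \<open>S n\<close> times
    \<open>\<epsilon>\<^sup>2\<close> converges to \<open>C'\<close>.\<close>
  define S where "S = (\<lambda>n. nat \<lfloor>C' * \<epsilon> n powr (- 2)\<rfloor>)"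
  have ep2: "\<epsilon> n powr (- 2) * (\<epsilon> n)\<^sup>2 = 1" if "n \<ge> 1" for n
    using eps_pos[OF that] by (simp add: powr_minus)
  have S_bounds: "C' * \<epsilon> n powr (- 2) - 1 \<le> real (S n)" "real (S n) \<le> C' * \<epsilon> n powr (- 2)" for n
  proof -
    have nn: "0 \<le> C' * \<epsilon> n powr (- 2)" using \<open>C' > 0\<close> by simp
    then have "real (S n) = real_of_int \<lfloor>C' * \<epsilon> n powr (- 2)\<rfloor>" by (simp add: S_def)
    then show "C' * \<epsilon> n powr (- 2) - 1 \<le> real (S n)" "real (S n) \<le> C' * \<epsilon> n powr (- 2)" by linarith+
  qed
  have S_lim: "(\<lambda>n. real (S n) * (\<epsilon> n)\<^sup>2) \<longlonglongrightarrow> C'"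
  proof (rule real_tendsto_sandwich[of "\<lambda>n. C' - (\<epsilon> n)\<^sup>2"])
    show "eventually (\<lambda>n. C' - (\<epsilon> n)\<^sup>2 \<le> real (S n) * (\<epsilon> n)\<^sup>2) sequentially"
      using eventually_ge_at_top[of 1]
    proof eventually_elim
      case (elim n)
      have "(C' * \<epsilon> n powr (- 2) - 1) * (\<epsilon> n)\<^sup>2 \<le> real (S n) * (\<epsilon> n)\<^sup>2"
        using S_bounds by (intro mult_right_mono) auto
      then show ?case using ep2[OF elim] by (simp add: left_diff_distrib mult.assoc)
    qed
    show "eventually (\<lambda>n. real (S n) * (\<epsilon> n)\<^sup>2 \<le> C') sequentially"
      using eventually_ge_at_top[of 1]
    proof eventually_elim
      case (elim n)
      have "real (S n) * (\<epsilon> n)\<^sup>2 \<le> (C' * \<epsilon> n powr (- 2)) * (\<epsilon> n)\<^sup>2"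
        using S_bounds by (intro mult_right_mono) auto
      then show ?case using ep2[OF elim] by (simp add: mult.assoc)
    qed
    show "(\<lambda>n. C' - (\<epsilon> n)\<^sup>2) \<longlonglongrightarrow> C'"
      using tendsto_diff[OF tendsto_const tendsto_power[OF eps_tendsto_0, of 2]] by simp
  qed simp
  note reS = re[OF S_lim]
  \<comment> \<open>\<open>S n\<close> is of order \<open>\<epsilon>\<close> to the power
    \<open>- 2\<close>, which dominates every multiple of the power \<open>- a\<close> because
    \<open>a < 2\<close>.\<close>
  have S_large: "eventually (\<lambda>n. K * \<epsilon> n powr (- a) \<le> real (S n)) sequentially" for K
  proof -
    have nn: "eventually (\<lambda>n. 0 \<le> \<epsilon> n) sequentially"
      using eventually_ge_at_top[of 1] by eventually_elim (rule less_imp_le[OF eps_pos])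
    have "(\<lambda>n. \<epsilon> n powr \<beta>) \<longlonglongrightarrow> 0"
      using tendsto_powr2[OF eps_tendsto_0 tendsto_const[of \<beta>] nn \<beta>(1)] \<beta> by simp
    then have "(\<lambda>n. \<bar>K\<bar> * \<epsilon> n powr \<beta> + (\<epsilon> n)\<^sup>2) \<longlonglongrightarrow> \<bar>K\<bar> * 0 + 0\<^sup>2"
      by (intro tendsto_intros eps_tendsto_0)
    then have lim0: "(\<lambda>n. \<bar>K\<bar> * \<epsilon> n powr \<beta> + (\<epsilon> n)\<^sup>2) \<longlonglongrightarrow> 0" by simp
    have "eventually (\<lambda>n. \<bar>K\<bar> * \<epsilon> n powr \<beta> + (\<epsilon> n)\<^sup>2 < C') sequentially"
      by (rule order_tendstoD(2)[OF lim0 \<open>C' > 0\<close>])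
    then show ?thesis using eventually_ge_at_top[of 1]
    proof eventually_elim
      case (elim n)
      have ep: "\<epsilon> n > 0" using eps_pos elim by simp
      have "\<bar>K\<bar> * \<epsilon> n powr (- a) + 1 = (\<bar>K\<bar> * \<epsilon> n powr \<beta> + (\<epsilon> n)\<^sup>2) * \<epsilon> n powr (- 2)"
        using ep ep2[OF elim(2)] powr_add[of "\<epsilon> n" \<beta> "- 2"] by (simp add: \<beta>_def algebra_simps)
      also have "\<dots> \<le> C' * \<epsilon> n powr (- 2)" using elim by (intro mult_right_mono) auto
      finally have "\<bar>K\<bar> * \<epsilon> n powr (- a) \<le> real (S n)" using S_bounds[of n] by linarith
      moreover have "K * \<epsilon> n powr (- a) \<le> \<bar>K\<bar> * \<epsilon> n powr (- a)" by (intro mult_right_mono) auto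
      ultimately show ?case by linarith
    qed
  qed
  obtain K where K: "K > 0" and ev: "eventually (\<lambda>n. \<exists>u.
    (\<forall>j<p n. \<bar>bias n u j\<bar> \<le> r n / 4) \<and>
    real (card {j \<in> {..<p n}. u j \<noteq> 0}) \<le> K * \<epsilon> n powr (- a) \<and>
    r n * (\<Sum>j<p n. \<bar>u j\<bar>) \<le> K \<and> (lin_sq n u) \<le> K \<and>
    error_sq n u \<le> K * \<epsilon> n powr \<beta>) sequentially"
    using sparse_center[OF sparse \<open>C > 1\<close> \<open>\<xi> > 0\<close> \<open>c > 0\<close>
        population_restricted_eigenvalue[OF \<open>c > 0\<close> reS]] S_large[of 1]
    unfolding a_def \<beta>_def by auto
  \<comment> \<open>The centers form a deterministic sequence: they may vary with \<open>n\<close>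
    but not with the sample, as Bernstein's inequality is applied to functions built from
    them.\<close>
  obtain u where u: "eventually (\<lambda>n.
    (\<forall>j<p n. \<bar>bias n (u n) j\<bar> \<le> r n / 4) \<and>
    real (card {j \<in> {..<p n}. u n j \<noteq> 0}) \<le> K * \<epsilon> n powr (- a) \<and>
    r n * (\<Sum>j<p n. \<bar>u n j\<bar>) \<le> K \<and> (lin_sq n (u n)) \<le> K \<and>
    error_sq n (u n) \<le> K * \<epsilon> n powr \<beta>) sequentially"
    using eventually_choice[OF ev] by blast
  have score: "whp (\<lambda>n \<omega>. \<forall>j<p n.
    \<bar>M_n n \<omega> j - (\<Sum>k<p n. G_n n \<omega> j k * u n k)\<bar> \<le> r n / 2)"
    by (rule score_bound[of u K]; use u in \<open>eventually_elim; blast\<close>)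
  \<comment> \<open>Adding 1 guarantees \<open>K1 * E \<ge> 1\<close>, so that the sparsity bound
    \<open>k\<close> below is at least 1.\<close>
  define K1 where "K1 = K + 1"
  define K3 where "K3 = 2 * K + 180 * B * K1 / c\<^sup>2"
  have K3: "K3 > 0" using K B_pos \<open>c > 0\<close> by (simp add: K3_def K1_def add_pos_pos)
  have ev_r: "eventually (\<lambda>n. r n \<le> real n powr (\<kappa> / 2) * \<epsilon> n) sequentially"
    using \<open>\<kappa> > 0\<close> by (intro r_le_eps) simp
  have ev_pow: "eventually (\<lambda>n. K3 * (real n powr (2 * \<kappa> / 2) * \<epsilon> n powr \<beta>) \<le> real n powr (2 * \<kappa> - \<beta> / 2)) sequentially"
    using \<open>\<kappa> > 0\<close> \<beta> K3 by (intro eps_power_le) auto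
  have ev1: "eventually (\<lambda>n. \<epsilon> n \<le> 1) sequentially"
    using order_tendstoD(2)[OF eps_tendsto_0, of 1] by (auto elim: eventually_mono)
  from with_prob_approaching_one_conj[OF M.prob_space_axioms score
      with_prob_approaching_one_conj[OF M.prob_space_axioms lasso reS]]
  show ?thesis
  proof (rule with_prob_approaching_one_mono)
    show "eventually (\<lambda>n. \<forall>\<omega>\<in>space M.
      (\<forall>j<p n. \<bar>M_n n \<omega> j - (\<Sum>k<p n. G_n n \<omega> j k * u n k)\<bar> \<le> r n / 2) \<and>
      is_arg_min (lasso_objective (p n) (r n) (M_n n \<omega>) (G_n n \<omega>))
        (\<lambda>_. True) (\<rho>hat n \<omega>) \<and>
      restricted_eigenvalue_ge (p n) (G_n n \<omega>) (S n) c \<longrightarrow>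
      L2_norm P (\<lambda>w. \<alpha> (X w) - lin_comb b (p n) (\<rho>hat n \<omega>) (X w)) \<le> real n powr (\<kappa> - \<xi> / (2 * \<xi> + 1))) sequentially"
      using u S_large[of "2 * K1"] ev_r ev_pow ev1 eventually_ge_at_top[of 1]
    proof eventually_elim
      case (elim n)
      have ep: "\<epsilon> n > 0" and rp: "r n > 0" using eps_pos r_pos elim by auto
      define E where "E = \<epsilon> n powr (- a)"
      have E1: "E \<ge> 1" unfolding E_def using ep elim(5) a by (simp add: powr_minus one_le_inverse powr_le1)
      define k where "k = nat \<lfloor>K1 * E\<rfloor>"
      have KE: "1 \<le> K1 * E" using K E1 mult_mono[of 1 K1 1 E] by (simp add: K1_def)
      have k: "k \<ge> 1" "real k \<le> K1 * E" using KE by (auto simp: k_def le_nat_iff)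
      have supp: "card {j \<in> {..<p n}. u n j \<noteq> 0} \<le> k"
      proof -
        have "K * E \<le> K1 * E" using E1 by (simp add: K1_def)
        then have "real (card {j \<in> {..<p n}. u n j \<noteq> 0}) \<le> K1 * E" using elim(1) unfolding E_def by linarith
        then show ?thesis unfolding k_def by (simp add: le_nat_floor)
      qed
      have kS: "2 * k \<le> S n" using k(2) elim(2) unfolding E_def by linarith
      show ?case
      proof (intro ballI impI)
        fix \<omega>
        let ?M = "M_n n \<omega>" and ?G = "G_n n \<omega>"
        assume H: "(\<forall>j<p n. \<bar>?M j - (\<Sum>k<p n. ?G j k * u n k)\<bar> \<le> r n / 2) \<and>
          is_arg_min (lasso_objective (p n) (r n) ?M ?G) (\<lambda>_. True) (\<rho>hat n \<omega>) \<and>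
          restricted_eigenvalue_ge (p n) ?G (S n) c"
        let ?d = "\<lambda>j. \<rho>hat n \<omega> j - u n j"
        have "(\<Sum>j<p n. (?d j)\<^sup>2) \<le> 90 * (r n)\<^sup>2 * real k / c\<^sup>2"
          by (rule lasso_fast_bound[of ?G "p n" "r n" c ?M]) (use H dict.G_hat_sym dict.G_hat_psd rp \<open>c > 0\<close> supp k kS in auto)
        also have "\<dots> \<le> 90 * (r n)\<^sup>2 * (K1 * E) / c\<^sup>2"
          using k by (intro divide_right_mono mult_left_mono) auto
        finally have d: "(\<Sum>j<p n. (?d j)\<^sup>2) \<le> 90 * K1 / c\<^sup>2 * ((r n)\<^sup>2 * E)" by (simp add: mult_ac)
        have "(r n)\<^sup>2 * E \<le> (real n powr (\<kappa> / 2) * \<epsilon> n)\<^sup>2 * E"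
          using elim(3) rp E1 by (intro mult_right_mono power_mono) auto
        also have "\<dots> = real n powr \<kappa> * \<epsilon> n powr \<beta>"
          using ep by (simp add: E_def \<beta>_def power_mult_distrib power2_eq_square[of "_ powr _"] powr_add[symmetric]
              powr_diff powr_minus field_simps)
        finally have rE: "(r n)\<^sup>2 * E \<le> real n powr \<kappa> * \<epsilon> n powr \<beta>" .
        have "(lin_sq n ?d) \<le> B * (\<Sum>j<p n. (?d j)\<^sup>2)" by (rule gram_le[OF elim(6)])
        also have "\<dots> \<le> B * (90 * K1 / c\<^sup>2 * (real n powr \<kappa> * \<epsilon> n powr \<beta>))"
        proof -
          have "90 * K1 / c\<^sup>2 * ((r n)\<^sup>2 * E) \<le> 90 * K1 / c\<^sup>2 * (real n powr \<kappa> * \<epsilon> n powr \<beta>)"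
            using rE K by (intro mult_left_mono) (auto simp: K1_def)
          then show ?thesis using d B_pos by (intro mult_left_mono) auto
        qed
        finally have lin: "(lin_sq n ?d) \<le> 90 * B * K1 / c\<^sup>2 * (real n powr \<kappa> * \<epsilon> n powr \<beta>)"
          by (simp add: mult_ac)
        have "1 \<le> real n powr \<kappa>" using elim(6) \<open>\<kappa> > 0\<close> by (simp add: ge_one_powr_ge_zero)
        then have "K * (1 * \<epsilon> n powr \<beta>) \<le> K * (real n powr \<kappa> * \<epsilon> n powr \<beta>)"
          using K by (intro mult_left_mono mult_right_mono) auto
        then have eu: "error_sq n (u n) \<le> K * (real n powr \<kappa> * \<epsilon> n powr \<beta>)" using elim(1) by simp
        have "error_sq n (\<rho>hat n \<omega>) \<le> 2 * (K * (real n powr \<kappa> * \<epsilon> n powr \<beta>))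
            + 2 * (90 * B * K1 / c\<^sup>2 * (real n powr \<kappa> * \<epsilon> n powr \<beta>))"
          using error_sq_triangle[of n "\<rho>hat n \<omega>" "u n"] eu lin by linarith
        also have "\<dots> = K3 * (real n powr \<kappa> * \<epsilon> n powr \<beta>)" by (simp add: K3_def algebra_simps)
        also have "\<dots> \<le> real n powr (2 * \<kappa> - \<beta> / 2)" using elim(4) by simp
        finally show "L2_norm P (\<lambda>w. \<alpha> (X w) - lin_comb b (p n) (\<rho>hat n \<omega>) (X w))
            \<le> real n powr (\<kappa> - \<xi> / (2 * \<xi> + 1))"
          unfolding a(3)[symmetric] by (rule L2_norm_le_powr)
      qed
    qed
  qed
qed

end

section \<open>Rate of the Lasso under an absolutely summable expansion\<close>

context lasso_riesz
begin

text \<open>The tail of the expansion is controlled through the Gram bound: its squared coefficients are at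
  most the total mass times the smallest retained coefficient, hence of order \<open>n\<close> to the power \<open>-1/2\<close>.
  Since the sets \<open>J\<close> grow without bound, so does \<open>p\<close>, and the Gram bound covers every finite part of
  the tail.\<close>

lemma summable_tail:
  assumes sums: "AE w in P. (\<lambda>j. \<rho> j * b j (X w)) sums \<alpha> (X w)" and summ: "summable (\<lambda>j. \<bar>\<rho> j\<bar>)"
    and n: "n \<ge> 1" and J: "J \<subseteq> {..<p n}" "J \<noteq> {}"
    and large: "\<And>j k. j \<in> J \<Longrightarrow> k \<notin> J \<Longrightarrow> \<bar>\<rho> k\<bar> \<le> \<bar>\<rho> j\<bar>"
    and unbounded: "\<And>q. \<exists>n'\<ge>1. q \<le> p n'"
  shows "error_sq n (\<lambda>j. if j \<in> J then \<rho> j else 0) \<le> B * (\<Sum>j. \<bar>\<rho> j\<bar>)\<^sup>2 / real (card J)"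
proof -
  define A where "A = (\<Sum>j. \<bar>\<rho> j\<bar>)"
  have A_ge: "(\<Sum>j\<in>F. \<bar>\<rho> j\<bar>) \<le> A" if "finite F" for F
    unfolding A_def using summ that by (intro sum_le_suminf) auto
  have A0: "A \<ge> 0" using A_ge[of "{}"] by simp
  have finJ: "finite J" using J finite_subset by blast
  have cJ: "real (card J) > 0" using J finJ by (simp add: card_gt_0_iff)
  let ?u = "\<lambda>j. if j \<in> J then \<rho> j else 0"
  let ?v = "\<lambda>j. if j \<in> J then 0 else \<rho> j"
  have coef: "\<bar>\<rho> k\<bar> \<le> A / real (card J)" if "k \<notin> J" for k
  proof -
    have "real (card J) * \<bar>\<rho> k\<bar> = (\<Sum>j\<in>J. \<bar>\<rho> k\<bar>)" by simp
    also have "\<dots> \<le> (\<Sum>j\<in>J. \<bar>\<rho> j\<bar>)" using large that by (intro sum_mono) auto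
    also have "\<dots> \<le> A" by (rule A_ge[OF finJ])
    finally show ?thesis using cJ by (simp add: field_simps)
  qed
  have part: "(\<integral>w. (lin_comb b q ?v (X w))\<^sup>2 \<partial>P) \<le> B * A\<^sup>2 / real (card J)" for q
  proof -
    obtain n' where n': "n' \<ge> 1" "q \<le> p n'" using unbounded by blast
    let ?v' = "\<lambda>j. if j < q then ?v j else 0"
    have "lin_comb b q ?v x = lin_comb b (p n') ?v' x" for x
      unfolding lin_comb_def using n'(2) by (intro sum.mono_neutral_cong_left) auto
    then have "(\<integral>w. (lin_comb b q ?v (X w))\<^sup>2 \<partial>P) \<le> B * (\<Sum>j<p n'. (?v' j)\<^sup>2)"
      using gram_le[OF n'(1), of ?v'] by simp
    also have "(\<Sum>j<p n'. (?v' j)\<^sup>2) \<le> (\<Sum>j<p n'. A / real (card J) * \<bar>\<rho> j\<bar>)"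
    proof (rule sum_mono)
      fix j
      show "(?v' j)\<^sup>2 \<le> A / real (card J) * \<bar>\<rho> j\<bar>"
      proof (cases "j < q \<and> j \<notin> J")
        case True
        then have "(?v' j)\<^sup>2 = \<bar>\<rho> j\<bar> * \<bar>\<rho> j\<bar>" by (simp add: power2_eq_square)
        also have "\<dots> \<le> A / real (card J) * \<bar>\<rho> j\<bar>" using coef True by (intro mult_right_mono) auto
        finally show ?thesis .
      next
        case False
        then have "?v' j = 0" by auto
        then show ?thesis using A0 cJ by simp
      qed
    qed
    also have "\<dots> = A / real (card J) * (\<Sum>j<p n'. \<bar>\<rho> j\<bar>)" by (simp add: sum_distrib_left)
    also have "\<dots> \<le> A / real (card J) * A" using A_ge[of "{..<p n'}"] A0 cJ by (intro mult_left_mono) auto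
    finally show ?thesis using B_pos by (simp add: power2_eq_square)
  qed
  \<comment> \<open>From \<open>p n\<close> on, subtracting the retained terms from a partial sum of
    the expansion leaves the partial sum of the tail. All of these are dominated by the constant
    \<open>Cb * A\<close>.\<close>
  have lim: "(\<lambda>q. \<integral>w. (lin_comb b q ?v (X w))\<^sup>2 \<partial>P) \<longlonglongrightarrow> error_sq n ?u"
  proof (rule integral_dominated_convergence[where w = "\<lambda>_. (Cb * A)\<^sup>2"])
    show "AE w in P. (\<lambda>q. (lin_comb b q ?v (X w))\<^sup>2) \<longlonglongrightarrow> (\<alpha> (X w) - lin_comb b (p n) ?u (X w))\<^sup>2"
      using sums
    proof eventually_elim
      case (elim w)
      have "(\<lambda>q. (\<Sum>j<q. \<rho> j * b j (X w)) - lin_comb b (p n) ?u (X w))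
          \<longlonglongrightarrow> \<alpha> (X w) - lin_comb b (p n) ?u (X w)"
        using elim unfolding sums_def by (intro tendsto_diff tendsto_const)
      moreover have "eventually (\<lambda>q. (\<Sum>j<q. \<rho> j * b j (X w)) - lin_comb b (p n) ?u (X w)
          = lin_comb b q ?v (X w)) sequentially"
        using eventually_ge_at_top[of "p n"]
      proof eventually_elim
        case (elim q)
        have "lin_comb b (p n) ?u (X w) = lin_comb b q ?u (X w)"
          unfolding lin_comb_def using elim J(1) by (intro sum.mono_neutral_cong_left) auto
        moreover have "lin_comb b q ?u (X w) + lin_comb b q ?v (X w) = (\<Sum>j<q. \<rho> j * b j (X w))"
          unfolding lin_comb_def sum.distrib[symmetric] by (intro sum.cong) (auto simp: mult.commute)
        ultimately show ?case by simp
      qed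
      ultimately have "(\<lambda>q. lin_comb b q ?v (X w)) \<longlonglongrightarrow> \<alpha> (X w) - lin_comb b (p n) ?u (X w)"
        by (rule Lim_transform_eventually)
      then show ?case by (rule tendsto_power)
    qed
    show "AE w in P. norm ((lin_comb b q ?v (X w))\<^sup>2) \<le> (Cb * A)\<^sup>2" for q
      using dict.AE_lin_comb_le[of q ?v]
    proof eventually_elim
      case (elim w)
      have "(\<Sum>j<q. \<bar>?v j\<bar>) \<le> (\<Sum>j<q. \<bar>\<rho> j\<bar>)" by (intro sum_mono) auto
      also have "\<dots> \<le> A" by (intro A_ge) simp
      finally have "Cb * (\<Sum>j<q. \<bar>?v j\<bar>) \<le> Cb * A" using dict.Cb_pos by (intro mult_left_mono) auto
      then have "\<bar>lin_comb b q ?v (X w)\<bar> \<le> Cb * A" using elim by linarith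
      then have "\<bar>lin_comb b q ?v (X w)\<bar>\<^sup>2 \<le> (Cb * A)\<^sup>2" by (rule power_mono) simp
      then show ?case by simp
    qed
  qed simp_all
  show ?thesis
    unfolding A_def[symmetric] by (rule LIMSEQ_le_const2[OF lim]) (use part in blast)
qed

text \<open>About \<open>C * sqrt n\<close> coefficients are retained, so the tail has squared error
  of order \<open>1 / sqrt n\<close>, which is \<open>O(r)\<close> since
  \<open>r \<ge> \<epsilon>\<close> eventually and \<open>p \<ge> 2\<close>. Coordinate descent adds
  at most 4 times this error to \<open>r\<close> times the coefficient sum, so after division by
  \<open>r\<close> the coefficient sum remains bounded.\<close>

lemma summable_center:
  assumes "summable_expansion P X b p \<alpha>"
  shows "\<exists>K>0. eventually (\<lambda>n. \<exists>u.
    (\<forall>j<p n. \<bar>bias n u j\<bar> \<le> r n / 4) \<and>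
    (\<Sum>j<p n. \<bar>u j\<bar>) \<le> K \<and> error_sq n u \<le> K * r n) sequentially"
proof -
  obtain \<rho> C where sums: "AE w in P. (\<lambda>j. \<rho> j * b j (X w)) sums \<alpha> (X w)"
    and summ: "summable (\<lambda>j. \<bar>\<rho> j\<bar>)" and "C > 0"
    and top: "\<And>n. n \<ge> 1 \<Longrightarrow> \<exists>J\<subseteq>{..<p n}. card J = nat \<lfloor>C * sqrt (real n)\<rfloor> \<and>
      (\<forall>j\<in>J. \<forall>k. k \<notin> J \<longrightarrow> \<bar>\<rho> k\<bar> \<le> \<bar>\<rho> j\<bar>)"
    using assms unfolding summable_expansion_def by blast
  define A where "A = (\<Sum>j. \<bar>\<rho> j\<bar>)"
  have A0: "A \<ge> 0" unfolding A_def by (intro suminf_nonneg summ) simp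
  \<comment> \<open>The 2 pays for rounding \<open>C * sqrt n\<close> down, and
    \<open>sqrt (ln 2)\<close> is the lower bound on \<open>\<epsilon> n * sqrt n\<close> that comes
    from \<open>p n \<ge> 2\<close>.\<close>
  define K0 where "K0 = 2 * B * A\<^sup>2 / (C * sqrt (ln 2))"
  have K0: "K0 \<ge> 0" using \<open>C > 0\<close> B_pos by (simp add: K0_def)
  have unbounded: "\<exists>n'\<ge>1. q \<le> p n'" for q
  proof -
    have "eventually (\<lambda>n. real q + 1 \<le> C * sqrt (real n)) sequentially" using \<open>C > 0\<close> by real_asymp
    then have "eventually (\<lambda>n. real q + 1 \<le> C * sqrt (real n) \<and> n \<ge> 1) sequentially"
      using eventually_ge_at_top[of 1] by eventually_elim simp
    then obtain n where n: "real q + 1 \<le> C * sqrt (real n)" "n \<ge> 1"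
      by (auto simp: eventually_sequentially)
    obtain J where J: "J \<subseteq> {..<p n}" "card J = nat \<lfloor>C * sqrt (real n)\<rfloor>" using top[OF n(2)] by blast
    have "q \<le> nat \<lfloor>C * sqrt (real n)\<rfloor>" using n(1) by (intro le_nat_floor) simp
    also have "\<dots> \<le> p n" using J card_mono[of "{..<p n}" J] by simp
    finally show ?thesis using n(2) by blast
  qed
  have "eventually (\<lambda>n. 2 \<le> C * sqrt (real n)) sequentially" using \<open>C > 0\<close> by real_asymp
  moreover have "eventually (\<lambda>n. \<epsilon> n \<le> 1 * r n) sequentially" by (rule eps_le_r) simp
  ultimately have "eventually (\<lambda>n. \<exists>u.
    (\<forall>j<p n. \<bar>bias n u j\<bar> \<le> r n / 4) \<and>
    (\<Sum>j<p n. \<bar>u j\<bar>) \<le> A + 4 * K0 + 1 \<and> error_sq n u \<le> (A + 4 * K0 + 1) * r n) sequentially"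
    using eventually_ge_at_top[of 1]
  proof eventually_elim
    case (elim n)
    have rp: "r n > 0" using r_pos elim by simp
    obtain J where J: "J \<subseteq> {..<p n}" "card J = nat \<lfloor>C * sqrt (real n)\<rfloor>"
      "\<And>j k. j \<in> J \<Longrightarrow> k \<notin> J \<Longrightarrow> \<bar>\<rho> k\<bar> \<le> \<bar>\<rho> j\<bar>" using top[OF elim(3)] by blast
    have cJ: "C * sqrt (real n) / 2 \<le> real (card J)"
    proof -
      have "real (card J) \<ge> C * sqrt (real n) - 1" unfolding J(2) by linarith
      then show ?thesis using elim(1) by linarith
    qed
    then have "card J \<noteq> 0" using elim(1) by (auto intro!: Nat.gr0I)
    then have "J \<noteq> {}" by auto
    let ?u = "\<lambda>j. if j \<in> J then \<rho> j else 0"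
    have sq_n: "sqrt (ln 2) / r n \<le> sqrt (real n)"
    proof -
      have "sqrt (ln 2) \<le> sqrt (ln (real (p n)))" using ln_p(1)[OF elim(3)] by simp
      also have "\<dots> = \<epsilon> n * sqrt (real n)" using elim(3) by (simp add: eps_rate_def real_sqrt_divide)
      also have "\<dots> \<le> r n * sqrt (real n)" using elim(2) by (intro mult_right_mono) auto
      finally show ?thesis using rp by (simp add: field_simps)
    qed
    have e0: "error_sq n ?u \<le> K0 * r n"
    proof -
      have "error_sq n ?u \<le> B * A\<^sup>2 / real (card J)"
        unfolding A_def using J \<open>J \<noteq> {}\<close> elim(3) unbounded by (intro summable_tail[OF sums summ]) auto
      also have "\<dots> \<le> B * A\<^sup>2 / (C * (sqrt (ln 2) / r n) / 2)"
      proof (rule frac_le)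
        have "C * (sqrt (ln 2) / r n) \<le> C * sqrt (real n)" using sq_n \<open>C > 0\<close> by (intro mult_left_mono) auto
        then have "C * (sqrt (ln 2) / r n) / 2 \<le> C * sqrt (real n) / 2" by (rule divide_right_mono) simp
        then show "C * (sqrt (ln 2) / r n) / 2 \<le> real (card J)" using cJ by (rule order_trans)
        show "0 < C * (sqrt (ln 2) / r n) / 2" using \<open>C > 0\<close> rp by simp
      qed (use B_pos in auto)
      also have "\<dots> = K0 * r n" by (simp add: K0_def)
      finally show ?thesis .
    qed
    obtain u where u: "\<forall>j<p n. \<bar>bias n u j\<bar> \<le> r n / 4"
      "r n * (\<Sum>j<p n. \<bar>u j\<bar>) \<le> r n * (\<Sum>j<p n. \<bar>?u j\<bar>) + 4 * error_sq n ?u"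
      "error_sq n u \<le> error_sq n ?u"
      using greedy_center[OF elim(3), of ?u] by blast
    have "(\<Sum>j<p n. \<bar>?u j\<bar>) \<le> (\<Sum>j<p n. \<bar>\<rho> j\<bar>)" by (intro sum_mono) auto
    also have "\<dots> \<le> A" unfolding A_def using summ by (intro sum_le_suminf) auto
    finally have "r n * (\<Sum>j<p n. \<bar>?u j\<bar>) \<le> r n * A" using rp by (intro mult_left_mono) auto
    then have "r n * (\<Sum>j<p n. \<bar>u j\<bar>) \<le> r n * A + 4 * (K0 * r n)" using u(2) e0 by linarith
    then have "r n * (\<Sum>j<p n. \<bar>u j\<bar>) \<le> r n * (A + 4 * K0)" by (simp add: algebra_simps)
    then have "(\<Sum>j<p n. \<bar>u j\<bar>) \<le> A + 4 * K0" using rp by (simp only: mult_le_cancel_left_pos)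
    moreover have "error_sq n u \<le> (A + 4 * K0 + 1) * r n"
    proof -
      have "K0 * r n \<le> (A + 4 * K0 + 1) * r n" using rp A0 K0 by (intro mult_right_mono) auto
      then show ?thesis using u(3) e0 by linarith
    qed
    ultimately show ?case using u(1) by (intro exI[of _ u]) auto
  qed
  moreover have "A + 4 * K0 + 1 > 0" using A0 K0 by linarith
  ultimately show ?thesis by blast
qed

text \<open>The slow bound on the sample form and the passage to the population form both cost a
  multiple of \<open>r\<close>, so the squared error is nearly of order \<open>n\<close> to the
  power \<open>- 1 / 2\<close>. The bound on the coefficients makes the estimated representer
  uniformly bounded, as the variance estimator requires.\<close>

theorem summable_rate:
  assumes summ: "summable_expansion P X b p \<alpha>"
  shows "\<kappa> > 0 \<Longrightarrow> whp (\<lambda>n \<omega>.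
      L2_norm P (\<lambda>w. \<alpha> (X w) - lin_comb b (p n) (\<rho>hat n \<omega>) (X w)) \<le> real n powr (\<kappa> - 1 / 4))"
    and "\<exists>K>0. whp (\<lambda>n \<omega>. (\<Sum>j<p n. \<bar>\<rho>hat n \<omega> j\<bar>) \<le> K)"
proof -
  obtain K where K: "K > 0" and ev: "eventually (\<lambda>n. \<exists>u.
    (\<forall>j<p n. \<bar>bias n u j\<bar> \<le> r n / 4) \<and>
    (\<Sum>j<p n. \<bar>u j\<bar>) \<le> K \<and> error_sq n u \<le> K * r n) sequentially"
    using summable_center[OF summ] by blast
  obtain u where u: "eventually (\<lambda>n.
    (\<forall>j<p n. \<bar>bias n (u n) j\<bar> \<le> r n / 4) \<and>
    (\<Sum>j<p n. \<bar>u n j\<bar>) \<le> K \<and> error_sq n (u n) \<le> K * r n) sequentially"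
    using eventually_choice[OF ev] by blast
  have r1: "eventually (\<lambda>n. r n \<le> 1) sequentially"
    using order_tendstoD(2)[OF r_tendsto_0, of 1] by (auto elim: eventually_mono)
  have score: "whp (\<lambda>n \<omega>. \<forall>j<p n.
    \<bar>M_n n \<omega> j - (\<Sum>k<p n. G_n n \<omega> j k * u n k)\<bar> \<le> r n / 2)"
  proof (rule score_bound[of u "2 * Ca\<^sup>2 + 2 * K"])
    show "eventually (\<lambda>n. r n * (\<Sum>j<p n. \<bar>u n j\<bar>) \<le> 2 * Ca\<^sup>2 + 2 * K) sequentially"
      using u r1 eventually_ge_at_top[of 1]
    proof eventually_elim
      case (elim n)
      have "r n * (\<Sum>j<p n. \<bar>u n j\<bar>) \<le> 1 * K"
        using elim r_pos[OF elim(3)] K by (intro mult_mono) (auto intro: sum_nonneg)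
      moreover have "Ca\<^sup>2 \<ge> 0" by simp
      ultimately show ?case using K by linarith
    qed
    show "eventually (\<lambda>n. (lin_sq n (u n)) \<le> 2 * Ca\<^sup>2 + 2 * K) sequentially"
      using u r1
    proof eventually_elim
      case (elim n)
      have "K * r n \<le> K * 1" using elim K by (intro mult_left_mono) auto
      moreover have "error_sq n (u n) \<le> K * r n" using elim by blast
      ultimately show ?case using lin_comb_square_le[of n "u n"] by linarith
    qed
    show "eventually (\<lambda>n. \<forall>j<p n.
        \<bar>bias n (u n) j\<bar> \<le> r n / 4) sequentially"
      using u by eventually_elim blast
  qed
  \<comment> \<open>\<open>4 * K\<close> bounds the coefficient sum of the error:
    \<open>3 * K\<close> for the Lasso and \<open>K\<close> for the center.\<close>
  define K3 where "K3 = 2 * K + 2 * (3 * K + (4 * K)\<^sup>2)"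
  have K3: "K3 > 0" using K by (simp add: K3_def add_pos_pos)
  have main: "whp (\<lambda>n \<omega>. (\<Sum>j<p n. \<bar>\<rho>hat n \<omega> j\<bar>) \<le> 3 * K \<and>
    error_sq n (\<rho>hat n \<omega>) \<le> K3 * r n)"
    using with_prob_approaching_one_conj[OF M.prob_space_axioms score
      with_prob_approaching_one_conj[OF M.prob_space_axioms lasso gram_bound]]
  proof (rule with_prob_approaching_one_mono)
    show "eventually (\<lambda>n. \<forall>\<omega>\<in>space M.
      (\<forall>j<p n. \<bar>M_n n \<omega> j - (\<Sum>k<p n. G_n n \<omega> j k * u n k)\<bar> \<le> r n / 2) \<and>
      is_arg_min (lasso_objective (p n) (r n) (M_n n \<omega>) (G_n n \<omega>))
        (\<lambda>_. True) (\<rho>hat n \<omega>) \<and>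
      (\<forall>v. (lin_sq n v)
        \<le> quad_form (p n) (G_n n \<omega>) v + r n * (\<Sum>j<p n. \<bar>v j\<bar>)\<^sup>2) \<longrightarrow>
      (\<Sum>j<p n. \<bar>\<rho>hat n \<omega> j\<bar>) \<le> 3 * K \<and> error_sq n (\<rho>hat n \<omega>) \<le> K3 * r n) sequentially"
      using u eventually_ge_at_top[of 1]
    proof eventually_elim
      case (elim n)
      have rp: "r n > 0" using r_pos elim by simp
      show ?case
      proof (intro ballI impI)
        fix \<omega>
        let ?M = "M_n n \<omega>" and ?G = "G_n n \<omega>"
        let ?d = "\<lambda>j. \<rho>hat n \<omega> j - u n j"
        assume H: "(\<forall>j<p n. \<bar>?M j - (\<Sum>k<p n. ?G j k * u n k)\<bar> \<le> r n / 2) \<and>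
          is_arg_min (lasso_objective (p n) (r n) ?M ?G) (\<lambda>_. True) (\<rho>hat n \<omega>) \<and>
          (\<forall>v. (lin_sq n v) \<le> quad_form (p n) ?G v + r n * (\<Sum>j<p n. \<bar>v j\<bar>)\<^sup>2)"
        note slow = lasso_slow_bound[of ?G "p n" "r n" ?M "\<rho>hat n \<omega>" "u n",
            OF dict.G_hat_sym dict.G_hat_psd rp H[THEN conjunct2, THEN conjunct1] H[THEN conjunct1, rule_format]]
        have ul: "(\<Sum>j<p n. \<bar>u n j\<bar>) \<le> K" using elim by blast
        have l1: "(\<Sum>j<p n. \<bar>\<rho>hat n \<omega> j\<bar>) \<le> 3 * K" using slow(1) ul by simp
        have "(\<Sum>j<p n. \<bar>?d j\<bar>) \<le> (\<Sum>j<p n. \<bar>\<rho>hat n \<omega> j\<bar>) + (\<Sum>j<p n. \<bar>u n j\<bar>)"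
          unfolding sum.distrib[symmetric] by (intro sum_mono) auto
        then have "(\<Sum>j<p n. \<bar>?d j\<bar>)\<^sup>2 \<le> (4 * K)\<^sup>2"
          using l1 ul by (intro power_mono) (auto intro: sum_nonneg)
        then have "r n * (\<Sum>j<p n. \<bar>?d j\<bar>)\<^sup>2 \<le> r n * (4 * K)\<^sup>2" using rp by (intro mult_left_mono) auto
        moreover have "3 * r n * (\<Sum>j<p n. \<bar>u n j\<bar>) \<le> 3 * r n * K" using rp ul by (intro mult_left_mono) auto
        moreover have "(lin_sq n ?d) \<le> quad_form (p n) ?G ?d + r n * (\<Sum>j<p n. \<bar>?d j\<bar>)\<^sup>2"
          using H by blast
        ultimately have lin: "(lin_sq n ?d) \<le> 3 * r n * K + r n * (4 * K)\<^sup>2"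
          using slow(2) by linarith
        have "error_sq n (u n) \<le> K * r n" using elim by blast
        then have "error_sq n (\<rho>hat n \<omega>) \<le> 2 * (K * r n) + 2 * (3 * r n * K + r n * (4 * K)\<^sup>2)"
          using lin by (intro order_trans[OF error_sq_triangle[of n "\<rho>hat n \<omega>" "u n"]] add_mono mult_left_mono) auto
        also have "\<dots> = K3 * r n" by (simp add: K3_def algebra_simps)
        finally show "(\<Sum>j<p n. \<bar>\<rho>hat n \<omega> j\<bar>) \<le> 3 * K \<and> error_sq n (\<rho>hat n \<omega>) \<le> K3 * r n"
          using l1 by blast
      qed
    qed
  qed
  have "whp (\<lambda>n \<omega>. (\<Sum>j<p n. \<bar>\<rho>hat n \<omega> j\<bar>) \<le> 3 * K)"
    using main by (rule with_prob_approaching_one_mono) simp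
  then show "\<exists>K>0. whp (\<lambda>n \<omega>. (\<Sum>j<p n. \<bar>\<rho>hat n \<omega> j\<bar>) \<le> K)"
    using K by (intro exI[of _ "3 * K"]) auto
  assume "\<kappa> > 0"
  have ev_r: "eventually (\<lambda>n. r n \<le> real n powr \<kappa> * \<epsilon> n) sequentially"
    using \<open>\<kappa> > 0\<close> by (rule r_le_eps)
  have ev_pow: "eventually (\<lambda>n. K3 * (real n powr (2 * \<kappa> / 2) * \<epsilon> n powr 1) \<le> real n powr (2 * \<kappa> - 1 / 2)) sequentially"
    using \<open>\<kappa> > 0\<close> K3 by (intro eps_power_le) auto
  show "whp (\<lambda>n \<omega>.
      L2_norm P (\<lambda>w. \<alpha> (X w) - lin_comb b (p n) (\<rho>hat n \<omega>) (X w)) \<le> real n powr (\<kappa> - 1 / 4))"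
    using main
  proof (rule with_prob_approaching_one_mono)
    show "eventually (\<lambda>n. \<forall>\<omega>\<in>space M.
      (\<Sum>j<p n. \<bar>\<rho>hat n \<omega> j\<bar>) \<le> 3 * K \<and> error_sq n (\<rho>hat n \<omega>) \<le> K3 * r n \<longrightarrow>
      L2_norm P (\<lambda>w. \<alpha> (X w) - lin_comb b (p n) (\<rho>hat n \<omega>) (X w)) \<le> real n powr (\<kappa> - 1 / 4)) sequentially"
      using ev_r ev_pow eventually_ge_at_top[of 1]
    proof eventually_elim
      case (elim n)
      have "K3 * r n \<le> K3 * (real n powr \<kappa> * \<epsilon> n)" using elim K3 by (intro mult_left_mono) auto
      also have "\<dots> \<le> real n powr (2 * \<kappa> - 1 / 2)" using elim eps_pos[OF elim(3)] by simp
      finally show ?case using L2_norm_le_powr[of n _ \<kappa> 1] by fastforce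
    qed
  qed
qed

end

section \<open>Cross-fitted debiased estimation\<close>

text \<open>Little-o in probability relative to the scale \<open>c\<close>. Measurability is built
  in so that exceptional sets of several terms can be united.\<close>

definition negligible_in_prob :: "'o measure \<Rightarrow> (nat \<Rightarrow> 'o \<Rightarrow> real) \<Rightarrow> (nat \<Rightarrow> real) \<Rightarrow> bool" where
  "negligible_in_prob M A c \<longleftrightarrow> (\<forall>n. A n \<in> borel_measurable M) \<and>
    (\<forall>e>0. (\<lambda>n. measure M {\<omega> \<in> space M. \<bar>A n \<omega>\<bar> > e * c n}) \<longlonglongrightarrow> 0)"

lemma (in prob_space) prob_subset_tendsto_0:
  assumes "eventually (\<lambda>n. A n \<subseteq> B n) sequentially" "\<And>n. B n \<in> events" "(\<lambda>n. prob (B n)) \<longlonglongrightarrow> 0"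
  shows "(\<lambda>n. prob (A n)) \<longlonglongrightarrow> 0"
proof (rule real_tendsto_sandwich[of "\<lambda>_. 0" _ _ "\<lambda>n. prob (B n)"])
  show "eventually (\<lambda>n. prob (A n) \<le> prob (B n)) sequentially"
    using assms(1) by eventually_elim (use assms(2) finite_measure_mono in blast)
qed (use assms in auto)

lemma (in prob_space) prob_Un_tendsto_0:
  assumes "\<And>n. A n \<in> events" "\<And>n. B n \<in> events"
    and "(\<lambda>n. prob (A n)) \<longlonglongrightarrow> 0" "(\<lambda>n. prob (B n)) \<longlonglongrightarrow> 0"
  shows "(\<lambda>n. prob (A n \<union> B n)) \<longlonglongrightarrow> 0"
proof (rule real_tendsto_sandwich[of "\<lambda>_. 0" _ _ "\<lambda>n. prob (A n) + prob (B n)"])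
  show "eventually (\<lambda>n. prob (A n \<union> B n) \<le> prob (A n) + prob (B n)) sequentially"
    using assms by (intro always_eventually allI measure_Un_le) auto
  show "(\<lambda>n. prob (A n) + prob (B n)) \<longlonglongrightarrow> 0" using tendsto_add[OF assms(3,4)] by simp
qed auto

lemma negligible_in_prob_add:
  assumes "prob_space M" "negligible_in_prob M A c" "negligible_in_prob M B c"
  shows "negligible_in_prob M (\<lambda>n \<omega>. A n \<omega> + B n \<omega>) c"
proof -
  interpret prob_space M by fact
  have [measurable]: "\<And>n. A n \<in> borel_measurable M" "\<And>n. B n \<in> borel_measurable M"
    and A: "\<And>e. e > 0 \<Longrightarrow> (\<lambda>n. prob {\<omega> \<in> space M. \<bar>A n \<omega>\<bar> > e * c n}) \<longlonglongrightarrow> 0"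
    and B: "\<And>e. e > 0 \<Longrightarrow> (\<lambda>n. prob {\<omega> \<in> space M. \<bar>B n \<omega>\<bar> > e * c n}) \<longlonglongrightarrow> 0"
    using assms by (auto simp: negligible_in_prob_def)
  show ?thesis
    unfolding negligible_in_prob_def
  proof (intro conjI allI impI)
    fix e :: real assume "e > 0"
    then have "e / 2 > 0" by simp
    have "(\<lambda>n. prob ({\<omega> \<in> space M. \<bar>A n \<omega>\<bar> > e / 2 * c n} \<union> {\<omega> \<in> space M. \<bar>B n \<omega>\<bar> > e / 2 * c n})) \<longlonglongrightarrow> 0"
      by (rule prob_Un_tendsto_0[OF _ _ A[OF \<open>e / 2 > 0\<close>] B[OF \<open>e / 2 > 0\<close>]]) auto
    then show "(\<lambda>n. prob {\<omega> \<in> space M. \<bar>A n \<omega> + B n \<omega>\<bar> > e * c n}) \<longlonglongrightarrow> 0"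
      by (rule prob_subset_tendsto_0[rotated 2]) (auto intro!: always_eventually)
  qed measurable
qed

lemma negligible_in_prob_uminus:
  "negligible_in_prob M A c \<Longrightarrow> negligible_in_prob M (\<lambda>n \<omega>. - A n \<omega>) c"
  by (simp add: negligible_in_prob_def)

lemma negligible_in_prob_sum:
  fixes L :: nat
  assumes "prob_space M" "\<And>l. l < L \<Longrightarrow> negligible_in_prob M (A l) c" "\<And>n. c n \<ge> 0"
  shows "negligible_in_prob M (\<lambda>n \<omega>. \<Sum>l<L. A l n \<omega>) c"
  using assms(2)
proof (induction L)
  case 0
  have "\<not> e * c n < 0" if "e > 0" for e n
    using assms(3)[of n] that by (simp add: not_less)
  then show ?case by (simp add: negligible_in_prob_def)
next
  case (Suc L)
  have "negligible_in_prob M (\<lambda>n \<omega>. (\<Sum>l<L. A l n \<omega>) + A L n \<omega>) c"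
    using Suc by (intro negligible_in_prob_add assms(1)) auto
  then show ?case by simp
qed

text \<open>Both rates are pure powers of \<open>n\<close>, valid with probability approaching one:
  constants and logarithms have been absorbed by slightly smaller exponents.
  \<open>m_joint_measurable\<close> is there because the moment is applied to a function that itself
  depends on the training sample.\<close>

locale auto_debiased = iid_sample M P W + dict: bounded_dictionary P N X b Cb
  for M :: "'o measure" and P :: "'w measure" and W :: "nat \<Rightarrow> 'o \<Rightarrow> 'w"
    and N :: "'x measure" and X :: "'w \<Rightarrow> 'x" and b :: "nat \<Rightarrow> 'x \<Rightarrow> real" and Cb :: real +
  fixes m :: "'w \<Rightarrow> ('x \<Rightarrow> real) \<Rightarrow> real" and Y :: "'w \<Rightarrow> real" and \<Gamma> :: "('x \<Rightarrow> real) set"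
    and \<alpha> \<gamma>0 :: "'x \<Rightarrow> real" and p :: "nat \<Rightarrow> nat" and L :: nat and I T :: "nat \<Rightarrow> nat \<Rightarrow> nat set"
    and \<gamma>learn :: "nat \<Rightarrow> nat \<Rightarrow> (nat \<Rightarrow> 'w) \<Rightarrow> 'x \<Rightarrow> real"
    and \<rho>learn :: "nat \<Rightarrow> nat \<Rightarrow> (nat \<Rightarrow> 'w) \<Rightarrow> nat \<Rightarrow> real"
    and Cm Ca Cv :: real and a g :: real
  assumes Y_measurable [measurable]: "Y \<in> borel_measurable P" and Y_square: "integrable P (\<lambda>w. (Y w)\<^sup>2)"
    and m_diff: "\<And>w u v. m w (\<lambda>x. u x - v x) = m w u - m w v"
    and m_measurable: "\<And>u. u \<in> borel_measurable N \<Longrightarrow> (\<lambda>w. m w u) \<in> borel_measurable P"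
    and m_joint_measurable: "\<And>(T' :: nat set) h. (\<lambda>(d, x). h d x) \<in> borel_measurable (PiM T' (\<lambda>_. P) \<Otimes>\<^sub>M N) \<Longrightarrow>
      (\<lambda>(d, w). m w (h d)) \<in> borel_measurable (PiM T' (\<lambda>_. P) \<Otimes>\<^sub>M P)"
    and m_square: "\<And>u. u \<in> L2_functions P N X \<Longrightarrow> integrable P (\<lambda>w. (m w u)\<^sup>2)"
      "\<And>u. u \<in> L2_functions P N X \<Longrightarrow> (\<integral>w. (m w u)\<^sup>2 \<partial>P) \<le> Cm * (\<integral>w. (u (X w))\<^sup>2 \<partial>P)" and Cm_nonneg: "Cm \<ge> 0"
    and m_riesz: "\<And>u. u \<in> \<Gamma> \<Longrightarrow> (\<integral>w. m w u \<partial>P) = (\<integral>w. \<alpha> (X w) * u (X w) \<partial>P)"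
    and \<Gamma>_L2: "\<Gamma> \<subseteq> L2_functions P N X" and \<Gamma>_diff: "\<And>u v. u \<in> \<Gamma> \<Longrightarrow> v \<in> \<Gamma> \<Longrightarrow> (\<lambda>x. u x - v x) \<in> \<Gamma>"
    and \<Gamma>_lin_comb: "\<And>q \<rho>. lin_comb b q \<rho> \<in> \<Gamma>" and \<alpha>_\<Gamma>: "\<alpha> \<in> \<Gamma>" and \<gamma>0_\<Gamma>: "\<gamma>0 \<in> \<Gamma>"
    and \<alpha>_bounded: "AE w in P. \<bar>\<alpha> (X w)\<bar> \<le> Ca"
    and residual_orthogonal: "\<And>u. u \<in> \<Gamma> \<Longrightarrow> (\<integral>w. (Y w - \<gamma>0 (X w)) * u (X w) \<partial>P) = 0"
    and residual_variance: "\<And>u K. u \<in> borel_measurable N \<Longrightarrow> AE w in P. \<bar>u (X w)\<bar> \<le> K \<Longrightarrow>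
      (\<integral>w. (u (X w))\<^sup>2 * (Y w - \<gamma>0 (X w))\<^sup>2 \<partial>P) \<le> Cv * (\<integral>w. (u (X w))\<^sup>2 \<partial>P)" and Cv_nonneg: "Cv \<ge> 0"
    and folds: "\<And>n. (\<Union>l<L. I n l) = {..<n}" "\<And>n. disjoint_family_on (I n) {..<L}"
    and T_eq: "T = (\<lambda>n l. {..<n} - I n l)"
    and \<gamma>learn_measurable: "\<And>n l. l < L \<Longrightarrow>
      (\<lambda>(d, x). \<gamma>learn n l d x) \<in> borel_measurable (PiM (T n l) (\<lambda>_. P) \<Otimes>\<^sub>M N)"
    and \<rho>learn_measurable: "\<And>n l j. l < L \<Longrightarrow> j < p n \<Longrightarrow>
      (\<lambda>d. \<rho>learn n l d j) \<in> borel_measurable (PiM (T n l) (\<lambda>_. P))"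
    and ag: "a > 0" "g > 0" "a + g > 1 / 2"
    and \<gamma>_rate: "\<And>l. l < L \<Longrightarrow> with_prob_approaching_one M (\<lambda>n \<omega>. \<gamma>learn n l (sample (T n l) \<omega>) \<in> \<Gamma> \<and>
      L2_norm P (\<lambda>w. \<gamma>learn n l (sample (T n l) \<omega>) (X w) - \<gamma>0 (X w)) \<le> real n powr (- g))"
    and \<alpha>_rate: "\<And>l. l < L \<Longrightarrow> with_prob_approaching_one M (\<lambda>n \<omega>.
      L2_norm P (\<lambda>w. \<alpha> (X w) - lin_comb b (p n) (\<rho>learn n l (sample (T n l) \<omega>)) (X w)) \<le> real n powr (- a))"
begin

definition \<theta>0 :: real where "\<theta>0 = (\<integral>w. m w \<gamma>0 \<partial>P)"

definition \<psi> :: "'w \<Rightarrow> real" where "\<psi> w = m w \<gamma>0 - \<theta>0 + \<alpha> (X w) * (Y w - \<gamma>0 (X w))"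

abbreviation PT :: "nat \<Rightarrow> nat \<Rightarrow> (nat \<Rightarrow> 'w) measure" where
  "PT n l \<equiv> PiM (T n l) (\<lambda>_. P)"

abbreviation train :: "nat \<Rightarrow> nat \<Rightarrow> 'o \<Rightarrow> nat \<Rightarrow> 'w" where
  "train n l \<omega> \<equiv> sample (T n l) \<omega>"

abbreviation \<alpha>learn :: "nat \<Rightarrow> nat \<Rightarrow> (nat \<Rightarrow> 'w) \<Rightarrow> 'x \<Rightarrow> real" where
  "\<alpha>learn n l d \<equiv> lin_comb b (p n) (\<rho>learn n l d)"

abbreviation \<delta> :: "nat \<Rightarrow> nat \<Rightarrow> (nat \<Rightarrow> 'w) \<Rightarrow> 'x \<Rightarrow> real" where
  "\<delta> n l d \<equiv> \<lambda>x. \<gamma>learn n l d x - \<gamma>0 x"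

abbreviation \<eta> :: "nat \<Rightarrow> nat \<Rightarrow> (nat \<Rightarrow> 'w) \<Rightarrow> 'x \<Rightarrow> real" where
  "\<eta> n l d \<equiv> \<lambda>x. \<alpha>learn n l d x - \<alpha> x"

definition summand :: "nat \<Rightarrow> nat \<Rightarrow> (nat \<Rightarrow> 'w) \<Rightarrow> 'w \<Rightarrow> real" where
  "summand n l d w = m w (\<gamma>learn n l d) + \<alpha>learn n l d (X w) * (Y w - \<gamma>learn n l d (X w))"

definition remainder :: "nat \<Rightarrow> nat \<Rightarrow> (nat \<Rightarrow> 'w) \<Rightarrow> 'w \<Rightarrow> real" where
  "remainder n l d w = summand n l d w - \<theta>0 - \<psi> w"

lemma remainder_eq:
  "remainder n l d w = (m w (\<delta> n l d) - \<alpha> (X w) * \<delta> n l d (X w))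
    + \<eta> n l d (X w) * (Y w - \<gamma>0 (X w)) - \<eta> n l d (X w) * \<delta> n l d (X w)"
  unfolding remainder_def summand_def \<psi>_def m_diff by (simp add: algebra_simps)

lemma in_L2: "u \<in> \<Gamma> \<Longrightarrow> u \<in> borel_measurable N" "u \<in> \<Gamma> \<Longrightarrow> integrable P (\<lambda>w. (u (X w))\<^sup>2)"
  using \<Gamma>_L2 by (auto simp: L2_functions_def)

lemma \<alpha>_measurable [measurable]: "\<alpha> \<in> borel_measurable N"
  by (rule in_L2[OF \<alpha>_\<Gamma>])

lemma \<gamma>0_measurable [measurable]: "\<gamma>0 \<in> borel_measurable N"
  by (rule in_L2[OF \<gamma>0_\<Gamma>])

lemma residual_square: "integrable P (\<lambda>w. (Y w - \<gamma>0 (X w))\<^sup>2)"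
  by (rule integrable_add_square(2)) (use Y_square in_L2(2)[OF \<gamma>0_\<Gamma>] in auto)

lemma integrable_bounded_mult_square:
  fixes u :: "'x \<Rightarrow> real" and f :: "'w \<Rightarrow> real"
  assumes u [measurable]: "u \<in> borel_measurable N" and bnd: "AE w in P. \<bar>u (X w)\<bar> \<le> K"
    and [measurable]: "f \<in> borel_measurable P" and f: "integrable P (\<lambda>w. (f w)\<^sup>2)"
  shows "integrable P (\<lambda>w. (u (X w) * f w)\<^sup>2)"
    and "(\<integral>w. (u (X w) * f w)\<^sup>2 \<partial>P) \<le> K\<^sup>2 * (\<integral>w. (f w)\<^sup>2 \<partial>P)"
proof -
  have le: "AE w in P. (u (X w) * f w)\<^sup>2 \<le> K\<^sup>2 * (f w)\<^sup>2"
    using bnd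
  proof eventually_elim
    case (elim w)
    have "\<bar>u (X w)\<bar>\<^sup>2 \<le> K\<^sup>2" using elim by (rule power_mono) simp
    then show ?case by (simp add: power_mult_distrib mult_right_mono)
  qed
  show int: "integrable P (\<lambda>w. (u (X w) * f w)\<^sup>2)"
    by (rule Bochner_Integration.integrable_bound[of P "\<lambda>w. K\<^sup>2 * (f w)\<^sup>2"])
      (use le f in \<open>auto elim: eventually_mono\<close>)
  have "(\<integral>w. (u (X w) * f w)\<^sup>2 \<partial>P) \<le> (\<integral>w. K\<^sup>2 * (f w)\<^sup>2 \<partial>P)"
    using int f le by (intro integral_mono_AE) auto
  then show "(\<integral>w. (u (X w) * f w)\<^sup>2 \<partial>P) \<le> K\<^sup>2 * (\<integral>w. (f w)\<^sup>2 \<partial>P)" by simp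
qed

lemma \<psi>_measurable [measurable]: "\<psi> \<in> borel_measurable P"
proof -
  note [measurable] = m_measurable[OF \<gamma>0_measurable]
  show ?thesis unfolding \<psi>_def by measurable
qed

lemma \<psi>_square: "integrable P (\<lambda>w. (\<psi> w)\<^sup>2)"
proof -
  note [measurable] = m_measurable[OF \<gamma>0_measurable]
  have m2: "integrable P (\<lambda>w. (m w \<gamma>0 - \<theta>0)\<^sup>2)"
    using m_square(1) \<gamma>0_\<Gamma> \<Gamma>_L2 by (intro integrable_add_square(2)) auto
  show ?thesis
    unfolding \<psi>_def using m2 integrable_bounded_mult_square(1)[OF \<alpha>_measurable \<alpha>_bounded _ residual_square]
    by (intro integrable_add_square(1)) auto
qed

lemma \<psi>_mean: "(\<integral>w. \<psi> w \<partial>P) = 0"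
proof -
  note [measurable] = m_measurable[OF \<gamma>0_measurable]
  have m1: "integrable P (\<lambda>w. m w \<gamma>0)"
    by (rule P.square_integrable_imp_integrable) (use m_square(1) \<gamma>0_\<Gamma> \<Gamma>_L2 in auto)
  have "integrable P (\<lambda>w. \<alpha> (X w) * (Y w - \<gamma>0 (X w)))"
    by (rule integrable_mult_L2) (use in_L2(2)[OF \<alpha>_\<Gamma>] residual_square in auto)
  then show ?thesis
    unfolding \<psi>_def using m1 residual_orthogonal[OF \<alpha>_\<Gamma>] by (simp add: \<theta>0_def P.prob_space mult.commute)
qed

subsection \<open>Measurability of the learners\<close>

lemma \<gamma>learn_X_measurable:
  assumes "l < L"
  shows "(\<lambda>(d, w). \<gamma>learn n l d (X w)) \<in> borel_measurable (PT n l \<Otimes>\<^sub>M P)"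
proof -
  have "(\<lambda>x. (fst x, X (snd x))) \<in> measurable (PT n l \<Otimes>\<^sub>M P) (PT n l \<Otimes>\<^sub>M N)"
    by measurable
  from measurable_compose[OF this \<gamma>learn_measurable[OF assms]] show ?thesis by (simp add: split_beta')
qed

lemma \<alpha>learn_X_measurable:
  assumes "l < L"
  shows "(\<lambda>(d, w). \<alpha>learn n l d (X w)) \<in> borel_measurable (PT n l \<Otimes>\<^sub>M P)"
  unfolding lin_comb_def split_beta'
proof (rule borel_measurable_sum)
  fix j assume "j \<in> {..<p n}"
  then have [measurable]: "(\<lambda>d. \<rho>learn n l d j) \<in> borel_measurable (PT n l)"
    using \<rho>learn_measurable[OF assms] by simp
  show "(\<lambda>x. b j (X (snd x)) * \<rho>learn n l (fst x) j) \<in> borel_measurable (PT n l \<Otimes>\<^sub>M P)"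
    by measurable
qed

lemma m_\<delta>_measurable:
  assumes "l < L"
  shows "(\<lambda>(d, w). m w (\<delta> n l d)) \<in> borel_measurable (PT n l \<Otimes>\<^sub>M P)"
proof (rule m_joint_measurable)
  show "(\<lambda>(d, x). \<delta> n l d x) \<in> borel_measurable (PT n l \<Otimes>\<^sub>M N)"
    using \<gamma>learn_measurable[OF assms, of n] by (simp add: split_beta')
qed

lemma remainder_measurable:
  assumes "l < L"
  shows "(\<lambda>(d, w). remainder n l d w) \<in> borel_measurable (PT n l \<Otimes>\<^sub>M P)"
  unfolding remainder_eq
  using m_\<delta>_measurable[OF assms, of n] \<gamma>learn_X_measurable[OF assms, of n] \<alpha>learn_X_measurable[OF assms, of n]
  by (simp add: split_beta')

lemma summand_measurable:
  assumes "l < L"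
  shows "(\<lambda>(d, w). summand n l d w) \<in> borel_measurable (PT n l \<Otimes>\<^sub>M P)"
proof -
  have "summand n l d w = remainder n l d w + \<theta>0 + \<psi> w" for d w by (simp add: remainder_def)
  then show ?thesis using remainder_measurable[OF assms, of n] by (simp add: split_beta')
qed

subsection \<open>The remainder\<close>

lemma fold_facts:
  assumes "l < L"
  shows "T n l \<inter> I n l = {}" "finite (I n l)" "card (I n l) \<le> n" "I n l \<subseteq> {..<n}"
proof -
  show sub: "I n l \<subseteq> {..<n}" using folds(1)[of n] assms by auto
  then show "finite (I n l)" using finite_subset by blast
  show "card (I n l) \<le> n" using card_mono[OF _ sub] by simp
qed (auto simp: T_eq)

text \<open>The bound \<open>K\<close> may depend on \<open>n\<close> and on the training sample; it
  secures integrability, and no estimate depends on its value.\<close>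

lemma \<eta>_facts:
  shows "\<eta> n l d \<in> \<Gamma>" "\<exists>K. AE w in P. \<bar>\<eta> n l d (X w)\<bar> \<le> K"
proof -
  show "\<eta> n l d \<in> \<Gamma>" by (rule \<Gamma>_diff[OF \<Gamma>_lin_comb \<alpha>_\<Gamma>])
  have "AE w in P. \<bar>\<eta> n l d (X w)\<bar> \<le> Cb * (\<Sum>j<p n. \<bar>\<rho>learn n l d j\<bar>) + Ca"
    using dict.AE_lin_comb_le[of "p n" "\<rho>learn n l d"] \<alpha>_bounded by eventually_elim linarith
  then show "\<exists>K. AE w in P. \<bar>\<eta> n l d (X w)\<bar> \<le> K" by blast
qed

text \<open>\<open>\<eta>\<close> lies in \<open>\<Gamma>\<close>, hence is orthogonal to the
  residual of the projection \<open>\<gamma>0\<close>. The conditional variance bound compares the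
  second moment with that of \<open>\<eta>\<close> instead of with its supremum, which need not be
  small.\<close>

lemma \<eta>_residual:
  shows "integrable P (\<lambda>w. (\<eta> n l d (X w) * (Y w - \<gamma>0 (X w)))\<^sup>2)"
    and "(\<integral>w. (\<eta> n l d (X w) * (Y w - \<gamma>0 (X w)))\<^sup>2 \<partial>P) \<le> Cv * (\<integral>w. (\<eta> n l d (X w))\<^sup>2 \<partial>P)"
    and "(\<integral>w. \<eta> n l d (X w) * (Y w - \<gamma>0 (X w)) \<partial>P) = 0"
proof -
  obtain K where K: "AE w in P. \<bar>\<eta> n l d (X w)\<bar> \<le> K" using \<eta>_facts(2) by blast
  have [measurable]: "\<eta> n l d \<in> borel_measurable N" by (rule in_L2[OF \<eta>_facts(1)])
  show "integrable P (\<lambda>w. (\<eta> n l d (X w) * (Y w - \<gamma>0 (X w)))\<^sup>2)"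
    by (rule integrable_bounded_mult_square(1)[OF _ K _ residual_square]) auto
  show "(\<integral>w. (\<eta> n l d (X w) * (Y w - \<gamma>0 (X w)))\<^sup>2 \<partial>P) \<le> Cv * (\<integral>w. (\<eta> n l d (X w))\<^sup>2 \<partial>P)"
    using residual_variance[OF _ K] by (simp add: power_mult_distrib)
  show "(\<integral>w. \<eta> n l d (X w) * (Y w - \<gamma>0 (X w)) \<partial>P) = 0"
    using residual_orthogonal[OF \<eta>_facts(1)] by (simp add: mult.commute)
qed

lemma \<eta>_norm: "(\<integral>w. (\<eta> n l d (X w))\<^sup>2 \<partial>P) = (L2_norm P (\<lambda>w. \<alpha> (X w) - \<alpha>learn n l d (X w)))\<^sup>2"
  by (simp add: L2_norm_square power2_commute)

text \<open>Mean zero holds because \<open>\<alpha>\<close> represents \<open>m\<close> on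
  \<open>\<Gamma>\<close>, which contains the error \<open>\<delta>\<close>. Given the training
  sample the sum then has standard deviation of order \<open>sqrt n\<close> times the norm of
  \<open>\<delta>\<close>, so any positive exponent \<open>g\<close> is enough here.\<close>

lemma negligible_moment:
  assumes "l < L"
  shows "negligible_in_prob M (\<lambda>n \<omega>. \<Sum>i\<in>I n l. m (W i \<omega>) (\<delta> n l (train n l \<omega>))
    - \<alpha> (X (W i \<omega>)) * \<delta> n l (train n l \<omega>) (X (W i \<omega>))) (\<lambda>n. sqrt (real n))"
proof -
  let ?g = "\<lambda>n d w. m w (\<delta> n l d) - \<alpha> (X w) * \<delta> n l d (X w)"
  have meas: "(\<lambda>(d, w). ?g n d w) \<in> borel_measurable (PT n l \<Otimes>\<^sub>M P)" for n
    using m_\<delta>_measurable[OF assms, of n] \<gamma>learn_X_measurable[OF assms, of n] by (simp add: split_beta')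
  have whp: "whp (\<lambda>n \<omega>. integrable P (\<lambda>w. (?g n (train n l \<omega>) w)\<^sup>2) \<and>
      (\<integral>w. ?g n (train n l \<omega>) w \<partial>P) = 0 \<and>
      (\<integral>w. (?g n (train n l \<omega>) w)\<^sup>2 \<partial>P) \<le> 2 * (Cm + Ca\<^sup>2) * real n powr (- 2 * g))"
    using \<gamma>_rate[OF assms]
  proof (rule with_prob_approaching_one_mono, intro always_eventually allI ballI impI)
    fix n \<omega>
    let ?d = "train n l \<omega>"
    assume H: "\<gamma>learn n l ?d \<in> \<Gamma> \<and> L2_norm P (\<lambda>w. \<delta> n l ?d (X w)) \<le> real n powr (- g)"
    then have D: "\<delta> n l ?d \<in> \<Gamma>" using \<Gamma>_diff \<gamma>0_\<Gamma> by blast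
    then have DL: "\<delta> n l ?d \<in> L2_functions P N X" using \<Gamma>_L2 by blast
    have [measurable]: "\<delta> n l ?d \<in> borel_measurable N" and d2: "integrable P (\<lambda>w. (\<delta> n l ?d (X w))\<^sup>2)"
      using in_L2[OF D] by auto
    note [measurable] = m_measurable[OF \<open>\<delta> n l ?d \<in> borel_measurable N\<close>]
    note \<alpha>\<delta> = integrable_bounded_mult_square[OF \<alpha>_measurable \<alpha>_bounded _ d2]
    have sq: "(\<integral>w. (\<delta> n l ?d (X w))\<^sup>2 \<partial>P) \<le> real n powr (- 2 * g)"
    proof -
      have "(L2_norm P (\<lambda>w. \<delta> n l ?d (X w)))\<^sup>2 \<le> (real n powr (- g))\<^sup>2"
        using H L2_norm_nonneg by (intro power_mono) auto
      then show ?thesis by (simp add: L2_norm_square power2_eq_square[of "_ powr _"] powr_add[symmetric])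
    qed
    have int_g: "integrable P (\<lambda>w. (?g n ?d w)\<^sup>2)"
      using m_square(1)[OF DL] \<alpha>\<delta>(1) by (intro integrable_add_square(2)) auto
    have int1: "integrable P (\<lambda>w. m w (\<delta> n l ?d))" "integrable P (\<lambda>w. \<alpha> (X w) * \<delta> n l ?d (X w))"
      using m_square(1)[OF DL] \<alpha>\<delta>(1) by (auto intro: P.square_integrable_imp_integrable)
    have mean: "(\<integral>w. ?g n ?d w \<partial>P) = 0" using int1 m_riesz[OF D] by simp
    have "(\<integral>w. (?g n ?d w)\<^sup>2 \<partial>P) \<le> (\<integral>w. 2 * (m w (\<delta> n l ?d))\<^sup>2 + 2 * (\<alpha> (X w) * \<delta> n l ?d (X w))\<^sup>2 \<partial>P)"
    proof (rule integral_mono)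
      have "(u - v)\<^sup>2 \<le> 2 * u\<^sup>2 + 2 * v\<^sup>2" for u v :: real
        using sum_squares_bound[of "-u" v] by (simp add: power2_diff)
      then show "(?g n ?d w)\<^sup>2 \<le> 2 * (m w (\<delta> n l ?d))\<^sup>2 + 2 * (\<alpha> (X w) * \<delta> n l ?d (X w))\<^sup>2" for w .
    qed (use int_g m_square(1)[OF DL] \<alpha>\<delta>(1) in auto)
    also have "\<dots> = 2 * (\<integral>w. (m w (\<delta> n l ?d))\<^sup>2 \<partial>P) + 2 * (\<integral>w. (\<alpha> (X w) * \<delta> n l ?d (X w))\<^sup>2 \<partial>P)"
      using m_square(1)[OF DL] \<alpha>\<delta>(1) by simp
    also have "\<dots> \<le> 2 * (Cm * (\<integral>w. (\<delta> n l ?d (X w))\<^sup>2 \<partial>P)) + 2 * (Ca\<^sup>2 * (\<integral>w. (\<delta> n l ?d (X w))\<^sup>2 \<partial>P))"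
      using m_square(2)[OF DL] \<alpha>\<delta>(2) by simp
    also have "\<dots> = 2 * (Cm + Ca\<^sup>2) * (\<integral>w. (\<delta> n l ?d (X w))\<^sup>2 \<partial>P)" by (simp add: algebra_simps)
    also have "\<dots> \<le> 2 * (Cm + Ca\<^sup>2) * real n powr (- 2 * g)"
      using sq Cm_nonneg by (intro mult_left_mono) auto
    finally show "integrable P (\<lambda>w. (?g n ?d w)\<^sup>2) \<and> (\<integral>w. ?g n ?d w \<partial>P) = 0 \<and>
      (\<integral>w. (?g n ?d w)\<^sup>2 \<partial>P) \<le> 2 * (Cm + Ca\<^sup>2) * real n powr (- 2 * g)"
      using int_g mean by blast
  qed
  have lim: "(\<lambda>n. 2 * (Cm + Ca\<^sup>2) * real n powr (- 2 * g)) \<longlonglongrightarrow> 0"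
    by (rule tendsto_mult_right_zero) (use ag in real_asymp)
  show ?thesis
    unfolding negligible_in_prob_def
    using crossfit_sum_measurable[OF meas]
      crossfit_sum_L2[of ?g "\<lambda>n. T n l" "\<lambda>n. I n l", OF meas fold_facts(1-3)[OF assms] whp lim]
    by blast
qed

lemma negligible_residual:
  assumes "l < L"
  shows "negligible_in_prob M (\<lambda>n \<omega>. \<Sum>i\<in>I n l. \<eta> n l (train n l \<omega>) (X (W i \<omega>))
    * (Y (W i \<omega>) - \<gamma>0 (X (W i \<omega>)))) (\<lambda>n. sqrt (real n))"
proof -
  let ?g = "\<lambda>n d w. \<eta> n l d (X w) * (Y w - \<gamma>0 (X w))"
  have meas: "(\<lambda>(d, w). ?g n d w) \<in> borel_measurable (PT n l \<Otimes>\<^sub>M P)" for n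
    using \<alpha>learn_X_measurable[OF assms, of n] by (simp add: split_beta')
  have whp: "whp (\<lambda>n \<omega>. integrable P (\<lambda>w. (?g n (train n l \<omega>) w)\<^sup>2) \<and>
      (\<integral>w. ?g n (train n l \<omega>) w \<partial>P) = 0 \<and>
      (\<integral>w. (?g n (train n l \<omega>) w)\<^sup>2 \<partial>P) \<le> Cv * real n powr (- 2 * a))"
    using \<alpha>_rate[OF assms]
  proof (rule with_prob_approaching_one_mono, intro always_eventually allI ballI impI)
    fix n \<omega>
    let ?d = "train n l \<omega>"
    assume "L2_norm P (\<lambda>w. \<alpha> (X w) - \<alpha>learn n l ?d (X w)) \<le> real n powr (- a)"
    then have "(\<integral>w. (\<eta> n l ?d (X w))\<^sup>2 \<partial>P) \<le> (real n powr (- a))\<^sup>2"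
      unfolding \<eta>_norm using L2_norm_nonneg by (intro power_mono) auto
    then have "Cv * (\<integral>w. (\<eta> n l ?d (X w))\<^sup>2 \<partial>P) \<le> Cv * real n powr (- 2 * a)"
      using Cv_nonneg by (intro mult_left_mono) (auto simp: power2_eq_square[of "_ powr _"] powr_add[symmetric])
    then show "integrable P (\<lambda>w. (?g n ?d w)\<^sup>2) \<and> (\<integral>w. ?g n ?d w \<partial>P) = 0 \<and>
      (\<integral>w. (?g n ?d w)\<^sup>2 \<partial>P) \<le> Cv * real n powr (- 2 * a)"
      using \<eta>_residual[of n l ?d] by auto
  qed
  have lim: "(\<lambda>n. Cv * real n powr (- 2 * a)) \<longlonglongrightarrow> 0"
    by (rule tendsto_mult_right_zero) (use ag in real_asymp)
  show ?thesis
    unfolding negligible_in_prob_def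
    using crossfit_sum_measurable[OF meas]
      crossfit_sum_L2[of ?g "\<lambda>n. T n l" "\<lambda>n. I n l", OF meas fold_facts(1-3)[OF assms] whp lim]
    by blast
qed

text \<open>This is the one term without conditional mean zero, so it is bounded in absolute value
  by Cauchy-Schwarz. Its order is \<open>n\<close> to the power \<open>1 - a - g\<close> against
  \<open>sqrt n\<close>, which is where \<open>a + g > 1 / 2\<close> enters.\<close>

lemma negligible_product:
  assumes "l < L"
  shows "negligible_in_prob M (\<lambda>n \<omega>. \<Sum>i\<in>I n l. \<eta> n l (train n l \<omega>) (X (W i \<omega>))
    * \<delta> n l (train n l \<omega>) (X (W i \<omega>))) (\<lambda>n. sqrt (real n))"
proof -
  let ?g = "\<lambda>n d w. \<eta> n l d (X w) * \<delta> n l d (X w)"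
  have meas: "(\<lambda>(d, w). ?g n d w) \<in> borel_measurable (PT n l \<Otimes>\<^sub>M P)" for n
    using \<alpha>learn_X_measurable[OF assms, of n] \<gamma>learn_X_measurable[OF assms, of n] by (simp add: split_beta')
  have whp: "whp (\<lambda>n \<omega>. integrable P (?g n (train n l \<omega>)) \<and>
      (\<integral>w. \<bar>?g n (train n l \<omega>) w\<bar> \<partial>P) \<le> real n powr (- a) * real n powr (- g))"
    using with_prob_approaching_one_conj[OF M.prob_space_axioms \<alpha>_rate[OF assms] \<gamma>_rate[OF assms]]
  proof (rule with_prob_approaching_one_mono, intro always_eventually allI ballI impI)
    fix n \<omega>
    let ?d = "train n l \<omega>"
    assume H: "L2_norm P (\<lambda>w. \<alpha> (X w) - \<alpha>learn n l ?d (X w)) \<le> real n powr (- a) \<and>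
      \<gamma>learn n l ?d \<in> \<Gamma> \<and> L2_norm P (\<lambda>w. \<delta> n l ?d (X w)) \<le> real n powr (- g)"
    then have D: "\<delta> n l ?d \<in> \<Gamma>" using \<Gamma>_diff \<gamma>0_\<Gamma> by blast
    have [measurable]: "\<delta> n l ?d \<in> borel_measurable N" "\<eta> n l ?d \<in> borel_measurable N"
      using in_L2(1)[OF D] in_L2(1)[OF \<eta>_facts(1)] by auto
    have L2: "integrable P (\<lambda>w. (\<eta> n l ?d (X w))\<^sup>2)" "integrable P (\<lambda>w. (\<delta> n l ?d (X w))\<^sup>2)"
      using in_L2(2)[OF D] in_L2(2)[OF \<eta>_facts(1)] by auto
    have "(\<integral>w. \<bar>?g n ?d w\<bar> \<partial>P)
        \<le> sqrt (\<integral>w. (\<eta> n l ?d (X w))\<^sup>2 \<partial>P) * sqrt (\<integral>w. (\<delta> n l ?d (X w))\<^sup>2 \<partial>P)"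
      by (rule Cauchy_Schwarz_integral) (use L2 in auto)
    also have "\<dots> = L2_norm P (\<lambda>w. \<alpha> (X w) - \<alpha>learn n l ?d (X w)) * L2_norm P (\<lambda>w. \<delta> n l ?d (X w))"
      unfolding \<eta>_norm by (simp add: L2_norm_nonneg L2_norm_def[of P "\<lambda>w. \<delta> n l ?d (X w)"])
    also have "\<dots> \<le> real n powr (- a) * real n powr (- g)"
      using H L2_norm_nonneg by (intro mult_mono) auto
    finally show "integrable P (?g n ?d) \<and> (\<integral>w. \<bar>?g n ?d w\<bar> \<partial>P) \<le> real n powr (- a) * real n powr (- g)"
      using integrable_mult_L2[OF _ _ L2] by auto
  qed
  have lim: "(\<lambda>n. real n * (real n powr (- a) * real n powr (- g)) / (e * sqrt (real n))) \<longlonglongrightarrow> 0"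
    if "e > 0" for e
  proof (rule Lim_transform_eventually)
    show "(\<lambda>n. 1 / e * real n powr (1 / 2 - (a + g))) \<longlonglongrightarrow> 0"
      by (rule tendsto_mult_right_zero) (use ag in real_asymp)
    show "eventually (\<lambda>n. 1 / e * real n powr (1 / 2 - (a + g))
        = real n * (real n powr (- a) * real n powr (- g)) / (e * sqrt (real n))) sequentially"
      using eventually_ge_at_top[of 1]
    proof eventually_elim
      case (elim n)
      have "real n powr (1 / 2 - (a + g)) * real n powr (1 / 2) = real n powr 1 * (real n powr (- a) * real n powr (- g))"
        by (simp only: powr_add[symmetric]) simp
      then have "real n powr (1 / 2 - (a + g)) * sqrt (real n) = real n * (real n powr (- a) * real n powr (- g))"
        using elim by (simp add: powr_half_sqrt)
      moreover have "sqrt (real n) > 0" using elim by simp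
      ultimately show ?case using that by (simp add: field_simps)
    qed
  qed
  have "(\<lambda>n. M.prob {\<omega> \<in> space M. \<bar>\<Sum>i\<in>I n l. ?g n (train n l \<omega>) (W i \<omega>)\<bar> > e * sqrt (real n)}) \<longlonglongrightarrow> 0"
    if "e > 0" for e
    by (rule crossfit_sum_L1[of ?g "\<lambda>n. T n l" "\<lambda>n. I n l", OF meas fold_facts(1-3)[OF assms] whp lim[OF that]])
      (use that in auto)
  then show ?thesis
    unfolding negligible_in_prob_def using crossfit_sum_measurable[OF meas] by blast
qed

lemma negligible_remainder:
  assumes "l < L"
  shows "negligible_in_prob M (\<lambda>n \<omega>. \<Sum>i\<in>I n l. remainder n l (train n l \<omega>) (W i \<omega>)) (\<lambda>n. sqrt (real n))"
  using negligible_in_prob_add[OF M.prob_space_axioms negligible_in_prob_add[OF M.prob_space_axioms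
      negligible_moment[OF assms] negligible_residual[OF assms]]
      negligible_in_prob_uminus[OF negligible_product[OF assms]]]
  by (simp add: remainder_eq sum.distrib sum_subtractf)

subsection \<open>Asymptotic normality\<close>

definition estimator :: "nat \<Rightarrow> 'o \<Rightarrow> real" where
  "estimator n \<omega> = theta_hat m X Y n L (I n) (\<lambda>l. \<gamma>learn n l (train n l \<omega>))
    (\<lambda>l. \<alpha>learn n l (train n l \<omega>)) (\<lambda>i. W i \<omega>)"

definition variance_estimator :: "nat \<Rightarrow> 'o \<Rightarrow> real" where
  "variance_estimator n \<omega> = V_hat m X Y n L (I n) (\<lambda>l. \<gamma>learn n l (train n l \<omega>))
    (\<lambda>l. \<alpha>learn n l (train n l \<omega>)) (\<lambda>i. W i \<omega>)"

lemma sum_folds: "(\<Sum>l<L. \<Sum>i\<in>I n l. h i) = (\<Sum>i<n. h i)" for h :: "nat \<Rightarrow> real"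
proof -
  have "(\<Sum>i\<in>(\<Union>l\<in>{..<L}. I n l). h i) = (\<Sum>l\<in>{..<L}. \<Sum>i\<in>I n l. h i)"
    using fold_facts(2) folds(2)[of n] by (intro sum.UNION_disjoint) (auto simp: disjoint_family_on_def)
  then show ?thesis using folds(1)[of n] by simp
qed

text \<open>\<open>\<psi>\<close> involves no learner, so its fold sums combine to a sum over the
  full sample, to which the classical limit theorems apply; only the remainder retains the fold
  structure.\<close>

lemma estimator_eq:
  assumes "n \<ge> 1"
  shows "real n * (estimator n \<omega> - \<theta>0)
    = (\<Sum>i<n. \<psi> (W i \<omega>)) + (\<Sum>l<L. \<Sum>i\<in>I n l. remainder n l (train n l \<omega>) (W i \<omega>))"
proof -
  have sc: "summand n l d w = \<psi> w + remainder n l d w + \<theta>0" for l d w by (simp add: remainder_def)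
  have "real n * estimator n \<omega> = (\<Sum>l<L. \<Sum>i\<in>I n l. summand n l (train n l \<omega>) (W i \<omega>))"
    using assms by (simp add: estimator_def theta_hat_def summand_def)
  also have "\<dots> = (\<Sum>l<L. \<Sum>i\<in>I n l. \<psi> (W i \<omega>))
      + (\<Sum>l<L. \<Sum>i\<in>I n l. remainder n l (train n l \<omega>) (W i \<omega>)) + (\<Sum>l<L. \<Sum>i\<in>I n l. \<theta>0)"
    unfolding sc by (simp only: sum.distrib)
  also have "(\<Sum>l<L. \<Sum>i\<in>I n l. \<theta>0) = real n * \<theta>0" unfolding sum_folds by simp
  finally show ?thesis unfolding sum_folds right_diff_distrib by linarith
qed

lemma estimator_measurable [measurable]: "estimator n \<in> borel_measurable M"
proof -
  have "estimator n = (\<lambda>\<omega>. (\<Sum>l<L. \<Sum>i\<in>I n l. summand n l (train n l \<omega>) (W i \<omega>)) / real n)"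
    by (rule ext) (simp add: estimator_def theta_hat_def summand_def)
  also have "\<dots> \<in> borel_measurable M"
    by (intro borel_measurable_divide borel_measurable_sum[of "{..<L}"]
        crossfit_sum_measurable[OF summand_measurable] borel_measurable_const) simp
  finally show ?thesis .
qed

lemma negligible_total_remainder:
  "negligible_in_prob M (\<lambda>n \<omega>. \<Sum>l<L. \<Sum>i\<in>I n l. remainder n l (train n l \<omega>) (W i \<omega>)) (\<lambda>n. sqrt (real n))"
  using negligible_remainder by (intro negligible_in_prob_sum M.prob_space_axioms) auto

theorem asymptotic_normality:
  "weak_conv_m (\<lambda>n. distr M borel (\<lambda>\<omega>. sqrt (real n) * (estimator n \<omega> - \<theta>0)))
    (normal_law 0 (\<integral>w. (\<psi> w)\<^sup>2 \<partial>P))"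
proof (rule M.slutsky[where X = "\<lambda>n \<omega>. (\<Sum>i<n. \<psi> (W i \<omega>)) / sqrt (real n)"])
  show "weak_conv_m (\<lambda>n. distr M borel (\<lambda>\<omega>. (\<Sum>i<n. \<psi> (W i \<omega>)) / sqrt (real n)))
      (normal_law 0 (\<integral>w. (\<psi> w)\<^sup>2 \<partial>P))"
    by (rule central_limit_W[OF _ \<psi>_square \<psi>_mean]) simp
  show "real_distribution (normal_law 0 (\<integral>w. (\<psi> w)\<^sup>2 \<partial>P))" by (rule normal_law_real_distribution)
  fix e :: real assume "e > 0"
  let ?R = "\<lambda>n \<omega>. \<Sum>l<L. \<Sum>i\<in>I n l. remainder n l (train n l \<omega>) (W i \<omega>)"
  have [measurable]: "?R n \<in> borel_measurable M" for n
    using negligible_total_remainder by (simp add: negligible_in_prob_def)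
  have "(\<lambda>n. M.prob {\<omega> \<in> space M. \<bar>?R n \<omega>\<bar> > e * sqrt (real n)}) \<longlonglongrightarrow> 0"
    using negligible_total_remainder \<open>e > 0\<close> by (simp add: negligible_in_prob_def)
  then show "(\<lambda>n. M.prob {\<omega> \<in> space M.
      \<bar>(\<Sum>i<n. \<psi> (W i \<omega>)) / sqrt (real n) - sqrt (real n) * (estimator n \<omega> - \<theta>0)\<bar> > e}) \<longlonglongrightarrow> 0"
  proof (rule M.prob_subset_tendsto_0[rotated 2])
    show "eventually (\<lambda>n. {\<omega> \<in> space M.
        \<bar>(\<Sum>i<n. \<psi> (W i \<omega>)) / sqrt (real n) - sqrt (real n) * (estimator n \<omega> - \<theta>0)\<bar> > e}
      \<subseteq> {\<omega> \<in> space M. \<bar>?R n \<omega>\<bar> > e * sqrt (real n)}) sequentially"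
      using eventually_ge_at_top[of 1]
    proof eventually_elim
      case (elim n)
      have pos: "sqrt (real n) > 0" using elim by simp
      have "(\<Sum>i<n. \<psi> (W i \<omega>)) / sqrt (real n) - sqrt (real n) * (estimator n \<omega> - \<theta>0) = - (?R n \<omega> / sqrt (real n))" for \<omega>
      proof -
        have "sqrt (real n) * (estimator n \<omega> - \<theta>0) = real n * (estimator n \<omega> - \<theta>0) / sqrt (real n)"
          by (metis of_nat_0_le_iff real_div_sqrt times_divide_eq_left)
        then show ?thesis unfolding estimator_eq[OF elim] by (simp add: add_divide_distrib)
      qed
      note eq = this
      show ?case
      proof
        fix \<omega> assume "\<omega> \<in> {\<omega> \<in> space M.
          \<bar>(\<Sum>i<n. \<psi> (W i \<omega>)) / sqrt (real n) - sqrt (real n) * (estimator n \<omega> - \<theta>0)\<bar> > e}"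
        then have "\<omega> \<in> space M" "\<bar>- (?R n \<omega> / sqrt (real n))\<bar> > e" unfolding eq by auto
        then show "\<omega> \<in> {\<omega> \<in> space M. \<bar>?R n \<omega>\<bar> > e * sqrt (real n)}"
          using pos by (simp add: pos_less_divide_eq)
      qed
    qed
  qed measurable
qed measurable

subsection \<open>Consistency of the variance estimator\<close>

text \<open>Squaring the product of the two errors is not covered by their mean-square rates; one
  factor must be bounded. The bound \<open>K\<close> on the coefficients provides this.\<close>

lemma negligible_remainder_square:
  assumes "l < L" and K: "K > 0"
    and l1: "whp (\<lambda>n \<omega>. (\<Sum>j<p n. \<bar>\<rho>learn n l (train n l \<omega>) j\<bar>) \<le> K)"
  shows "negligible_in_prob M (\<lambda>n \<omega>. \<Sum>i\<in>I n l. (remainder n l (train n l \<omega>) (W i \<omega>))\<^sup>2) real"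
proof -
  let ?g = "\<lambda>n d w. (remainder n l d w)\<^sup>2"
  let ?v = "\<lambda>n. 3 * (Cm + (Cb * K)\<^sup>2) * real n powr (- 2 * g) + 3 * Cv * real n powr (- 2 * a)"
  have meas: "(\<lambda>(d, w). ?g n d w) \<in> borel_measurable (PT n l \<Otimes>\<^sub>M P)" for n
    using remainder_measurable[OF \<open>l < L\<close>, of n] by (simp add: split_beta')
  have whp: "whp (\<lambda>n \<omega>. integrable P (?g n (train n l \<omega>)) \<and>
      (\<integral>w. \<bar>?g n (train n l \<omega>) w\<bar> \<partial>P) \<le> ?v n)"
    using with_prob_approaching_one_conj[OF M.prob_space_axioms l1
        with_prob_approaching_one_conj[OF M.prob_space_axioms \<alpha>_rate[OF \<open>l < L\<close>] \<gamma>_rate[OF \<open>l < L\<close>]]]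
  proof (rule with_prob_approaching_one_mono, intro always_eventually allI ballI impI)
    fix n \<omega>
    let ?d = "train n l \<omega>"
    assume \<omega>: "\<omega> \<in> space M" and H: "(\<Sum>j<p n. \<bar>\<rho>learn n l ?d j\<bar>) \<le> K \<and>
      L2_norm P (\<lambda>w. \<alpha> (X w) - \<alpha>learn n l ?d (X w)) \<le> real n powr (- a) \<and>
      \<gamma>learn n l ?d \<in> \<Gamma> \<and> L2_norm P (\<lambda>w. \<delta> n l ?d (X w)) \<le> real n powr (- g)"
    then have D: "\<delta> n l ?d \<in> \<Gamma>" using \<Gamma>_diff \<gamma>0_\<Gamma> by blast
    then have DL: "\<delta> n l ?d \<in> L2_functions P N X" using \<Gamma>_L2 by blast
    have [measurable]: "\<delta> n l ?d \<in> borel_measurable N" and d2: "integrable P (\<lambda>w. (\<delta> n l ?d (X w))\<^sup>2)"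
      using in_L2[OF D] by auto
    have rem_meas [measurable]: "remainder n l ?d \<in> borel_measurable P"
      using measurable_section[OF remainder_measurable[OF \<open>l < L\<close>]] measurable_space[OF sample_measurable \<omega>] by blast
    have "AE w in P. \<bar>\<alpha>learn n l ?d (X w)\<bar> \<le> Cb * K"
      using dict.AE_lin_comb_le[of "p n" "\<rho>learn n l ?d"]
    proof eventually_elim
      case (elim w)
      have "Cb * (\<Sum>j<p n. \<bar>\<rho>learn n l ?d j\<bar>) \<le> Cb * K" using H dict.Cb_pos by (intro mult_left_mono) auto
      then show ?case using elim by linarith
    qed
    note \<alpha>\<delta> = integrable_bounded_mult_square[OF _ this _ d2]
    \<comment> \<open>The terms containing \<open>\<alpha>\<close> and \<open>\<eta>\<close> times
      \<open>\<delta>\<close> are merged into the estimated representer times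
      \<open>\<delta>\<close>, which has the bounded factor.\<close>
    let ?x = "\<lambda>w. m w (\<delta> n l ?d)" and ?y = "\<lambda>w. \<eta> n l ?d (X w) * (Y w - \<gamma>0 (X w))"
      and ?z = "\<lambda>w. \<alpha>learn n l ?d (X w) * \<delta> n l ?d (X w)"
    have x2: "integrable P (\<lambda>w. (?x w)\<^sup>2)" by (rule m_square(1)[OF DL])
    have y2: "integrable P (\<lambda>w. (?y w)\<^sup>2)" by (rule \<eta>_residual(1))
    have z2: "integrable P (\<lambda>w. (?z w)\<^sup>2)" by (rule \<alpha>\<delta>(1)) auto
    have le: "(remainder n l ?d w)\<^sup>2 \<le> 3 * (?x w)\<^sup>2 + 3 * (?y w)\<^sup>2 + 3 * (?z w)\<^sup>2" for w
    proof -
      have "(x + y - z)\<^sup>2 \<le> 3 * x\<^sup>2 + 3 * y\<^sup>2 + 3 * z\<^sup>2" for x y z :: real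
      proof -
        have "0 \<le> (x - y)\<^sup>2 + (x + z)\<^sup>2 + (y + z)\<^sup>2" by simp
        then show ?thesis by (simp add: power2_eq_square algebra_simps)
      qed
      moreover have "remainder n l ?d w = ?x w + ?y w - ?z w"
        unfolding remainder_eq by (simp add: algebra_simps)
      ultimately show ?thesis by simp
    qed
    have int: "integrable P (?g n ?d)"
      by (rule Bochner_Integration.integrable_bound[of P "\<lambda>w. 3 * (?x w)\<^sup>2 + 3 * (?y w)\<^sup>2 + 3 * (?z w)\<^sup>2"])
        (use x2 y2 z2 le in \<open>auto simp: abs_of_nonneg\<close>)
    have "(\<integral>w. \<bar>?g n ?d w\<bar> \<partial>P) = (\<integral>w. (remainder n l ?d w)\<^sup>2 \<partial>P)" by simp
    also have "\<dots> \<le> (\<integral>w. 3 * (?x w)\<^sup>2 + 3 * (?y w)\<^sup>2 + 3 * (?z w)\<^sup>2 \<partial>P)"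
      using int x2 y2 z2 le by (intro integral_mono) auto
    also have "\<dots> = 3 * (\<integral>w. (?x w)\<^sup>2 \<partial>P) + 3 * (\<integral>w. (?y w)\<^sup>2 \<partial>P) + 3 * (\<integral>w. (?z w)\<^sup>2 \<partial>P)"
      using x2 y2 z2 by simp
    also have "\<dots> \<le> 3 * (Cm * real n powr (- 2 * g)) + 3 * (Cv * real n powr (- 2 * a))
        + 3 * ((Cb * K)\<^sup>2 * real n powr (- 2 * g))"
    proof -
      have sq: "(\<integral>w. (\<delta> n l ?d (X w))\<^sup>2 \<partial>P) \<le> real n powr (- 2 * g)"
      proof -
        have "(L2_norm P (\<lambda>w. \<delta> n l ?d (X w)))\<^sup>2 \<le> (real n powr (- g))\<^sup>2"
          using H L2_norm_nonneg by (intro power_mono) auto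
        then show ?thesis by (simp add: L2_norm_square power2_eq_square[of "_ powr _"] powr_add[symmetric])
      qed
      have sq': "(\<integral>w. (\<eta> n l ?d (X w))\<^sup>2 \<partial>P) \<le> real n powr (- 2 * a)"
      proof -
        have "(\<integral>w. (\<eta> n l ?d (X w))\<^sup>2 \<partial>P) \<le> (real n powr (- a))\<^sup>2"
          unfolding \<eta>_norm using H L2_norm_nonneg by (intro power_mono) auto
        then show ?thesis by (simp add: power2_eq_square[of "_ powr _"] powr_add[symmetric])
      qed
      have "(\<integral>w. (?x w)\<^sup>2 \<partial>P) \<le> Cm * real n powr (- 2 * g)"
        using m_square(2)[OF DL] mult_left_mono[OF sq Cm_nonneg] by linarith
      moreover have "(\<integral>w. (?y w)\<^sup>2 \<partial>P) \<le> Cv * real n powr (- 2 * a)"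
        using \<eta>_residual(2)[of n l ?d] mult_left_mono[OF sq' Cv_nonneg] by linarith
      moreover have "(\<integral>w. (?z w)\<^sup>2 \<partial>P) \<le> (Cb * K)\<^sup>2 * real n powr (- 2 * g)"
        using \<alpha>\<delta>(2) mult_left_mono[OF sq zero_le_power2[of "Cb * K"]] by fastforce
      ultimately show ?thesis by linarith
    qed
    also have "\<dots> = ?v n" by (simp add: algebra_simps)
    finally show "integrable P (?g n ?d) \<and> (\<integral>w. \<bar>?g n ?d w\<bar> \<partial>P) \<le> ?v n" using int by blast
  qed
  have v0: "?v \<longlonglongrightarrow> 0"
  proof -
    have "(\<lambda>n. real n powr (- 2 * g)) \<longlonglongrightarrow> 0" "(\<lambda>n. real n powr (- 2 * a)) \<longlonglongrightarrow> 0"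
      using ag by real_asymp+
    from tendsto_add[OF tendsto_mult_right_zero[OF this(1)] tendsto_mult_right_zero[OF this(2)]]
    show ?thesis by simp
  qed
  have lim: "(\<lambda>n. real n * ?v n / (e * real n)) \<longlonglongrightarrow> 0" if "e > 0" for e
  proof (rule Lim_transform_eventually)
    show "(\<lambda>n. ?v n / e) \<longlonglongrightarrow> 0" using tendsto_divide[OF v0 tendsto_const[of e]] that by simp
    show "eventually (\<lambda>n. ?v n / e = real n * ?v n / (e * real n)) sequentially"
      using eventually_ge_at_top[of 1] by eventually_elim simp
  qed
  have "(\<lambda>n. M.prob {\<omega> \<in> space M. \<bar>\<Sum>i\<in>I n l. ?g n (train n l \<omega>) (W i \<omega>)\<bar> > e * real n}) \<longlonglongrightarrow> 0"
    if "e > 0" for e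
    by (rule crossfit_sum_L1[of ?g "\<lambda>n. T n l" "\<lambda>n. I n l", OF meas fold_facts(1-3)[OF \<open>l < L\<close>] whp lim[OF that]])
      (use that in auto)
  then show ?thesis
    unfolding negligible_in_prob_def using crossfit_sum_measurable[OF meas] by blast
qed

text \<open>Each estimated influence value is \<open>\<psi>\<close> plus a perturbation, namely the
  remainder minus the estimation error \<open>\<Delta>\<close>. A perturbation \<open>x\<close> of
  \<open>u\<close> changes the square by at most \<open>\<tau> * u\<^sup>2\<close> plus a multiple
  of \<open>x\<^sup>2\<close>, so it suffices that the mean squared perturbation is small.\<close>

theorem variance_consistency:
  assumes K: "K > 0" and l1: "\<And>l. l < L \<Longrightarrow> whp
    (\<lambda>n \<omega>. (\<Sum>j<p n. \<bar>\<rho>learn n l (train n l \<omega>) j\<bar>) \<le> K)"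
  shows "tendsto_in_prob M variance_estimator (\<integral>w. (\<psi> w)\<^sup>2 \<partial>P)"
  unfolding tendsto_in_prob_def
proof (intro allI impI)
  fix e :: real assume e: "e > 0"
  let ?V = "\<integral>w. (\<psi> w)\<^sup>2 \<partial>P"
  have V: "?V \<ge> 0" by simp
  let ?R = "\<lambda>n \<omega>. \<Sum>l<L. \<Sum>i\<in>I n l. remainder n l (train n l \<omega>) (W i \<omega>)"
  let ?R2 = "\<lambda>n \<omega>. \<Sum>l<L. \<Sum>i\<in>I n l. (remainder n l (train n l \<omega>) (W i \<omega>))\<^sup>2"
  have R2: "negligible_in_prob M ?R2 real"
    using negligible_remainder_square[OF _ K l1] by (intro negligible_in_prob_sum M.prob_space_axioms) auto
  have [measurable]: "?R n \<in> borel_measurable M" "?R2 n \<in> borel_measurable M" for n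
    using negligible_total_remainder R2 by (simp_all add: negligible_in_prob_def)
  have V1: "?V + 1 > 0" using V by linarith
  \<comment> \<open>The tolerance \<open>e\<close> is split: \<open>e / 4\<close> for the law of
    large numbers, \<open>e / 4\<close> for the part weighted by \<open>\<tau>\<close>, and
    \<open>e / 4\<close> for the mean squared perturbation, which is allowed to reach
    \<open>x0\<close>.\<close>
  define \<tau> where "\<tau> = e / 4 / (?V + 1)"
  have "\<tau> > 0" unfolding \<tau>_def by (intro divide_pos_pos V1) (use e in auto)
  moreover have "\<tau> * (?V + 1) = e / 4" unfolding \<tau>_def using V1 by (intro nonzero_eq_divide_eq[THEN iffD1] refl) auto
  ultimately have \<tau>: "\<tau> > 0" "\<tau> * (?V + 1) = e / 4" .
  have \<tau>1: "1 + 1 / \<tau> > 0" using \<tau>(1) by (intro add_pos_pos) auto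
  define x0 where "x0 = e / 4 / (1 + 1 / \<tau>)"
  have x0: "x0 > 0" "(1 + 1 / \<tau>) * x0 = e / 4"
    unfolding x0_def using e \<tau>1 by (auto simp del: divide_divide_eq_left)
  \<comment> \<open>Two terms of size at most \<open>c1\<close> give
    \<open>\<bar>\<Delta>\<bar> \<le> 2 * c1\<close>, so \<open>2 * \<Delta>\<^sup>2\<close> uses
    half of \<open>x0\<close>; the squared remainders use the other half.\<close>
  define c1 where "c1 = sqrt x0 / 4"
  have c1: "c1 > 0" "8 * c1\<^sup>2 = x0 / 2" using x0 by (auto simp: c1_def power_divide)
  \<comment> \<open>The minimum with 1 keeps the empirical mean of \<open>\<psi>\<^sup>2\<close>
    below \<open>?V + 1\<close>, the quantity in the definition of \<open>\<tau>\<close>.\<close>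
  let ?A = "\<lambda>n. {\<omega> \<in> space M. \<bar>(\<Sum>i<n. (\<psi> (W i \<omega>))\<^sup>2) / real n - ?V\<bar> > min 1 (e / 4)}"
  let ?B = "\<lambda>n. {\<omega> \<in> space M. \<bar>?R2 n \<omega>\<bar> > x0 / 4 * real n}"
  let ?D = "\<lambda>n. {\<omega> \<in> space M. \<bar>\<Sum>i<n. \<psi> (W i \<omega>)\<bar> > c1 * real n}"
  let ?F = "\<lambda>n. {\<omega> \<in> space M. \<bar>?R n \<omega>\<bar> > c1 * sqrt (real n)}"
  have ev: "?A n \<in> M.events" "?B n \<in> M.events" "?D n \<in> M.events" "?F n \<in> M.events" for n
    by measurable
  have lims: "(\<lambda>n. M.prob (?A n)) \<longlonglongrightarrow> 0" "(\<lambda>n. M.prob (?B n)) \<longlonglongrightarrow> 0"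
    "(\<lambda>n. M.prob (?D n)) \<longlonglongrightarrow> 0" "(\<lambda>n. M.prob (?F n)) \<longlonglongrightarrow> 0"
  proof -
    show "(\<lambda>n. M.prob (?A n)) \<longlonglongrightarrow> 0" using \<psi>_square e by (intro law_of_large_numbers_L1) auto
    show "(\<lambda>n. M.prob (?B n)) \<longlonglongrightarrow> 0" 
      using R2[unfolded negligible_in_prob_def, THEN conjunct2, rule_format, of "x0 / 4"] x0(1) by simp
    show "(\<lambda>n. M.prob (?D n)) \<longlonglongrightarrow> 0"
      using \<psi>_square \<psi>_mean c1(1) by (intro law_of_large_numbers_L2) auto
    show "(\<lambda>n. M.prob (?F n)) \<longlonglongrightarrow> 0"
      using negligible_total_remainder c1(1) by (simp add: negligible_in_prob_def)
  qed
  have "(\<lambda>n. M.prob ((?A n \<union> ?B n) \<union> (?D n \<union> ?F n))) \<longlonglongrightarrow> 0"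
    by (rule M.prob_Un_tendsto_0[OF _ _ M.prob_Un_tendsto_0[OF ev(1,2) lims(1,2)]
          M.prob_Un_tendsto_0[OF ev(3,4) lims(3,4)]]) (intro sets.Un ev)+
  then show "(\<lambda>n. M.prob {\<omega> \<in> space M. \<bar>variance_estimator n \<omega> - ?V\<bar> > e}) \<longlonglongrightarrow> 0"
  proof (rule M.prob_subset_tendsto_0[rotated 2])
    show "eventually (\<lambda>n. {\<omega> \<in> space M. \<bar>variance_estimator n \<omega> - ?V\<bar> > e}
      \<subseteq> (?A n \<union> ?B n) \<union> (?D n \<union> ?F n)) sequentially"
      using eventually_ge_at_top[of 1]
    proof eventually_elim
      case (elim n)
      have n: "real n > 0" using elim by simp
      show ?case
      proof (rule subsetI, rule ccontr)
        fix \<omega> assume \<omega>: "\<omega> \<in> {\<omega> \<in> space M. \<bar>variance_estimator n \<omega> - ?V\<bar> > e}"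
          "\<omega> \<notin> (?A n \<union> ?B n) \<union> (?D n \<union> ?F n)"
        define A where "A = (\<Sum>i<n. (\<psi> (W i \<omega>))\<^sup>2) / real n"
        define \<Delta> where "\<Delta> = estimator n \<omega> - \<theta>0"
        let ?rem = "\<lambda>l i. remainder n l (train n l \<omega>) (W i \<omega>)"
        have A: "\<bar>A - ?V\<bar> \<le> 1" "\<bar>A - ?V\<bar> \<le> e / 4" and R2': "?R2 n \<omega> \<le> x0 / 4 * real n"
          and small: "\<bar>\<Sum>i<n. \<psi> (W i \<omega>)\<bar> \<le> c1 * real n" "\<bar>?R n \<omega>\<bar> \<le> c1 * sqrt (real n)"
          using \<omega> by (auto simp: A_def not_less)
        have "sqrt (real n) \<le> real n" using elim by (intro real_le_lsqrt) (auto simp: power2_eq_square)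
        then have "c1 * sqrt (real n) \<le> c1 * real n" using c1(1) by (intro mult_left_mono) auto
        then have "\<bar>real n * \<Delta>\<bar> \<le> 2 * c1 * real n"
          unfolding \<Delta>_def estimator_eq[OF elim] using small by linarith
        then have "\<bar>\<Delta>\<bar> \<le> 2 * c1" using n by (simp add: abs_mult)
        then have "\<bar>\<Delta>\<bar>\<^sup>2 \<le> (2 * c1)\<^sup>2" by (rule power_mono) simp
        then have \<Delta>2: "2 * \<Delta>\<^sup>2 \<le> x0 / 2" using c1(2) by (simp add: power_mult_distrib)
        have Vhat: "variance_estimator n \<omega>
            = (\<Sum>l<L. \<Sum>i\<in>I n l. (\<psi> (W i \<omega>) + (?rem l i - \<Delta>))\<^sup>2) / real n"
        proof -
          have sc: "summand n l d w = \<psi> w + remainder n l d w + \<theta>0" for l d w by (simp add: remainder_def)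
          have "variance_estimator n \<omega>
              = (\<Sum>l<L. \<Sum>i\<in>I n l. (summand n l (train n l \<omega>) (W i \<omega>) - estimator n \<omega>)\<^sup>2) / real n"
            unfolding variance_estimator_def V_hat_def estimator_def[symmetric] summand_def
            by (simp add: algebra_simps)
          then show ?thesis unfolding sc \<Delta>_def by (simp add: algebra_simps)
        qed
        have Aeq: "A = (\<Sum>l<L. \<Sum>i\<in>I n l. (\<psi> (W i \<omega>))\<^sup>2) / real n" unfolding A_def sum_folds ..
        have pt: "\<bar>(u + x)\<^sup>2 - u\<^sup>2\<bar> \<le> \<tau> * u\<^sup>2 + (1 + 1 / \<tau>) * x\<^sup>2" for u x :: real
        proof -
          have "0 \<le> (sqrt \<tau> * u - x / sqrt \<tau>)\<^sup>2" "0 \<le> (sqrt \<tau> * u + x / sqrt \<tau>)\<^sup>2" by simp_all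
          then have *: "2 * (u * x) \<le> \<tau> * u\<^sup>2 + x\<^sup>2 / \<tau>" "- 2 * (u * x) \<le> \<tau> * u\<^sup>2 + x\<^sup>2 / \<tau>"
            using \<tau>(1) by (simp_all add: power2_diff power2_sum power_mult_distrib power_divide)
          have "(u + x)\<^sup>2 - u\<^sup>2 = 2 * (u * x) + x\<^sup>2" by (simp add: power2_sum)
          moreover have "(1 + 1 / \<tau>) * x\<^sup>2 = x\<^sup>2 + x\<^sup>2 / \<tau>" by (simp add: distrib_right)
          moreover have "x\<^sup>2 \<ge> 0" by simp
          ultimately show ?thesis using * unfolding abs_le_iff by linarith
        qed
        have x2: "(?rem l i - \<Delta>)\<^sup>2 \<le> 2 * (?rem l i)\<^sup>2 + 2 * \<Delta>\<^sup>2" for l i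
          using sum_squares_bound[of "- ?rem l i" \<Delta>] by (simp add: power2_diff)
        have "\<bar>variance_estimator n \<omega> - A\<bar>
            = \<bar>\<Sum>l<L. \<Sum>i\<in>I n l. (\<psi> (W i \<omega>) + (?rem l i - \<Delta>))\<^sup>2 - (\<psi> (W i \<omega>))\<^sup>2\<bar> / real n"
          unfolding Vhat Aeq sum_subtractf diff_divide_distrib[symmetric] using n by simp
        also have "\<dots> \<le> (\<Sum>l<L. \<Sum>i\<in>I n l. \<tau> * (\<psi> (W i \<omega>))\<^sup>2 + (1 + 1 / \<tau>) * (2 * (?rem l i)\<^sup>2 + 2 * \<Delta>\<^sup>2)) / real n"
        proof (rule divide_right_mono)
          have "\<bar>\<Sum>l<L. \<Sum>i\<in>I n l. (\<psi> (W i \<omega>) + (?rem l i - \<Delta>))\<^sup>2 - (\<psi> (W i \<omega>))\<^sup>2\<bar>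
              \<le> (\<Sum>l<L. \<Sum>i\<in>I n l. \<bar>(\<psi> (W i \<omega>) + (?rem l i - \<Delta>))\<^sup>2 - (\<psi> (W i \<omega>))\<^sup>2\<bar>)"
            by (rule order_trans[OF sum_abs sum_mono[OF sum_abs]])
          also have "\<dots> \<le> (\<Sum>l<L. \<Sum>i\<in>I n l. \<tau> * (\<psi> (W i \<omega>))\<^sup>2 + (1 + 1 / \<tau>) * (2 * (?rem l i)\<^sup>2 + 2 * \<Delta>\<^sup>2))"
          proof (rule sum_mono, rule sum_mono)
            fix l i
            have "(1 + 1 / \<tau>) * (?rem l i - \<Delta>)\<^sup>2 \<le> (1 + 1 / \<tau>) * (2 * (?rem l i)\<^sup>2 + 2 * \<Delta>\<^sup>2)"
              using x2 \<tau>(1) by (intro mult_left_mono) auto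
            then show "\<bar>(\<psi> (W i \<omega>) + (?rem l i - \<Delta>))\<^sup>2 - (\<psi> (W i \<omega>))\<^sup>2\<bar>
                \<le> \<tau> * (\<psi> (W i \<omega>))\<^sup>2 + (1 + 1 / \<tau>) * (2 * (?rem l i)\<^sup>2 + 2 * \<Delta>\<^sup>2)"
              using pt[of "\<psi> (W i \<omega>)" "?rem l i - \<Delta>"] by linarith
          qed
          finally show "\<bar>\<Sum>l<L. \<Sum>i\<in>I n l. (\<psi> (W i \<omega>) + (?rem l i - \<Delta>))\<^sup>2 - (\<psi> (W i \<omega>))\<^sup>2\<bar>
              \<le> (\<Sum>l<L. \<Sum>i\<in>I n l. \<tau> * (\<psi> (W i \<omega>))\<^sup>2 + (1 + 1 / \<tau>) * (2 * (?rem l i)\<^sup>2 + 2 * \<Delta>\<^sup>2))" .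
        qed simp
        also have "\<dots> = \<tau> * A + (1 + 1 / \<tau>) * (2 * (?R2 n \<omega> / real n) + 2 * \<Delta>\<^sup>2)"
        proof -
          have "(\<Sum>l<L. \<Sum>i\<in>I n l. 2 * \<Delta>\<^sup>2) = real n * (2 * \<Delta>\<^sup>2)" unfolding sum_folds by simp
          then have "(\<Sum>l<L. \<Sum>i\<in>I n l. \<tau> * (\<psi> (W i \<omega>))\<^sup>2 + (1 + 1 / \<tau>) * (2 * (?rem l i)\<^sup>2 + 2 * \<Delta>\<^sup>2))
              = \<tau> * (\<Sum>l<L. \<Sum>i\<in>I n l. (\<psi> (W i \<omega>))\<^sup>2) + (1 + 1 / \<tau>) * (2 * ?R2 n \<omega> + real n * (2 * \<Delta>\<^sup>2))"
            by (simp only: sum.distrib sum_distrib_left[symmetric])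
          then show ?thesis unfolding Aeq using n by (simp add: add_divide_distrib distrib_left)
        qed
        also have "\<dots> \<le> \<tau> * (?V + 1) + (1 + 1 / \<tau>) * x0"
        proof (rule add_mono)
          show "\<tau> * A \<le> \<tau> * (?V + 1)" using A(1) \<tau>(1) by (intro mult_left_mono) auto
          have "?R2 n \<omega> / real n \<le> x0 / 4" using R2' n by (simp add: pos_divide_le_eq)
          then have "2 * (?R2 n \<omega> / real n) + 2 * \<Delta>\<^sup>2 \<le> x0" using \<Delta>2 by linarith
          then show "(1 + 1 / \<tau>) * (2 * (?R2 n \<omega> / real n) + 2 * \<Delta>\<^sup>2) \<le> (1 + 1 / \<tau>) * x0"
            using \<tau>(1) by (intro mult_left_mono) auto
        qed
        also have "\<dots> = e / 2" unfolding \<tau>(2) x0(2) by simp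
        finally have "\<bar>variance_estimator n \<omega> - ?V\<bar> < e" using A(2) e by linarith
        then show False using \<omega>(1) by simp
      qed
    qed
  qed (intro sets.Un ev)
qed

end

section \<open>The estimators of the weighted average derivative\<close>

lemma
  assumes "closed_L2_subspace P N X \<Gamma>"
  shows closed_L2_subspace_add: "u \<in> \<Gamma> \<Longrightarrow> v \<in> \<Gamma> \<Longrightarrow> (\<lambda>x. u x + v x) \<in> \<Gamma>"
    and closed_L2_subspace_scale: "u \<in> \<Gamma> \<Longrightarrow> (\<lambda>x. c * u x) \<in> \<Gamma>"
  using assms by (simp_all add: closed_L2_subspace_def)

lemma closed_L2_subspace_diff:
  assumes "closed_L2_subspace P N X \<Gamma>" "u \<in> \<Gamma>" "v \<in> \<Gamma>"
  shows "(\<lambda>x. u x - v x) \<in> \<Gamma>"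
  using closed_L2_subspace_add[OF assms(1,2) closed_L2_subspace_scale[OF assms(1,3), of "- 1"]] by simp

text \<open>Along \<open>\<gamma>0 + t * u\<close> the objective is a quadratic polynomial in
  \<open>t\<close> with its minimum at 0, so its linear coefficient, minus twice the inner product,
  vanishes.\<close>

lemma argmin_orthogonal:
  fixes f :: "'w \<Rightarrow> real"
  assumes \<Gamma>: "closed_L2_subspace P N X \<Gamma>" and X [measurable]: "X \<in> measurable P N"
    and f [measurable]: "f \<in> borel_measurable P" and f2: "integrable P (\<lambda>w. (f w)\<^sup>2)"
    and opt: "is_arg_min (\<lambda>\<gamma>. \<integral>w. (f w - \<gamma> (X w))\<^sup>2 \<partial>P) (\<lambda>\<gamma>. \<gamma> \<in> \<Gamma>) \<gamma>0" and u: "u \<in> \<Gamma>"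
  shows "(\<integral>w. (f w - \<gamma>0 (X w)) * u (X w) \<partial>P) = 0"
proof -
  have L2: "v \<in> borel_measurable N" "integrable P (\<lambda>w. (v (X w))\<^sup>2)" if "v \<in> \<Gamma>" for v
    using \<Gamma> that by (auto simp: closed_L2_subspace_def L2_functions_def)
  have \<gamma>0: "\<gamma>0 \<in> \<Gamma>" using opt by (simp add: is_arg_min_def)
  note [measurable] = L2(1)[OF \<gamma>0] L2(1)[OF u]
  have e2: "integrable P (\<lambda>w. (f w - \<gamma>0 (X w))\<^sup>2)"
    by (rule integrable_add_square(2)) (use f2 L2(2)[OF \<gamma>0] in auto)
  have eu: "integrable P (\<lambda>w. (f w - \<gamma>0 (X w)) * u (X w))"
    by (rule integrable_mult_L2) (use e2 L2(2)[OF u] in auto)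
  let ?I = "\<integral>w. (f w - \<gamma>0 (X w)) * u (X w) \<partial>P" and ?U = "\<integral>w. (u (X w))\<^sup>2 \<partial>P"
  have "(2 * ?I) * t + (- ?U) * t\<^sup>2 \<le> 0" for t
  proof -
    have "(\<lambda>x. \<gamma>0 x + t * u x) \<in> \<Gamma>"
      by (rule closed_L2_subspace_add[OF \<Gamma> \<gamma>0 closed_L2_subspace_scale[OF \<Gamma> u]])
    then have "(\<integral>w. (f w - \<gamma>0 (X w))\<^sup>2 \<partial>P) \<le> (\<integral>w. (f w - (\<gamma>0 (X w) + t * u (X w)))\<^sup>2 \<partial>P)"
      using opt by (auto simp: is_arg_min_def not_less)
    also have "\<dots> = (\<integral>w. (f w - \<gamma>0 (X w))\<^sup>2 - 2 * t * ((f w - \<gamma>0 (X w)) * u (X w)) + t\<^sup>2 * (u (X w))\<^sup>2 \<partial>P)"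
      by (intro Bochner_Integration.integral_cong refl) (simp add: power2_eq_square algebra_simps)
    also have "\<dots> = (\<integral>w. (f w - \<gamma>0 (X w))\<^sup>2 \<partial>P) - 2 * t * ?I + t\<^sup>2 * ?U"
      using e2 eu L2(2)[OF u] by simp
    finally show ?thesis by (simp add: algebra_simps)
  qed
  then have "2 * ?I = 0" by (rule linear_coeff_zero_if_quadratic_nonpos)
  then show ?thesis by simp
qed

text \<open>The square of \<open>u (X w)\<close> is measurable for the sigma-algebra generated by
  \<open>X\<close>, so under the integral \<open>h\<close> may be replaced by its conditional
  expectation. Boundedness of \<open>u\<close> makes the product integrable, and
  \<open>max C 0\<close> makes the constant visibly nonnegative.\<close>

lemma cond_exp_bounded_imp_integral_le:
  fixes h :: "'w \<Rightarrow> real" and u :: "'x \<Rightarrow> real"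
  assumes "prob_space P" and X [measurable]: "X \<in> measurable P N" and u [measurable]: "u \<in> borel_measurable N"
    and bnd: "AE w in P. \<bar>u (X w)\<bar> \<le> K" and h: "integrable P h" "\<And>w. h w \<ge> 0"
    and ce: "AE w in P. \<bar>real_cond_exp P (vimage_algebra (space P) X N) h w\<bar> \<le> C"
  shows "(\<integral>w. (u (X w))\<^sup>2 * h w \<partial>P) \<le> max C 0 * (\<integral>w. (u (X w))\<^sup>2 \<partial>P)"
proof -
  interpret prob_space P by fact
  let ?F = "vimage_algebra (space P) X N"
  have sub: "subalgebra P ?F"
    using measurable_sets[OF X] measurable_space[OF X]
    by (auto simp: subalgebra_def sets_vimage_algebra2)
  interpret sigma_finite_subalgebra P ?F
    using sub by (intro finite_measure_subalgebra_is_sigma_finite finite_measure_subalgebra.intro)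
      (auto simp: finite_measure_subalgebra_axioms_def finite_measure_axioms)
  have uF: "(\<lambda>w. (u (X w))\<^sup>2) \<in> borel_measurable ?F"
  proof -
    have "X \<in> measurable ?F N" using measurable_space[OF X] by (intro measurable_vimage_algebra1) auto
    then show ?thesis by (intro borel_measurable_power measurable_compose[OF _ u])
  qed
  have u2: "integrable P (\<lambda>w. (u (X w))\<^sup>2)"
  proof (rule integrable_const_bound[of _ "K\<^sup>2"])
    show "AE w in P. norm ((u (X w))\<^sup>2) \<le> K\<^sup>2"
      using bnd by eventually_elim (simp add: abs_le_square_iff[symmetric])
  qed simp
  have int: "integrable P (\<lambda>w. (u (X w))\<^sup>2 * h w)"
  proof (rule Bochner_Integration.integrable_bound[of P "\<lambda>w. K\<^sup>2 * h w"])
    show "AE w in P. norm ((u (X w))\<^sup>2 * h w) \<le> norm (K\<^sup>2 * h w)"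
      using bnd
    proof eventually_elim
      case (elim w)
      have "\<bar>u (X w)\<bar>\<^sup>2 \<le> K\<^sup>2" using elim by (rule power_mono) simp
      then show ?case using h(2)[of w] by (simp add: mult_right_mono)
    qed
  qed (use h in auto)
  note ci = real_cond_exp_intg[OF int uF borel_measurable_integrable[OF h(1)]]
  have "(\<integral>w. (u (X w))\<^sup>2 * h w \<partial>P) = (\<integral>w. (u (X w))\<^sup>2 * real_cond_exp P ?F h w \<partial>P)" using ci(2) by simp
  also have "\<dots> \<le> (\<integral>w. max C 0 * (u (X w))\<^sup>2 \<partial>P)"
  proof (rule integral_mono_AE)
    show "AE w in P. (u (X w))\<^sup>2 * real_cond_exp P ?F h w \<le> max C 0 * (u (X w))\<^sup>2"
      using ce by eventually_elim (auto simp: mult.commute[of _ "(u _)\<^sup>2"] intro!: mult_left_mono)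
  qed (use ci(1) u2 in auto)
  finally show ?thesis by simp
qed

text \<open>The constant in the stochastic order varies with the probability level; giving up a
  small power of \<open>n\<close> absorbs all of them at once.\<close>

lemma bigO_in_prob_imp_with_prob_approaching_one:
  assumes "prob_space M" and meas: "\<And>n. Z n \<in> borel_measurable M"
    and O: "bigO_in_prob M Z (\<lambda>n. real n powr (- d))" and "g < d"
  shows "with_prob_approaching_one M (\<lambda>n \<omega>. Z n \<omega> \<le> real n powr (- g))"
proof (rule with_prob_approaching_oneI[OF assms(1)])
  interpret prob_space M by fact
  note [measurable] = meas
  show "{\<omega> \<in> space M. \<not> Z n \<omega> \<le> real n powr (- g)} \<in> events" for n by measurable
  show "(\<lambda>n. prob {\<omega> \<in> space M. \<not> Z n \<omega> \<le> real n powr (- g)}) \<longlonglongrightarrow> 0"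
  proof (rule LIMSEQ_I)
    fix e :: real assume "e > 0"
    then obtain K n0 where K: "K > 0"
      "\<And>n. n \<ge> n0 \<Longrightarrow> prob {\<omega> \<in> space M. \<bar>Z n \<omega>\<bar> > K * \<bar>real n powr (- d)\<bar>} < e"
      using O unfolding bigO_in_prob_def by blast
    have "eventually (\<lambda>n. K \<le> real n powr (d - g)) sequentially" using \<open>g < d\<close> by real_asymp
    then have "eventually (\<lambda>n. norm (prob {\<omega> \<in> space M. \<not> Z n \<omega> \<le> real n powr (- g)} - 0) < e) sequentially"
      using eventually_ge_at_top[of n0]
    proof eventually_elim
      case (elim n)
      have "K * real n powr (- d) \<le> real n powr (d - g) * real n powr (- d)" using elim by (intro mult_right_mono) auto
      also have "\<dots> = real n powr (- g)" by (simp add: powr_add[symmetric])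
      finally have "prob {\<omega> \<in> space M. \<not> Z n \<omega> \<le> real n powr (- g)}
          \<le> prob {\<omega> \<in> space M. \<bar>Z n \<omega>\<bar> > K * \<bar>real n powr (- d)\<bar>}"
        by (intro finite_measure_mono) auto
      then show ?case using K(2)[OF elim(2)] by simp
    qed
    then show "\<exists>no. \<forall>n\<ge>no. norm (prob {\<omega> \<in> space M. \<not> Z n \<omega> \<le> real n powr (- g)} - 0) < e"
      by (simp add: eventually_sequentially)
  qed
qed

lemma closed_L2_subspace_lin_comb:
  assumes \<Gamma>: "closed_L2_subspace P N X \<Gamma>" and b: "\<And>j. b j \<in> \<Gamma>"
  shows "lin_comb b q \<rho> \<in> \<Gamma>"
proof (induction q)
  case 0
  then show ?case using \<Gamma> by (simp add: lin_comb_def[abs_def] closed_L2_subspace_def)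
next
  case (Suc q)
  have "(\<lambda>x. lin_comb b q \<rho> x + \<rho> q * b q x) \<in> \<Gamma>"
    by (rule closed_L2_subspace_add[OF \<Gamma> Suc closed_L2_subspace_scale[OF \<Gamma> b]])
  moreover have "lin_comb b (Suc q) \<rho> = (\<lambda>x. lin_comb b q \<rho> x + \<rho> q * b q x)"
    by (rule ext) (simp add: lin_comb_def mult.commute)
  ultimately show ?case by simp
qed

text \<open>With at least two folds the limiting share of a fold is at most one half, hence
  eventually below \<open>3 / 4\<close>.\<close>

lemma training_set_large:
  assumes folds: "cross_fit_folds L I" and "L \<ge> 2" "l < L"
  shows "eventually (\<lambda>n. real (card ({..<n} - I n l)) \<ge> 1 / 4 * real n) sequentially"
proof -
  have "1 / real L < 3 / 4" using \<open>L \<ge> 2\<close> by (simp add: field_simps)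
  moreover have "(\<lambda>n. real (card (I n l)) / real n) \<longlonglongrightarrow> 1 / real L"
    using folds \<open>l < L\<close> by (simp add: cross_fit_folds_def)
  ultimately have "eventually (\<lambda>n. real (card (I n l)) / real n < 3 / 4) sequentially"
    by (intro order_tendstoD(2))
  then show ?thesis using eventually_ge_at_top[of 1]
  proof eventually_elim
    case (elim n)
    have sub: "I n l \<subseteq> {..<n}" using folds \<open>l < L\<close> unfolding cross_fit_folds_def by blast
    have "real (card ({..<n} - I n l)) = real n - real (card (I n l))"
      using sub card_mono[OF _ sub] by (simp add: card_Diff_subset finite_subset of_nat_diff)
    then show ?case using elim by (simp add: field_simps)
  qed
qed

theorem corollary6:
  fixes M :: "'o measure" and P :: "'w measure" and MZ :: "'z measure"
    and W :: "nat \<Rightarrow> 'o \<Rightarrow> 'w"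
    and Y D U :: "'w \<Rightarrow> real" and Z :: "'w \<Rightarrow> 'z" and X :: "'w \<Rightarrow> real \<times> 'z"
    and pdf :: "real \<Rightarrow> real" and f :: "real \<Rightarrow> 'z \<Rightarrow> real"
    and m :: "'w \<Rightarrow> (real \<times> 'z \<Rightarrow> real) \<Rightarrow> real"
    and \<Gamma> :: "(real \<times> 'z \<Rightarrow> real) set"
    and \<alpha>0 \<alpha>bar \<gamma>bar :: "real \<times> 'z \<Rightarrow> real"
    and \<theta>bar V :: real and \<psi> :: "'w \<Rightarrow> real"
    and b :: "nat \<Rightarrow> real \<times> 'z \<Rightarrow> real" and p :: "nat \<Rightarrow> nat" and r :: "nat \<Rightarrow> real"
    and L :: nat and I T :: "nat \<Rightarrow> nat \<Rightarrow> nat set"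
    and \<gamma>learn :: "nat \<Rightarrow> nat \<Rightarrow> (nat \<Rightarrow> 'w) \<Rightarrow> real \<times> 'z \<Rightarrow> real"
    and \<rho>learn :: "nat \<Rightarrow> nat \<Rightarrow> (nat \<Rightarrow> 'w) \<Rightarrow> nat \<Rightarrow> real"
    and \<gamma>hat \<alpha>hat :: "nat \<Rightarrow> 'o \<Rightarrow> nat \<Rightarrow> real \<times> 'z \<Rightarrow> real"
    and \<rho>hat :: "nat \<Rightarrow> 'o \<Rightarrow> nat \<Rightarrow> nat \<Rightarrow> real"
    and \<theta>hat Vhat :: "nat \<Rightarrow> 'o \<Rightarrow> real"
  (* i.i.d. sample from the distribution P *)
  assumes "prob_space M" and "prob_space P"
    and "prob_space.indep_vars M (\<lambda>_. P) W UNIV" and "\<And>i. distr M P (W i) = P"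
  (* the components of an observation *)
    and "Y \<in> borel_measurable P" and "integrable P (\<lambda>w. (Y w)\<^sup>2)"
    and "D \<in> borel_measurable P" and "Z \<in> measurable P MZ" and "U \<in> borel_measurable P"
    and X_def: "X = (\<lambda>w. (D w, Z w))"
    and "(\<lambda>(d, z). f d z) \<in> borel_measurable (borel \<Otimes>\<^sub>M MZ)" and "\<And>d z. f d z \<ge> 0"
    and "distr P (borel \<Otimes>\<^sub>M MZ) X =
           density (lborel \<Otimes>\<^sub>M distr P MZ Z) (\<lambda>(d, z). ennreal (f d z))"
    and "\<And>u. pdf u \<ge> 0" and "\<And>u. pdf u > 0 \<Longrightarrow> pdf differentiable (at u)"
    and "distributed P lborel U (\<lambda>u. ennreal (pdf u))"
    and "prob_space.indep_set P (sets (vimage_algebra (space P) U borel))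
           (sets (vimage_algebra (space P) Z MZ))"
  (* population objects *)
    and m_def: "m = wad_moment pdf U Z"
    and "closed_L2_subspace P (borel \<Otimes>\<^sub>M MZ) X \<Gamma>"
    and \<alpha>0_def: "\<alpha>0 = wad_riesz f pdf"
    and riesz: "\<And>\<gamma>. \<gamma> \<in> L2_functions P (borel \<Otimes>\<^sub>M MZ) X \<Longrightarrow>
           integrable P (\<lambda>w. m w \<gamma>) \<and> integrable P (\<lambda>w. \<alpha>0 (X w) * \<gamma> (X w)) \<and>
           (\<integral>w. m w \<gamma> \<partial>P) = (\<integral>w. \<alpha>0 (X w) * \<gamma> (X w) \<partial>P)"
    and "is_arg_min (\<lambda>\<alpha>. \<integral>w. (\<alpha>0 (X w) - \<alpha> (X w))\<^sup>2 \<partial>P) (\<lambda>\<alpha>. \<alpha> \<in> \<Gamma>) \<alpha>bar"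
    and "is_arg_min (\<lambda>\<gamma>. \<integral>w. (Y w - \<gamma> (X w))\<^sup>2 \<partial>P) (\<lambda>\<gamma>. \<gamma> \<in> \<Gamma>) \<gamma>bar"
    and \<theta>bar_def: "\<theta>bar = (\<integral>w. m w \<gamma>bar \<partial>P)"
    and \<psi>_def: "\<psi> = (\<lambda>w. m w \<gamma>bar - \<theta>bar + \<alpha>bar (X w) * (Y w - \<gamma>bar (X w)))"
    and V_def: "V = (\<integral>w. (\<psi> w)\<^sup>2 \<partial>P)"
  (* dictionary size, penalty and folds; T n l is the complement of the fold I n l *)
    and "\<And>n. n \<ge> 1 \<Longrightarrow> p n \<ge> 2" and "\<And>n. n \<ge> 1 \<Longrightarrow> r n > 0"
    and "L \<ge> 2" and "cross_fit_folds L I"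
    and T_def: "T = (\<lambda>n l. {..<n} - I n l)"
  (* the learners depend only on the observations outside the fold *)
    and "\<And>n l. l < L \<Longrightarrow>
           (\<lambda>(d, x). \<gamma>learn n l d x)
             \<in> borel_measurable (PiM (T n l) (\<lambda>_. P) \<Otimes>\<^sub>M (borel \<Otimes>\<^sub>M MZ))"
    and \<gamma>hat_def: "\<gamma>hat = (\<lambda>n \<omega> l. \<gamma>learn n l (restrict (\<lambda>i. W i \<omega>) (T n l)))"
    and "\<And>n l j. l < L \<Longrightarrow> j < p n \<Longrightarrow>
           (\<lambda>d. \<rho>learn n l d j) \<in> borel_measurable (PiM (T n l) (\<lambda>_. P))"
    and \<rho>hat_def: "\<rho>hat = (\<lambda>n \<omega> l. \<rho>learn n l (restrict (\<lambda>i. W i \<omega>) (T n l)))"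
    and "\<And>l. l < L \<Longrightarrow> with_prob_approaching_one M
           (\<lambda>n \<omega>. is_arg_min
              (lasso_objective (p n) (r n)
                 (M_hat m b (T n l) (\<lambda>i. W i \<omega>)) (G_hat X b (T n l) (\<lambda>i. W i \<omega>)))
              (\<lambda>_. True) (\<rho>hat n \<omega> l))"
    and \<alpha>hat_def: "\<alpha>hat = (\<lambda>n \<omega> l. lin_comb b (p n) (\<rho>hat n \<omega> l))"
    and \<theta>hat_def: "\<theta>hat = (\<lambda>n \<omega>. theta_hat m X Y n L (I n) (\<gamma>hat n \<omega>) (\<alpha>hat n \<omega>) (\<lambda>i. W i \<omega>))"
    and Vhat_def: "Vhat = (\<lambda>n \<omega>. V_hat m X Y n L (I n) (\<gamma>hat n \<omega>) (\<alpha>hat n \<omega>) (\<lambda>i. W i \<omega>))"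
  (* conditions (1) to (8) *)
    and c1: "\<And>j. b j \<in> \<Gamma>"
      "\<And>\<alpha> e. \<alpha> \<in> \<Gamma> \<Longrightarrow> e > 0 \<Longrightarrow>
         \<exists>q \<rho>. (\<integral>w. (\<alpha> (X w) - lin_comb b q \<rho> (X w))\<^sup>2 \<partial>P) < e"
    and c2: "\<exists>C>1. \<exists>\<xi>>0. sparse_approx P X b p \<alpha>bar C \<xi>"
    and c3: "eigenvalue_condition M W P X b p L T"
    and c4: "\<exists>C>0. AE w in P. \<forall>j. \<bar>b j (X w)\<bar> \<le> C"
    and c5: "eps_rate p \<in> o(r)"
      "\<And>c::real. c > 0 \<Longrightarrow> r \<in> o(\<lambda>n. real n powr c * eps_rate p n)"
      "\<exists>C>0. \<forall>n\<ge>1. real (p n) \<le> C * real n powr C"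
    and c6: "\<exists>C. AE w in P.
         \<bar>real_cond_exp P (vimage_algebra (space P) X (borel \<Otimes>\<^sub>M MZ))
            (\<lambda>w. (Y w - \<gamma>bar (X w))\<^sup>2) w\<bar> \<le> C"
      "\<exists>C. AE w in P. \<bar>\<alpha>bar (X w)\<bar> \<le> C"
    and c7: "\<And>l. l < L \<Longrightarrow> with_prob_approaching_one M (\<lambda>n \<omega>. \<gamma>hat n \<omega> l \<in> \<Gamma>)"
      "\<exists>d\<gamma>>0.
         (\<forall>l<L. bigO_in_prob M (\<lambda>n \<omega>. L2_norm P (\<lambda>w. \<gamma>hat n \<omega> l (X w) - \<gamma>bar (X w)))
                  (\<lambda>n. real n powr (- d\<gamma>))) \<and>
         ((\<exists>C>1. \<exists>\<xi>>0. sparse_approx P X b p \<alpha>bar C \<xi> \<and>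
              eigenvalue_condition M W P X b p L T \<and> \<xi> / (2 * \<xi> + 1) + d\<gamma> > 1 / 2) \<or>
          (summable_expansion P X b p \<alpha>bar \<and> d\<gamma> > 1 / 4))"
    and c8: "\<exists>C>0. (\<forall>u. \<bar>score pdf u\<bar> \<le> C) \<and> (AE w in P. inverse (f (D w) (Z w)) * pdf (D w) \<le> C)"
  shows "weak_conv_m (\<lambda>n. distr M borel (\<lambda>\<omega>. sqrt (real n) * (\<theta>hat n \<omega> - \<theta>bar))) (normal_law 0 V)
    \<and> (summable_expansion P X b p \<alpha>bar \<longrightarrow> tendsto_in_prob M Vhat V)"
proof -
  let ?N = "borel \<Otimes>\<^sub>M MZ"
  interpret P: prob_space P by (rule assms(2))
  interpret iid_sample M P W
    using assms(1-4) by (simp add: iid_sample_def iid_sample_axioms_def)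
  note [measurable] = assms(5) assms(7-9)
  have X_meas [measurable]: "X \<in> measurable P ?N" unfolding X_def by measurable
  note closed = assms(19)
  have \<Gamma>: "\<Gamma> \<subseteq> L2_functions P ?N X" using closed by (simp add: closed_L2_subspace_def)
  have \<alpha>bar: "\<alpha>bar \<in> \<Gamma>" and \<gamma>bar: "\<gamma>bar \<in> \<Gamma>"
    using assms(22,23) by (simp_all add: is_arg_min_def)
  note \<Gamma>_diff = closed_L2_subspace_diff[OF closed]
  have pdf_meas [measurable]: "pdf \<in> borel_measurable borel"
  proof -
    have "(\<lambda>u. ennreal (pdf u)) \<in> borel_measurable borel"
      using distributed_borel_measurable[OF assms(16)] by simp
    then have "(\<lambda>u. enn2real (ennreal (pdf u))) \<in> borel_measurable borel" by measurable
    then show ?thesis using assms(14) by simp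
  qed
  have score_meas [measurable]: "score pdf \<in> borel_measurable borel"
    using assms(14,15) by (intro score_measurable pdf_meas) auto
  obtain C8 where C8: "C8 > 0" "\<And>u. \<bar>score pdf u\<bar> \<le> C8"
    "AE w in P. inverse (f (D w) (Z w)) * pdf (D w) \<le> C8" using c8 by blast
  have \<alpha>0_meas [measurable]: "\<alpha>0 \<in> borel_measurable ?N"
  proof -
    have [measurable]: "(\<lambda>x. f (fst x) (snd x)) \<in> borel_measurable ?N"
      using assms(11) by (simp add: split_beta')
    show ?thesis unfolding \<alpha>0_def wad_riesz_def[abs_def] by measurable
  qed
  \<comment> \<open>One factor \<open>C8\<close> bounds the inverse conditional density times
    \<open>pdf\<close>, the other bounds the score.\<close>
  have \<alpha>0_bdd: "AE w in P. \<bar>\<alpha>0 (X w)\<bar> \<le> C8 * C8"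
    using C8(3)
  proof eventually_elim
    case (elim w)
    have "\<bar>\<alpha>0 (X w)\<bar> = (inverse (f (D w) (Z w)) * pdf (D w)) * \<bar>score pdf (D w)\<bar>"
      using assms(12,14) by (simp add: \<alpha>0_def wad_riesz_def X_def abs_mult)
    also have "\<dots> \<le> C8 * C8" using elim C8(1,2) by (intro mult_mono) auto
    finally show ?case .
  qed
  interpret wad: wad_functional P MZ D U Z X pdf \<alpha>0 C8 "C8 * C8"
    by unfold_locales (use X_def C8 \<alpha>0_bdd riesz[unfolded m_def] in auto)
  obtain Cb where Cb: "Cb > 0" "AE w in P. \<forall>j. \<bar>b j (X w)\<bar> \<le> Cb" using c4 by blast
  have b_meas [measurable]: "b j \<in> borel_measurable ?N" for j
    using c1(1)[of j] \<Gamma> by (auto simp: L2_functions_def)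
  interpret dict: bounded_dictionary P ?N X b Cb
    by unfold_locales (use Cb in auto)
  obtain Ca' where Ca': "AE w in P. \<bar>\<alpha>bar (X w)\<bar> \<le> Ca'" using c6(2) by blast
  \<comment> \<open>Enlarged to a positive constant, as \<open>lasso_riesz\<close> asks; the same is
    done for the eigenvalue bound \<open>B\<close>.\<close>
  define Ca where "Ca = max Ca' 1"
  have Ca: "Ca > 0" "AE w in P. \<bar>\<alpha>bar (X w)\<bar> \<le> Ca"
    using Ca' by (auto simp: Ca_def le_max_iff_disj elim: eventually_mono)
  obtain Cv where Cv: "AE w in P. \<bar>real_cond_exp P (vimage_algebra (space P) X ?N)
      (\<lambda>w. (Y w - \<gamma>bar (X w))\<^sup>2) w\<bar> \<le> Cv" using c6(1) by blast
  have \<gamma>bar_meas [measurable]: "\<gamma>bar \<in> borel_measurable ?N" and \<gamma>bar2: "integrable P (\<lambda>w. (\<gamma>bar (X w))\<^sup>2)"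
    using \<gamma>bar \<Gamma> by (auto simp: L2_functions_def)
  have \<alpha>bar_meas [measurable]: "\<alpha>bar \<in> borel_measurable ?N" using \<alpha>bar \<Gamma> by (auto simp: L2_functions_def)
  have orth_\<gamma>: "(\<integral>w. (Y w - \<gamma>bar (X w)) * u (X w) \<partial>P) = 0" if "u \<in> \<Gamma>" for u
    by (rule argmin_orthogonal[OF closed X_meas assms(5,6,23) that])
  have \<alpha>02: "integrable P (\<lambda>w. (\<alpha>0 (X w))\<^sup>2)"
    by (rule dict.integrable_square_bounded[OF _ \<alpha>0_bdd]) simp
  \<comment> \<open>Against elements of \<open>\<Gamma>\<close> the Riesz representer may be
    replaced by its projection, since the difference is orthogonal to
    \<open>\<Gamma>\<close>.\<close>
  have m_riesz: "(\<integral>w. m w u \<partial>P) = (\<integral>w. \<alpha>bar (X w) * u (X w) \<partial>P)" if u: "u \<in> \<Gamma>" for u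
  proof -
    have [measurable]: "u \<in> borel_measurable ?N" and u2: "integrable P (\<lambda>w. (u (X w))\<^sup>2)"
      using u \<Gamma> by (auto simp: L2_functions_def)
    have "(\<integral>w. (\<alpha>0 (X w) - \<alpha>bar (X w)) * u (X w) \<partial>P) = 0"
      by (rule argmin_orthogonal[OF closed X_meas _ \<alpha>02 assms(22) u]) simp
    moreover have "integrable P (\<lambda>w. \<alpha>0 (X w) * u (X w))" "integrable P (\<lambda>w. \<alpha>bar (X w) * u (X w))"
      using \<alpha>02 u2 \<alpha>bar \<Gamma> by (auto intro!: integrable_mult_L2 simp: L2_functions_def)
    moreover have "(\<integral>w. m w u \<partial>P) = (\<integral>w. \<alpha>0 (X w) * u (X w) \<partial>P)" using riesz u \<Gamma> by blast
    ultimately show ?thesis by (simp add: left_diff_distrib)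
  qed
  have T_fin: "finite (T n l)" for n l by (simp add: T_def)
  obtain B' where B': "\<And>n k. n \<ge> 1 \<Longrightarrow> eigenvalue (gram_matrix P X b (p n)) k \<Longrightarrow> k \<le> B'"
    using c3 unfolding eigenvalue_condition_def by blast
  define B where "B = max B' 1"
  have gram: "(\<integral>w. (lin_comb b (p n) v (X w))\<^sup>2 \<partial>P) \<le> B * (\<Sum>j<p n. (v j)\<^sup>2)" if "n \<ge> 1" for n v
    unfolding dict.quad_form_gram[symmetric]
  proof (rule quad_form_le_eigenvalue_bound)
    fix k assume "eigenvalue (mat (p n) (p n) (\<lambda>(j, k). \<integral>w. b j (X w) * b k (X w) \<partial>P)) k"
    then show "k \<le> B" using B'[OF that] unfolding gram_matrix_def B_def by (simp add: le_max_iff_disj)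
  qed (simp add: mult.commute)
  have lasso_riesz: "lasso_riesz M P W ?N X b Cb m \<alpha>bar p r (\<lambda>n. T n l) (\<lambda>n \<omega>. \<rho>hat n \<omega> l) (C8 * Cb) Ca (1 / 4) B"
    if l: "l < L" for l
  proof unfold_locales
    show "(\<lambda>w. m w (b j)) \<in> borel_measurable P" for j
      unfolding m_def by (rule wad.wad_moment_measurable) simp
    show "AE w in P. \<bar>m w (b j)\<bar> \<le> C8 * Cb" for j
      unfolding m_def using Cb by (intro wad.AE_wad_moment_bounded) (auto elim: eventually_mono)
    show "(\<integral>w. m w (b j) \<partial>P) = (\<integral>w. \<alpha>bar (X w) * b j (X w) \<partial>P)" for j by (rule m_riesz[OF c1(1)])
    show "eventually (\<lambda>n. 1 / 4 * real n \<le> real (card (T n l))) sequentially"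
      unfolding T_def by (rule training_set_large[OF assms(30,29) l])
  qed (use C8 Cb Ca assms(27,28) assms(36)[OF l] c5 T_fin gram in \<open>auto simp: B_def\<close>)
  obtain d\<gamma> where d\<gamma>: "d\<gamma> > 0"
    "\<And>l. l < L \<Longrightarrow> bigO_in_prob M (\<lambda>n \<omega>. L2_norm P (\<lambda>w. \<gamma>hat n \<omega> l (X w) - \<gamma>bar (X w))) (\<lambda>n. real n powr (- d\<gamma>))"
    and alt: "(\<exists>C>1. \<exists>\<xi>>0. sparse_approx P X b p \<alpha>bar C \<xi> \<and>
              eigenvalue_condition M W P X b p L T \<and> \<xi> / (2 * \<xi> + 1) + d\<gamma> > 1 / 2) \<or>
          (summable_expansion P X b p \<alpha>bar \<and> d\<gamma> > 1 / 4)"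
    using c7(2) by blast
  \<comment> \<open>\<open>d\<alpha>\<close> is the rate exponent of the Lasso:
    \<open>\<xi> / (2 * \<xi> + 1)\<close> in the sparse alternative and \<open>1 / 4\<close> in the
    summable one. In both cases its sum with \<open>d\<gamma>\<close> exceeds one half.\<close>
  obtain d\<alpha> where d\<alpha>: "d\<alpha> > 0" "d\<alpha> + d\<gamma> > 1 / 2"
    "\<And>\<kappa> l. \<kappa> > 0 \<Longrightarrow> l < L \<Longrightarrow> with_prob_approaching_one M (\<lambda>n \<omega>.
      L2_norm P (\<lambda>w. \<alpha>bar (X w) - lin_comb b (p n) (\<rho>hat n \<omega> l) (X w)) \<le> real n powr (\<kappa> - d\<alpha>))"
    using alt
  proof
    assume "\<exists>C>1. \<exists>\<xi>>0. sparse_approx P X b p \<alpha>bar C \<xi> \<and>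
      eigenvalue_condition M W P X b p L T \<and> \<xi> / (2 * \<xi> + 1) + d\<gamma> > 1 / 2"
    then obtain C \<xi> where C: "C > 1" "\<xi> > 0" "sparse_approx P X b p \<alpha>bar C \<xi>"
      "\<xi> / (2 * \<xi> + 1) + d\<gamma> > 1 / 2" by blast
    obtain C' c where C': "C' > 0" "c > 0" "\<And>l S. l < L \<Longrightarrow> (\<lambda>n. real (S n) * (eps_rate p n)\<^sup>2) \<longlonglongrightarrow> C' \<Longrightarrow>
      with_prob_approaching_one M (\<lambda>n \<omega>. restricted_eigenvalue_ge (p n) (G_hat X b (T n l) (\<lambda>i. W i \<omega>)) (S n) c)"
      using c3 unfolding eigenvalue_condition_def by blast
    show thesis
    proof (rule that[of "\<xi> / (2 * \<xi> + 1)"])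
      fix \<kappa> :: real and l assume "\<kappa> > 0" "l < L"
      show "with_prob_approaching_one M (\<lambda>n \<omega>. L2_norm P (\<lambda>w. \<alpha>bar (X w) - lin_comb b (p n) (\<rho>hat n \<omega> l) (X w))
          \<le> real n powr (\<kappa> - \<xi> / (2 * \<xi> + 1)))"
        by (rule lasso_riesz.sparse_rate[OF lasso_riesz[OF \<open>l < L\<close>] C(3,1,2) C'(1,2) C'(3)[OF \<open>l < L\<close>] \<open>\<kappa> > 0\<close>])
    qed (use C in auto)
  next
    assume summ: "summable_expansion P X b p \<alpha>bar \<and> d\<gamma> > 1 / 4"
    show thesis
    proof (rule that[of "1 / 4"])
      fix \<kappa> :: real and l assume "\<kappa> > 0" "l < L"
      show "with_prob_approaching_one M (\<lambda>n \<omega>. L2_norm P (\<lambda>w. \<alpha>bar (X w) - lin_comb b (p n) (\<rho>hat n \<omega> l) (X w))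
          \<le> real n powr (\<kappa> - 1 / 4))"
        by (rule lasso_riesz.summable_rate(1)[OF lasso_riesz[OF \<open>l < L\<close>] summ[THEN conjunct1] \<open>\<kappa> > 0\<close>])
    qed (use summ in auto)
  qed
  \<comment> \<open>Both exponents are lowered by \<open>\<kappa>\<close>. A quarter of the surplus
    of their sum over one half leaves a positive surplus, and half of each exponent keeps both
    positive.\<close>
  define \<kappa> where "\<kappa> = min ((d\<alpha> + d\<gamma> - 1 / 2) / 4) (min (d\<alpha> / 2) (d\<gamma> / 2))"
  have "\<kappa> \<le> (d\<alpha> + d\<gamma> - 1 / 2) / 4" "\<kappa> \<le> d\<alpha> / 2" "\<kappa> \<le> d\<gamma> / 2"
    unfolding \<kappa>_def by (rule min.cobounded1, (rule min.coboundedI2, simp)+)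
  moreover have "\<kappa> > 0" using d\<alpha>(1,2) d\<gamma>(1) by (simp add: \<kappa>_def)
  moreover have "4 * \<kappa> \<le> d\<alpha> + d\<gamma> - 1 / 2" using calculation(1) by simp
  ultimately have \<kappa>: "\<kappa> > 0" "\<kappa> < d\<alpha>" "\<kappa> < d\<gamma>" "(d\<alpha> - \<kappa>) + (d\<gamma> - \<kappa>) > 1 / 2"
    using d\<alpha>(1,2) d\<gamma>(1) by simp_all
  have \<gamma>_X_meas: "(\<lambda>(d, w). \<gamma>learn n l d (X w) - \<gamma>bar (X w)) \<in> borel_measurable (PiM (T n l) (\<lambda>_. P) \<Otimes>\<^sub>M P)"
    if "l < L" for n l
  proof -
    have "(\<lambda>x. (fst x, X (snd x))) \<in> measurable (PiM (T n l) (\<lambda>_. P) \<Otimes>\<^sub>M P) (PiM (T n l) (\<lambda>_. P) \<Otimes>\<^sub>M ?N)"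
      by measurable
    from measurable_compose[OF this assms(32)[OF that]] show ?thesis by (simp add: split_beta')
  qed
  have \<gamma>_rate: "with_prob_approaching_one M (\<lambda>n \<omega>. \<gamma>learn n l (sample (T n l) \<omega>) \<in> \<Gamma> \<and>
      L2_norm P (\<lambda>w. \<gamma>learn n l (sample (T n l) \<omega>) (X w) - \<gamma>bar (X w)) \<le> real n powr (- (d\<gamma> - \<kappa>)))"
    if l: "l < L" for l
  proof (rule with_prob_approaching_one_conj[OF assms(1)])
    show "with_prob_approaching_one M (\<lambda>n \<omega>. \<gamma>learn n l (sample (T n l) \<omega>) \<in> \<Gamma>)"
      using c7(1)[OF l] by (simp add: \<gamma>hat_def)
    show "with_prob_approaching_one M (\<lambda>n \<omega>.
        L2_norm P (\<lambda>w. \<gamma>learn n l (sample (T n l) \<omega>) (X w) - \<gamma>bar (X w)) \<le> real n powr (- (d\<gamma> - \<kappa>)))"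
    proof (rule bigO_in_prob_imp_with_prob_approaching_one[OF assms(1)])
      show "bigO_in_prob M (\<lambda>n \<omega>. L2_norm P (\<lambda>w. \<gamma>learn n l (sample (T n l) \<omega>) (X w) - \<gamma>bar (X w)))
          (\<lambda>n. real n powr (- d\<gamma>))"
        using d\<gamma>(2)[OF l] by (simp add: \<gamma>hat_def)
      show "(\<lambda>\<omega>. L2_norm P (\<lambda>w. \<gamma>learn n l (sample (T n l) \<omega>) (X w) - \<gamma>bar (X w))) \<in> borel_measurable M" for n
      proof -
        note \<gamma>_X_meas[OF l, of n, measurable]
        have "(\<lambda>d. L2_norm P (\<lambda>w. \<gamma>learn n l d (X w) - \<gamma>bar (X w))) \<in> borel_measurable (PiM (T n l) (\<lambda>_. P))"
          unfolding L2_norm_def by measurable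
        then show ?thesis by (rule measurable_compose[OF sample_measurable])
      qed
    qed (use \<kappa> in auto)
  qed
  interpret ad: auto_debiased M P W ?N X b Cb m Y \<Gamma> \<alpha>bar \<gamma>bar p L I T \<gamma>learn \<rho>learn
      "C8 * (C8 * C8)" Ca "max Cv 0" "d\<alpha> - \<kappa>" "d\<gamma> - \<kappa>"
  proof unfold_locales
    \<comment> \<open>The moment evaluates \<open>h d\<close> at \<open>(U, Z)\<close>, so joint
      measurability comes from composing with that map.\<close>
    show "(\<lambda>(d, w). m w (h d)) \<in> borel_measurable (PiM T' (\<lambda>_. P) \<Otimes>\<^sub>M P)"
      if h: "(\<lambda>(d, x). h d x) \<in> borel_measurable (PiM T' (\<lambda>_. P) \<Otimes>\<^sub>M ?N)" for T' :: "nat set" and h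
    proof -
      have "(\<lambda>x. (fst x, (U (snd x), Z (snd x)))) \<in> measurable (PiM T' (\<lambda>_. P) \<Otimes>\<^sub>M P) (PiM T' (\<lambda>_. P) \<Otimes>\<^sub>M ?N)"
        by measurable
      from measurable_compose[OF this h]
      have [measurable]: "(\<lambda>x. h (fst x) (U (snd x), Z (snd x))) \<in> borel_measurable (PiM T' (\<lambda>_. P) \<Otimes>\<^sub>M P)"
        by (simp add: split_beta')
      show ?thesis unfolding m_def wad_moment_def split_beta' by measurable
    qed
    show "(\<integral>w. (u (X w))\<^sup>2 * (Y w - \<gamma>bar (X w))\<^sup>2 \<partial>P) \<le> max Cv 0 * (\<integral>w. (u (X w))\<^sup>2 \<partial>P)"
      if "u \<in> borel_measurable ?N" "AE w in P. \<bar>u (X w)\<bar> \<le> K" for u K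
    proof (rule cond_exp_bounded_imp_integral_le[OF assms(2) X_meas that _ _ Cv])
      show "integrable P (\<lambda>w. (Y w - \<gamma>bar (X w))\<^sup>2)"
        by (rule integrable_add_square(2)) (use assms(6) \<gamma>bar2 in auto)
    qed simp
    show "m w (\<lambda>x. u x - v x) = m w u - m w v" for w u v
      by (simp add: m_def wad_moment_def right_diff_distrib)
    show "(\<lambda>w. m w u) \<in> borel_measurable P" if "u \<in> borel_measurable ?N" for u
      unfolding m_def using that by (rule wad.wad_moment_measurable)
    show "integrable P (\<lambda>w. (m w u)\<^sup>2)" if "u \<in> L2_functions P ?N X" for u
      unfolding m_def using that by (rule wad.integrable_wad_moment_square)
    show "(\<integral>w. (m w u)\<^sup>2 \<partial>P) \<le> C8 * (C8 * C8) * (\<integral>w. (u (X w))\<^sup>2 \<partial>P)" if "u \<in> L2_functions P ?N X" for u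
      unfolding m_def using that by (rule wad.wad_moment_square_le)
    show "lin_comb b q \<rho> \<in> \<Gamma>" for q \<rho> by (rule closed_L2_subspace_lin_comb[OF closed c1(1)])
    show "\<And>n. (\<Union>l<L. I n l) = {..<n}" "\<And>n. disjoint_family_on (I n) {..<L}"
      using assms(30) by (auto simp: cross_fit_folds_def)
    show "with_prob_approaching_one M (\<lambda>n \<omega>.
        L2_norm P (\<lambda>w. \<alpha>bar (X w) - lin_comb b (p n) (\<rho>learn n l (sample (T n l) \<omega>)) (X w))
          \<le> real n powr (- (d\<alpha> - \<kappa>)))" if "l < L" for l
      using d\<alpha>(3)[OF \<kappa>(1) that] by (simp add: \<rho>hat_def)
  qed (use C8(1) Ca \<kappa> \<Gamma> \<Gamma>_diff \<alpha>bar \<gamma>bar m_riesz orth_\<gamma> \<gamma>_rate assms(5,6,31,32,34) in auto)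
  have \<theta>: "ad.\<theta>0 = \<theta>bar" by (simp add: ad.\<theta>0_def \<theta>bar_def)
  have \<psi>: "ad.\<psi> = \<psi>" by (rule ext) (simp add: ad.\<psi>_def \<theta> \<psi>_def)
  have est: "ad.estimator = \<theta>hat"
    by (intro ext) (simp add: ad.estimator_def \<theta>hat_def \<gamma>hat_def \<alpha>hat_def \<rho>hat_def)
  have var: "ad.variance_estimator = Vhat"
    by (intro ext) (simp add: ad.variance_estimator_def Vhat_def \<gamma>hat_def \<alpha>hat_def \<rho>hat_def)
  show ?thesis
  proof
    show "weak_conv_m (\<lambda>n. distr M borel (\<lambda>\<omega>. sqrt (real n) * (\<theta>hat n \<omega> - \<theta>bar))) (normal_law 0 V)"
      using ad.asymptotic_normality by (simp add: \<theta> \<psi> est V_def)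
    show "summable_expansion P X b p \<alpha>bar \<longrightarrow> tendsto_in_prob M Vhat V"
    proof
      assume summ: "summable_expansion P X b p \<alpha>bar"
      \<comment> \<open>Each fold brings its own coefficient bound; the sum of these bounds serves
        all folds simultaneously.\<close>
      define K where "K = (\<lambda>l. SOME k. k > 0 \<and>
        with_prob_approaching_one M (\<lambda>n \<omega>. (\<Sum>j<p n. \<bar>\<rho>hat n \<omega> l j\<bar>) \<le> k))"
      have K: "K l > 0 \<and> with_prob_approaching_one M (\<lambda>n \<omega>. (\<Sum>j<p n. \<bar>\<rho>hat n \<omega> l j\<bar>) \<le> K l)"
        if "l < L" for l
        unfolding K_def by (rule someI_ex[OF lasso_riesz.summable_rate(2)[OF lasso_riesz[OF that] summ]])
      define K' where "K' = (\<Sum>l<L. K l)"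
      have le: "K l \<le> K'" if "l < L" for l
        unfolding K'_def using K that by (intro member_le_sum) (auto intro: less_imp_le)
      have "0 < L" using assms(29) by simp
      then have "K' > 0" using K le by force
      have "with_prob_approaching_one M (\<lambda>n \<omega>. (\<Sum>j<p n. \<bar>\<rho>learn n l (sample (T n l) \<omega>) j\<bar>) \<le> K')" if "l < L" for l
        using K[OF that, THEN conjunct2]
        by (rule with_prob_approaching_one_mono) (use le[OF that] in \<open>auto simp: \<rho>hat_def intro: order_trans\<close>)
      then show "tendsto_in_prob M Vhat V"
        using ad.variance_consistency[OF \<open>K' > 0\<close>] by (simp add: \<psi> var V_def)
    qed
  qed
qed

end
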